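(* If $K\subseteq\mathbb R^d$ is a simplex, then the unique matrix convex set $K_{\rm nc}=\bigsqcup_n K_n$ for which $K_1=K$ (namely $K_{\rm nc}=K^{\rm min}=K^{\rm max}$) has Smith-Ward geometry.
   Context: $\mathbb B$ is the C$^*$-algebra of bounded linear operators on $\ell^2(\mathbb N)$ and $\mathbb K$ is the ideal of compact operators. For a $d$-tuple $\mathfrak x$ of elements of a unital C$^*$-algebra, $\mathcal O_{\mathfrak x}=\mathrm{Span}\{1,x_1,x_1^*,\dots,x_d,x_d^*\}$. The matrix range is $W(\mathfrak x)=\bigsqcup_n W_n(\mathfrak x)$, $W_n(\mathfrak x)=\{(\phi(x_1),\dots,\phi(x_d)) : \phi:\mathrm C^*(\mathcal O_{\mathfrak x})\to M_n(\mathbb C)\text{ unital completely positive}\}$. For $\mathfrak x\in\mathbb B^d$, the essential matrix range $W_{\rm e}(\mathfrak x)=\bigsqcup_n W_{n,{\rm e}}(\mathfrak x)$ is defined in the same way but using only those $\phi$ that vanish on every compact operator in $\mathrm C^*(\mathcal O_{\mathfrak x})$; it equals the matrix range of the image of $\mathfrak x$ in $\mathbb B/\mathbb K$. A tuple $\mathfrak x\in\mathbb B^d$ has the Smith-Ward property if $W_{\rm e}(\mathfrak x)=W(\mathfrak x+\mathfrak k)$ for some $\mathfrak k\in\mathbb K^d$. A compact matrix convex set is a graded set $K_{\rm nc}=\bigsqcup_n K_n$, $K_n\subseteq M_n(\mathbb C)^d$ compact, such that $\sum_{j=1}^m\gamma_j^*\mathfrak a_j\gamma_j\in K_n$ whenever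 $\mathfrak a_j\in K_{n_j}$ and $\gamma_j:\mathbb C^n\to\mathbb C^{n_j}$ are linear with $\sum_j\gamma_j^*\gamma_j=1_n$. It has Smith-Ward geometry if every tuple $\mathfrak x\in\mathbb B^d$ with $W_{\rm e}(\mathfrak x)=K_{\rm nc}$ has the Smith-Ward property. For a compact convex set $K\subseteq\mathbb R^d$ or $\mathbb C^d$: $K_n^{\rm max}$ is the set of $d$-tuples $\mathfrak a$ of $n\times n$ matrices with $W_1(\mathfrak a)\subseteq K$; $K_n^{\rm min}$ is the set of $d$-tuples $\mathfrak a=(a_1,\dots,a_d)$ of $n\times n$ matrices for which there are positive $h_1,\dots,h_m\in M_n(\mathbb C)$ and $\lambda_j=(\lambda_{j1},\dots,\lambda_{jd})\in K$ with $\sum_j h_j=1_n$ and $a_\ell=\sum_j\lambda_{j\ell}h_j$ for all $\ell$. $K^{\rm min}=\bigsqcup_nK_n^{\rm min}$ and $K^{\rm max}=\bigsqcup_nK_n^{\rm max}$ are the smallest and largest compact matrix convex sets with first level $K$. It is a known fact that $K^{\rm min}=K^{\rm max}$ when $K$ is a simplex, so there is exactly one matrix convex set with first level $K$. *)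

theory Defs
  imports
    "HOL-Analysis.Analysis"
    "Jordan_Normal_Form.Schur_Decomposition"
begin

section \<open>The Hilbert space of square-summable complex sequences\<close>

typedef ell2 = "{f :: nat \<Rightarrow> complex. summable (\<lambda>n. (cmod (f n))\<^sup>2)}"
  morphisms ell2_coord Abs_ell2
  by (rule exI[of _ "\<lambda>_. 0"]) simp

setup_lifting type_definition_ell2

lemma summable_cmod_add:
  fixes f g :: "nat \<Rightarrow> complex"
  assumes "summable (\<lambda>n. (cmod (f n))\<^sup>2)" "summable (\<lambda>n. (cmod (g n))\<^sup>2)"
  shows "summable (\<lambda>n. (cmod (f n + g n))\<^sup>2)"
proof (rule summable_comparison_test')
  show "summable (\<lambda>n. 2 * (cmod (f n))\<^sup>2 + 2 * (cmod (g n))\<^sup>2)"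
    using assms by (intro summable_add summable_mult)
  fix n
  have "(cmod (f n + g n))\<^sup>2 \<le> (cmod (f n) + cmod (g n))\<^sup>2"
    by (intro power_mono norm_triangle_ineq norm_ge_zero)
  also have "\<dots> \<le> 2 * (cmod (f n))\<^sup>2 + 2 * (cmod (g n))\<^sup>2"
    using sum_squares_bound[of "cmod (f n)" "cmod (g n)"] by (simp add: power2_sum)
  finally show "norm ((cmod (f n + g n))\<^sup>2) \<le> 2 * (cmod (f n))\<^sup>2 + 2 * (cmod (g n))\<^sup>2"
    by simp
qed

lemma summable_ell2_prod:
  fixes f g :: "nat \<Rightarrow> complex"
  assumes "summable (\<lambda>n. (cmod (f n))\<^sup>2)" "summable (\<lambda>n. (cmod (g n))\<^sup>2)"
  shows "summable (\<lambda>n. f n * cnj (g n))"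
proof (rule summable_comparison_test')
  show "summable (\<lambda>n. (cmod (f n))\<^sup>2 + (cmod (g n))\<^sup>2)"
    using assms by (intro summable_add)
  fix n
  have "0 \<le> cmod (f n) * cmod (g n)" by simp
  then show "norm (f n * cnj (g n)) \<le> (cmod (f n))\<^sup>2 + (cmod (g n))\<^sup>2"
    using sum_squares_bound[of "cmod (f n)" "cmod (g n)"]
    unfolding norm_mult complex_mod_cnj by linarith
qed

lift_definition cscale :: "complex \<Rightarrow> ell2 \<Rightarrow> ell2" is "\<lambda>c f n. c * f n"
  by (simp add: norm_mult power_mult_distrib summable_mult)

text \<open>Inner products are linear in the first argument.\<close>

lift_definition cip :: "ell2 \<Rightarrow> ell2 \<Rightarrow> complex" is "\<lambda>f g. \<Sum>n. f n * cnj (g n)" .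

instantiation ell2 :: real_inner
begin

lift_definition zero_ell2 :: ell2 is "\<lambda>_. 0" by simp
lift_definition plus_ell2 :: "ell2 \<Rightarrow> ell2 \<Rightarrow> ell2" is "\<lambda>f g n. f n + g n"
  by (rule summable_cmod_add)
lift_definition uminus_ell2 :: "ell2 \<Rightarrow> ell2" is "\<lambda>f n. - f n" by simp
definition minus_ell2 :: "ell2 \<Rightarrow> ell2 \<Rightarrow> ell2" where "minus_ell2 f g = f + (- g)"
definition scaleR_ell2 :: "real \<Rightarrow> ell2 \<Rightarrow> ell2" where "scaleR_ell2 r = cscale (of_real r)"
definition inner_ell2 :: "ell2 \<Rightarrow> ell2 \<Rightarrow> real" where "inner_ell2 f g = Re (cip f g)"
definition norm_ell2 :: "ell2 \<Rightarrow> real" where "norm_ell2 f = sqrt (inner f f)"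
definition sgn_ell2 :: "ell2 \<Rightarrow> ell2" where "sgn_ell2 f = scaleR (inverse (norm f)) f"
definition dist_ell2 :: "ell2 \<Rightarrow> ell2 \<Rightarrow> real" where "dist_ell2 f g = norm (f - g)"
definition uniformity_ell2 :: "(ell2 \<times> ell2) filter" where
  "uniformity_ell2 = (INF e\<in>{0<..}. principal {(x, y). dist x y < e})"
definition open_ell2 :: "ell2 set \<Rightarrow> bool" where
  "open_ell2 U = (\<forall>x\<in>U. \<forall>\<^sub>F (x', y) in uniformity. x' = x \<longrightarrow> y \<in> U)"

lemma inner_ell2_eq: "inner f g = (\<Sum>n. Re (ell2_coord f n * cnj (ell2_coord g n)))"
  unfolding inner_ell2_def cip.rep_eq
  using ell2_coord[of f] ell2_coord[of g]
  by (subst Re_suminf[symmetric]) (auto intro: summable_ell2_prod)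

lemma summable_inner_ell2: "summable (\<lambda>n. Re (ell2_coord f n * cnj (ell2_coord g n)))"
  using summable_Re summable_ell2_prod ell2_coord[of f] ell2_coord[of g] by blast

instance
proof
  fix a b c :: ell2 and r s :: real
  show "a + b + c = a + (b + c)" by transfer (simp add: add.assoc)
  show "a + b = b + a" by transfer (simp add: add.commute)
  show "0 + a = a" by transfer simp
  show "- a + a = 0" by transfer simp
  show "a - b = a + - b" by (simp add: minus_ell2_def)
  show "r *\<^sub>R (a + b) = r *\<^sub>R a + r *\<^sub>R b"
    unfolding scaleR_ell2_def by transfer (simp add: algebra_simps)
  show "(r + s) *\<^sub>R a = r *\<^sub>R a + s *\<^sub>R a"
    unfolding scaleR_ell2_def by transfer (simp add: algebra_simps)
  show "r *\<^sub>R s *\<^sub>R a = (r * s) *\<^sub>R a"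
    unfolding scaleR_ell2_def by transfer (simp add: algebra_simps)
  show "1 *\<^sub>R a = a" unfolding scaleR_ell2_def by transfer simp
  show "sgn a = scaleR (inverse (norm a)) a" by (simp add: sgn_ell2_def)
  show "dist a b = norm (a - b)" by (simp add: dist_ell2_def)
  show "uniformity = (INF e\<in>{0<..}. principal {(x :: ell2, y). dist x y < e})"
    by (simp add: uniformity_ell2_def)
  show "open U = (\<forall>x\<in>U. \<forall>\<^sub>F (x', y) in uniformity. x' = x \<longrightarrow> y \<in> U)" for U :: "ell2 set"
    by (simp add: open_ell2_def)
  show "norm a = sqrt (inner a a)" by (simp add: norm_ell2_def)
  show "inner a b = inner b a"
    unfolding inner_ell2_eq by (rule suminf_cong) (simp add: mult.commute)
  show "inner (a + b) c = inner a c + inner b c"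
    unfolding inner_ell2_eq
    by (subst suminf_add[OF summable_inner_ell2 summable_inner_ell2])
      (simp add: plus_ell2.rep_eq algebra_simps)
  show "inner (r *\<^sub>R a) b = r * inner a b"
    unfolding inner_ell2_eq
    by (subst suminf_mult[OF summable_inner_ell2, symmetric])
      (simp add: scaleR_ell2_def cscale.rep_eq algebra_simps)
  have nn: "0 \<le> Re (ell2_coord a n * cnj (ell2_coord a n))" for n by simp
  show "0 \<le> inner a a"
    unfolding inner_ell2_eq by (rule suminf_nonneg[OF summable_inner_ell2 nn])
  show "(inner a a = 0) = (a = 0)"
    unfolding inner_ell2_eq suminf_eq_zero_iff[OF summable_inner_ell2 nn]
  proof
    assume *: "\<forall>n. Re (ell2_coord a n * cnj (ell2_coord a n)) = 0"
    have "ell2_coord a n = 0" for n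
      using spec[OF *, of n] by (simp add: complex_eq_iff sum_squares_eq_zero_iff)
    then show "a = 0" by (simp add: ell2_coord_inject[symmetric] zero_ell2.rep_eq fun_eq_iff)
  next
    assume "a = 0"
    then show "\<forall>n. Re (ell2_coord a n * cnj (ell2_coord a n)) = 0"
      by (simp add: zero_ell2.rep_eq)
  qed
qed

end

lemma cmod_coord_square: "(norm f)\<^sup>2 = (\<Sum>n. (cmod (ell2_coord f n))\<^sup>2)"
proof -
  have "(norm f)\<^sup>2 = inner f f" by (simp add: power2_norm_eq_inner)
  also have "\<dots> = (\<Sum>n. (cmod (ell2_coord f n))\<^sup>2)"
    unfolding inner_ell2_eq
    by (rule suminf_cong) (simp only: cmod_power2, simp add: power2_eq_square)
  finally show ?thesis .
qed

lemma norm_cscale: "norm (cscale c f) = cmod c * norm f"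
proof -
  have "(norm (cscale c f))\<^sup>2 = (cmod c * norm f)\<^sup>2"
    unfolding power_mult_distrib cmod_coord_square
    using ell2_coord[of f]
    by (simp add: cscale.rep_eq norm_mult power_mult_distrib suminf_mult)
  then show ?thesis by (simp add: power2_eq_iff_nonneg)
qed

lemma bounded_linear_cscale: "bounded_linear (cscale c)"
proof (rule bounded_linear_intro[where K = "cmod c"])
  show "cscale c (x + y) = cscale c x + cscale c y" for x y
    by transfer (simp add: algebra_simps)
  show "cscale c (r *\<^sub>R x) = r *\<^sub>R cscale c x" for r x
    unfolding scaleR_ell2_def by transfer (simp add: algebra_simps)
  show "norm (cscale c x) \<le> norm x * cmod c" for x
    by (simp add: norm_cscale mult.commute)
qed

section \<open>Bounded and compact operators\<close>

text \<open>\<open>\<Rightarrow>\<^sub>L\<close> only requires real linearity, so complex linearity is imposed separately.\<close>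

definition bounded_ops :: "(ell2 \<Rightarrow>\<^sub>L ell2) set" where
  "bounded_ops = {T. \<forall>c v. blinfun_apply T (cscale c v) = cscale c (blinfun_apply T v)}"

definition cscale_op :: "complex \<Rightarrow> (ell2 \<Rightarrow>\<^sub>L ell2) \<Rightarrow> (ell2 \<Rightarrow>\<^sub>L ell2)" where
  "cscale_op c T = Blinfun (\<lambda>v. cscale c (blinfun_apply T v))"

lemma blinfun_apply_cscale_op [simp]:
  "blinfun_apply (cscale_op c T) v = cscale c (blinfun_apply T v)"
  unfolding cscale_op_def
  by (simp add: bounded_linear_Blinfun_apply
      bounded_linear_compose[OF bounded_linear_cscale blinfun.bounded_linear_right])

definition adj_op :: "(ell2 \<Rightarrow>\<^sub>L ell2) \<Rightarrow> (ell2 \<Rightarrow>\<^sub>L ell2)" where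
  "adj_op T = (THE S. S \<in> bounded_ops \<and>
     (\<forall>v w. cip (blinfun_apply T v) w = cip v (blinfun_apply S w)))"

definition compact_op :: "(ell2 \<Rightarrow>\<^sub>L ell2) \<Rightarrow> bool" where
  "compact_op T \<longleftrightarrow> T \<in> bounded_ops \<and> compact (closure (blinfun_apply T ` cball 0 1))"

section \<open>C*-algebras of operators\<close>

text \<open>
  A value of the following record is the algebra of all bounded operators on a Hilbert space,
  given with its action on that space. The two instances that matter are the bounded operators
  on \<open>ell2\<close> and, for each \<open>n\<close>, the complex \<open>n \<times> n\<close> matrices acting on column vectors; the
  dimension \<open>n\<close> is a value here, because a graded set ranges over all \<open>n\<close>.
\<close>

record ('a, 'v) op_alg =
  ops :: "'a set"
  add :: "'a \<Rightarrow> 'a \<Rightarrow> 'a"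
  scl :: "complex \<Rightarrow> 'a \<Rightarrow> 'a"
  mul :: "'a \<Rightarrow> 'a \<Rightarrow> 'a"
  adj :: "'a \<Rightarrow> 'a"
  unt :: 'a
  vecs :: "'v set"
  app :: "'a \<Rightarrow> 'v \<Rightarrow> 'v"
  ip :: "'v \<Rightarrow> 'v \<Rightarrow> complex"

definition BH :: "(ell2 \<Rightarrow>\<^sub>L ell2, ell2) op_alg" where
  "BH = \<lparr>ops = bounded_ops, add = (+), scl = cscale_op, mul = (o\<^sub>L), adj = adj_op,
     unt = id_blinfun, vecs = UNIV, app = blinfun_apply, ip = cip\<rparr>"

definition Mat :: "nat \<Rightarrow> (complex mat, complex Matrix.vec) op_alg" where
  "Mat n = \<lparr>ops = carrier_mat n n, add = (+), scl = (\<cdot>\<^sub>m), mul = (*), adj = mat_adjoint,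
     unt = 1\<^sub>m n, vecs = carrier_vec n, app = (*\<^sub>v), ip = (\<lambda>v w. v \<bullet>c w)\<rparr>"

definition op_norm :: "('a, 'v) op_alg \<Rightarrow> 'a \<Rightarrow> real" where
  "op_norm R T = Sup {sqrt (Re (ip R (app R T v) (app R T v))) | v.
     v \<in> vecs R \<and> Re (ip R v v) \<le> 1}"

definition lin_subspace :: "('a, 'v) op_alg \<Rightarrow> 'a set \<Rightarrow> bool" where
  "lin_subspace R V \<longleftrightarrow> V \<subseteq> ops R \<and> V \<noteq> {} \<and>
     (\<forall>S\<in>V. \<forall>T\<in>V. add R S T \<in> V) \<and> (\<forall>c. \<forall>T\<in>V. scl R c T \<in> V)"

definition cstar_subalg :: "('a, 'v) op_alg \<Rightarrow> 'a set \<Rightarrow> bool" where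
  "cstar_subalg R A \<longleftrightarrow> lin_subspace R A \<and>
     (\<forall>S\<in>A. \<forall>T\<in>A. mul R S T \<in> A) \<and> (\<forall>T\<in>A. adj R T \<in> A) \<and>
     (\<forall>S T. (\<forall>m::nat. S m \<in> A) \<and> T \<in> ops R \<and>
        (\<lambda>m. op_norm R (add R (S m) (scl R (-1) T))) \<longlonglongrightarrow> 0 \<longrightarrow> T \<in> A)"

definition op_system :: "('a, 'v) op_alg \<Rightarrow> ('d \<Rightarrow> 'a) \<Rightarrow> 'a set" where
  "op_system R x = \<Inter>{V. lin_subspace R V \<and> unt R \<in> V \<and> (\<forall>i. x i \<in> V \<and> adj R (x i) \<in> V)}"

definition cstar_gen :: "('a, 'v) op_alg \<Rightarrow> 'a set \<Rightarrow> 'a set" where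
  "cstar_gen R S = \<Inter>{A. cstar_subalg R A \<and> S \<subseteq> A}"

section \<open>Unital completely positive maps and matrix ranges\<close>

text \<open>
  Positivity of the \<open>k \<times> k\<close> operator matrix with entries \<open>F i j\<close>, acting on the direct sum of
  \<open>k\<close> copies of the Hilbert space.
\<close>

definition mat_positive :: "('a, 'v) op_alg \<Rightarrow> nat \<Rightarrow> (nat \<Rightarrow> nat \<Rightarrow> 'a) \<Rightarrow> bool" where
  "mat_positive R k F \<longleftrightarrow>
     (\<forall>i<k. \<forall>j<k. F i j \<in> ops R) \<and>
     (\<forall>\<xi>. (\<forall>i<k. \<xi> i \<in> vecs R) \<longrightarrow>
        (\<Sum>i<k. \<Sum>j<k. ip R (app R (F i j) (\<xi> j)) (\<xi> i)) \<in> \<real>\<^sub>\<ge>\<^sub>0)"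

definition positive :: "('a, 'v) op_alg \<Rightarrow> 'a \<Rightarrow> bool" where
  "positive R T \<longleftrightarrow> T \<in> ops R \<and> (\<forall>v\<in>vecs R. ip R (app R T v) v \<in> \<real>\<^sub>\<ge>\<^sub>0)"

definition ucp :: "('a, 'v) op_alg \<Rightarrow> 'a set \<Rightarrow> nat \<Rightarrow> ('a \<Rightarrow> complex mat) \<Rightarrow> bool" where
  "ucp R A n \<phi> \<longleftrightarrow>
     (\<forall>T\<in>A. \<phi> T \<in> carrier_mat n n) \<and>
     (\<forall>S\<in>A. \<forall>T\<in>A. \<phi> (add R S T) = \<phi> S + \<phi> T) \<and>
     (\<forall>c. \<forall>T\<in>A. \<phi> (scl R c T) = c \<cdot>\<^sub>m \<phi> T) \<and>
     \<phi> (unt R) = 1\<^sub>m n \<and>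
     (\<forall>k F. (\<forall>i<k. \<forall>j<k. F i j \<in> A) \<and> mat_positive R k F \<longrightarrow>
        mat_positive (Mat n) k (\<lambda>i j. \<phi> (F i j)))"

text \<open>
  A graded set is represented by one set of tuples of matrices; the disjoint union over
  \<open>n \<ge> 1\<close> is a plain union because a matrix carries its dimensions.
\<close>

type_synonym 'd tuple = "'d \<Rightarrow> complex mat"

definition tuples :: "nat \<Rightarrow> 'd tuple set" where
  "tuples n = {a. \<forall>l. a l \<in> carrier_mat n n}"

definition level :: "'d tuple set \<Rightarrow> nat \<Rightarrow> 'd tuple set" where
  "level K n = K \<inter> tuples n"

definition matrix_range :: "('a, 'v) op_alg \<Rightarrow> ('d \<Rightarrow> 'a) \<Rightarrow> 'd tuple set" where
  "matrix_range R x = {(\<lambda>l. \<phi> (x l)) | n \<phi>. 1 \<le> n \<and> ucp R (cstar_gen R (op_system R x)) n \<phi>}"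

definition ess_matrix_range :: "('d \<Rightarrow> (ell2 \<Rightarrow>\<^sub>L ell2)) \<Rightarrow> 'd tuple set" where
  "ess_matrix_range x = {(\<lambda>l. \<phi> (x l)) | n \<phi>. 1 \<le> n \<and>
     ucp BH (cstar_gen BH (op_system BH x)) n \<phi> \<and>
     (\<forall>T\<in>cstar_gen BH (op_system BH x). compact_op T \<longrightarrow> \<phi> T = 0\<^sub>m n n)}"

section \<open>Matrix convex sets and the Smith--Ward property\<close>

definition mat_sum :: "nat \<Rightarrow> nat \<Rightarrow> (nat \<Rightarrow> complex mat) \<Rightarrow> complex mat" where
  "mat_sum n m F = Matrix.mat n n (\<lambda>(r, c). \<Sum>j<m. F j $$ (r, c))"

definition matrix_convex :: "'d tuple set \<Rightarrow> bool" where
  "matrix_convex K \<longleftrightarrow>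
     (\<forall>a\<in>K. \<exists>n\<ge>1. a \<in> tuples n) \<and>
     (\<forall>n\<ge>1. \<forall>m N a \<gamma>.
        (\<forall>j<m. 1 \<le> N j \<and> a j \<in> level K (N j) \<and> \<gamma> j \<in> carrier_mat (N j) n) \<and>
        mat_sum n m (\<lambda>j. mat_adjoint (\<gamma> j) * \<gamma> j) = 1\<^sub>m n \<longrightarrow>
        (\<lambda>l. mat_sum n m (\<lambda>j. mat_adjoint (\<gamma> j) * a j l * \<gamma> j)) \<in> level K n)"

text \<open>
  The matrix type has no topology; entries embed the \<open>d\<close>-tuples of \<open>n \<times> n\<close> matrices
  homeomorphically into a product space.
\<close>

definition entries :: "nat \<Rightarrow> 'd tuple \<Rightarrow> ('d \<Rightarrow> nat \<Rightarrow> nat \<Rightarrow> complex)" where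
  "entries n a = (\<lambda>l r c. if r < n \<and> c < n then a l $$ (r, c) else 0)"

definition compact_matrix_convex :: "'d tuple set \<Rightarrow> bool" where
  "compact_matrix_convex K \<longleftrightarrow> matrix_convex K \<and> (\<forall>n\<ge>1. compact (entries n ` level K n))"

definition smith_ward_property :: "('d \<Rightarrow> (ell2 \<Rightarrow>\<^sub>L ell2)) \<Rightarrow> bool" where
  "smith_ward_property x \<longleftrightarrow>
     (\<exists>k. (\<forall>l. compact_op (k l)) \<and> ess_matrix_range x = matrix_range BH (\<lambda>l. x l + k l))"

definition smith_ward_geometry :: "'d tuple set \<Rightarrow> bool" where
  "smith_ward_geometry K \<longleftrightarrow>
     (\<forall>x. (\<forall>l. x l \<in> bounded_ops) \<and> ess_matrix_range x = K \<longrightarrow> smith_ward_property x)"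

section \<open>Minimal and maximal matrix convex sets\<close>

definition complexify :: "real^'d \<Rightarrow> complex^'d" where
  "complexify p = (\<chi> l. complex_of_real (vec_nth p l))"

text \<open>Identifies points of \<open>d\<close>-dimensional complex space with \<open>d\<close>-tuples of \<open>1 \<times> 1\<close> matrices.\<close>

definition point_tuple :: "complex^'d \<Rightarrow> 'd tuple" where
  "point_tuple p = (\<lambda>l. Matrix.mat 1 1 (\<lambda>_. vec_nth p l))"

definition K_min :: "(complex^'d) set \<Rightarrow> 'd tuple set" where
  "K_min K = {a. \<exists>n\<ge>1. a \<in> tuples n \<and>
     (\<exists>m h \<mu>. (\<forall>j<m. positive (Mat n) (h j) \<and> \<mu> j \<in> K) \<and>
        mat_sum n m h = 1\<^sub>m n \<and>
        (\<forall>l. a l = mat_sum n m (\<lambda>j. vec_nth (\<mu> j) l \<cdot>\<^sub>m h j)))}"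

definition K_max :: "(complex^'d) set \<Rightarrow> 'd tuple set" where
  "K_max K = {a. \<exists>n\<ge>1. a \<in> tuples n \<and>
     level (matrix_range (Mat n) a) 1 \<subseteq> point_tuple ` K}"

end

theory Submission
  imports Defs
begin

text \<open>
  The barycentric coordinates of a simplex extend to affine functions \<open>f\<^sub>i\<close> with \<open>\<Sum>i. f\<^sub>i = 1\<close>. A
  tuple of matrices lies over the simplex iff the matrices \<open>f\<^sub>i(a)\<close> are positive and
  \<open>a = \<Sum>i. v\<^sub>i f\<^sub>i(a)\<close> for the vertices \<open>v\<^sub>i\<close>; this identifies all matrix convex sets over the
  simplex. If the essential matrix range of \<open>x\<close> is this set, then the real parts of the operators
  \<open>f\<^sub>i(x)\<close> sum to one and are positive modulo the compacts. They are lifted to positive operators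
  \<open>h\<^sub>i\<close> with sum one by repeatedly averaging pinchings along increasing coordinate projections: each
  round is a small finite-rank change that improves the lower bound, and the rounds converge in
  norm. Splitting off one unit vector per vertex, on which \<open>h\<^sub>i\<close> acts diagonally, makes the matrix
  range of \<open>\<Sum>i. v\<^sub>i h\<^sub>i\<close> exactly the required set.
\<close>

subsection \<open>Positive semidefinite matrices\<close>

text \<open>Lifting the coordinates one at a time, for instance by positive parts, destroys the
  relation that they sum to one. So all are corrected together by operations that respect the sum:
  pinching, averaging, and mixing with the identity. Mixing makes a finite block positive at a cost
  proportional to the current negativity, because the lower bounds of the other summands bound each
  operator from above. A single pinching discards an off-diagonal corner that need not be small;
  this is the reason for averaging over many cut-offs. The lower bound is halved in every round, so
  the corrections are dominated by a geometric series.

  Smallness modulo compacts is measured by quadratic forms on vectors beyond a large cut-off: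
  compactness is read off from them, and the essential range enters only through limits of vector
  states along such vectors. Positivity of the h_i bounds the matrix range from above only; the unit
  vectors split off at the end make every vertex a value of a vector state, which gives the other
  inclusion.\<close>

definition qform :: "nat \<Rightarrow> (nat \<Rightarrow> nat \<Rightarrow> complex) \<Rightarrow> (nat \<Rightarrow> complex) \<Rightarrow> complex" where
  "qform n A v = (\<Sum>r<n. \<Sum>s<n. A r s * v s * cnj (v r))"

text \<open>Matrices are plain functions of two indices here, so that sums and scalings carry no
  carrier conditions; entries with an index beyond \<open>n\<close> are ignored.\<close>

definition psd :: "nat \<Rightarrow> (nat \<Rightarrow> nat \<Rightarrow> complex) \<Rightarrow> bool" where
  "psd n A \<longleftrightarrow> (\<forall>v. qform n A v \<in> \<real>\<^sub>\<ge>\<^sub>0)"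

lemma qform_cong:
  assumes "\<And>r s. r < n \<Longrightarrow> s < n \<Longrightarrow> A r s = B r s" "\<And>r. r < n \<Longrightarrow> v r = w r"
  shows "qform n A v = qform n B w"
  unfolding qform_def using assms by (intro sum.cong) auto

lemma psd_cong:
  assumes "\<And>r s. r < n \<Longrightarrow> s < n \<Longrightarrow> A r s = B r s"
  shows "psd n A \<longleftrightarrow> psd n B"
  unfolding psd_def using qform_cong[OF assms] by simp

lemma qform_add: "qform n (\<lambda>r s. A r s + B r s) v = qform n A v + qform n B v"
  by (simp add: qform_def sum.distrib algebra_simps)

lemma qform_diff: "qform n (\<lambda>r s. A r s - B r s) v = qform n A v - qform n B v"
  by (simp add: qform_def sum_subtractf algebra_simps)

lemma qform_scale: "qform n (\<lambda>r s. c * A r s) v = c * qform n A v"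
  by (simp add: qform_def sum_distrib_left mult.assoc)

lemma qform_sum: "qform n (\<lambda>r s. \<Sum>i\<in>I. A i r s) v = (\<Sum>i\<in>I. qform n (A i) v)"
proof (cases "finite I")
  case True
  then show ?thesis by induction (auto simp: qform_add, simp add: qform_def)
qed (simp add: qform_def)

lemma qform_id: "qform n (\<lambda>r s. of_bool (r = s)) v = of_real (\<Sum>r<n. (cmod (v r))\<^sup>2)"
  unfolding qform_def of_real_sum
  by (intro sum.cong refl)
    (simp add: complex_norm_square of_bool_def if_distrib[of "\<lambda>x. x * _"] cong: if_cong
      del: of_real_power)

lemma qform_rank_one:
  "qform n (\<lambda>r s. w r * cnj (w s)) v = of_real ((cmod (\<Sum>r<n. w r * cnj (v r)))\<^sup>2)"
  unfolding complex_norm_square cnj_sum qform_def sum_product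
  by (intro sum.cong refl) (simp add: algebra_simps)

lemma psd_rank_one: "psd n (\<lambda>r s. w r * cnj (w s))"
  unfolding psd_def qform_rank_one by (simp only: nonneg_Reals_of_real_iff) simp

lemma nonneg_Reals_sum:
  assumes "\<And>i. i \<in> I \<Longrightarrow> f i \<in> (\<real>\<^sub>\<ge>\<^sub>0 :: complex set)"
  shows "sum f I \<in> \<real>\<^sub>\<ge>\<^sub>0"
  using assms by (auto simp: complex_nonneg_Reals_iff intro: sum_nonneg)

lemma psd_sum:
  assumes "\<And>i. i \<in> I \<Longrightarrow> psd n (A i)"
  shows "psd n (\<lambda>r s. \<Sum>i\<in>I. A i r s)"
  using assms unfolding psd_def qform_sum by (auto intro: nonneg_Reals_sum)

lemma psd_scale:
  assumes "psd n A" "0 \<le> c"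
  shows "psd n (\<lambda>r s. complex_of_real c * A r s)"
  using assms unfolding psd_def qform_scale by (auto simp: complex_nonneg_Reals_iff)

lemma sum_two_points:
  fixes f :: "nat \<Rightarrow> complex"
  assumes "r < n" "s < n" "r \<noteq> s"
  shows "(\<Sum>t<n. f t * (if t = r then x else if t = s then y else 0)) = f r * x + f s * y"
proof -
  have "(\<Sum>t<n. f t * (if t = r then x else if t = s then y else 0))
      = (\<Sum>t<n. (if t = r then f t * x else 0) + (if t = s then f t * y else 0))"
    using assms by (intro sum.cong) auto
  then show ?thesis using assms by (simp add: sum.distrib)
qed

lemma qform_two_points:
  assumes "r < n" "s < n" "r \<noteq> s"
  shows "qform n A (\<lambda>t. if t = r then x else if t = s then y else 0)
    = A r r * x * cnj x + A r s * y * cnj x + A s r * x * cnj y + A s s * y * cnj y"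
proof -
  let ?v = "\<lambda>t. if t = r then x else if t = s then y else 0"
  have "qform n A ?v = (\<Sum>p<n. (\<Sum>q<n. A p q * ?v q) * cnj (?v p))"
    by (simp add: qform_def sum_distrib_right)
  also have "\<dots> = (\<Sum>p<n. (A p r * x + A p s * y) * (if p = r then cnj x else if p = s then cnj y else 0))"
    by (intro sum.cong refl) (simp add: sum_two_points[OF assms])
  finally show ?thesis unfolding sum_two_points[OF assms] by (simp add: algebra_simps)
qed

lemma qform_single:
  assumes "r < n"
  shows "qform n A (\<lambda>t. if t = r then x else 0) = A r r * x * cnj x"
proof -
  have "qform n A (\<lambda>t. if t = r then x else 0)
      = (\<Sum>p<n. \<Sum>q<n. if q = r then (if p = r then A p q * x * cnj x else 0) else 0)"
    unfolding qform_def by (intro sum.cong) auto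
  then show ?thesis using assms by simp
qed

text \<open>Polarization: the test vectors with entries \<open>1, 1\<close> and
  \<open>1, \<i>\<close> at two coordinates isolate the sum and the difference of the two
  off-diagonal entries.\<close>

lemma qform_eq_0_imp:
  assumes z: "\<And>v. qform n A v = 0" and rs: "r < n" "s < n"
  shows "A r s = 0"
proof (cases "r = s")
  case True
  then show ?thesis using qform_single[OF rs(1), of A 1] z by simp
next
  case False
  have d: "A r r = 0" "A s s = 0"
    using qform_single[OF rs(1), of A 1] qform_single[OF rs(2), of A 1] z by auto
  have 1: "A r s + A s r = 0" using qform_two_points[OF rs False, of A 1 1] z d by simp
  have 2: "A r s * \<i> - A s r * \<i> = 0" using qform_two_points[OF rs False, of A 1 \<i>] z d by simp
  have "A r s = A s r" using 2 by simp
  then show ?thesis using 1 by simp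
qed

text \<open>Over the complex scalars a real-valued form comes from a Hermitian matrix; the test
  vectors are again those of polarization.\<close>

lemma psd_hermitian:
  assumes p: "psd n A" and rs: "r < n" "s < n"
  shows "cnj (A s r) = A r s"
proof (cases "r = s")
  case True
  have "qform n A (\<lambda>t. if t = r then 1 else 0) \<in> \<real>\<^sub>\<ge>\<^sub>0" using p unfolding psd_def by blast
  then have "A r r \<in> \<real>\<^sub>\<ge>\<^sub>0" by (simp add: qform_single[OF rs(1)])
  then show ?thesis using True by (simp add: complex_eq_iff complex_nonneg_Reals_iff)
next
  case False
  have "A r r \<in> \<real>\<^sub>\<ge>\<^sub>0" "A s s \<in> \<real>\<^sub>\<ge>\<^sub>0"
    using p rs qform_single[of r n A 1] qform_single[of s n A 1] unfolding psd_def
    by (metis complex_cnj_one mult.right_neutral)+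
  moreover have "qform n A (\<lambda>t. if t = r then 1 else if t = s then 1 else 0) \<in> \<real>\<^sub>\<ge>\<^sub>0"
    using p unfolding psd_def by blast
  moreover have "qform n A (\<lambda>t. if t = r then 1 else if t = s then \<i> else 0) \<in> \<real>\<^sub>\<ge>\<^sub>0"
    using p unfolding psd_def by blast
  ultimately show ?thesis
    unfolding qform_two_points[OF rs False] by (simp add: complex_eq_iff complex_nonneg_Reals_iff)
qed

lemma qform_shift:
  assumes k: "k < n"
  shows "qform n A (\<lambda>t. v t + (if t = k then z else 0))
    = qform n A v + z * (\<Sum>r<n. A r k * cnj (v r)) + cnj z * (\<Sum>s<n. A k s * v s) + A k k * z * cnj z"
proof -
  have "qform n A (\<lambda>t. v t + (if t = k then z else 0))
    = qform n A v + (\<Sum>r<n. \<Sum>s<n. if s = k then A r s * z * cnj (v r) else 0)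
      + (\<Sum>r<n. \<Sum>s<n. if r = k then A r s * v s * cnj z else 0)
      + (\<Sum>r<n. \<Sum>s<n. if s = k then (if r = k then A r s * z * cnj z else 0) else 0)"
    unfolding qform_def sum.distrib[symmetric]
    by (intro sum.cong) (auto simp: algebra_simps)
  also have "(\<Sum>r<n. \<Sum>s<n. if r = k then A r s * v s * cnj z else 0)
      = (\<Sum>r<n. if r = k then (\<Sum>s<n. A r s * v s * cnj z) else 0)"
    by (intro sum.cong) auto
  finally have "qform n A (\<lambda>t. v t + (if t = k then z else 0))
    = qform n A v + (\<Sum>r<n. A r k * z * cnj (v r)) + (\<Sum>s<n. A k s * v s * cnj z) + A k k * z * cnj z"
    using k by simp
  moreover have "(\<Sum>r<n. A r k * z * cnj (v r)) = z * (\<Sum>r<n. A r k * cnj (v r))"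
    "(\<Sum>s<n. A k s * v s * cnj z) = cnj z * (\<Sum>s<n. A k s * v s)"
    unfolding sum_distrib_left by (intro sum.cong refl; simp)+
  ultimately show ?thesis by simp
qed

text \<open>One step of symmetric Gaussian elimination.\<close>

lemma psd_eliminate:
  assumes p: "psd n B" and k: "k < n"
  obtains u where "psd n (\<lambda>r s. B r s - u r * cnj (u s))"
    and "\<And>s. s < n \<Longrightarrow> B k s = u k * cnj (u s)" "\<And>s. s < n \<Longrightarrow> B s k = u s * cnj (u k)"
    and "\<And>r. r < n \<Longrightarrow> B r k = 0 \<Longrightarrow> u r = 0"
proof -
  define \<beta> where "\<beta> v = (\<Sum>s<n. B k s * v s)" for v
  have adj: "(\<Sum>r<n. B r k * cnj (v r)) = cnj (\<beta> v)" for v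
    unfolding \<beta>_def cnj_sum by (intro sum.cong) (auto simp: psd_hermitian[OF p _ k])
  have shift: "qform n B v + z * cnj (\<beta> v) + cnj z * \<beta> v + B k k * z * cnj z \<in> \<real>\<^sub>\<ge>\<^sub>0" for v z
    using p qform_shift[OF k, of B v z] unfolding psd_def adj \<beta>_def by metis
  have "B k k \<in> \<real>\<^sub>\<ge>\<^sub>0" using p qform_single[OF k, of B 1] unfolding psd_def
    by (metis complex_cnj_one mult.right_neutral)
  then obtain b where b: "B k k = of_real b" "0 \<le> b" by (auto elim: nonneg_Reals_cases)
  show thesis
  proof (cases "b = 0")
    case True
    \<comment> \<open>With a zero pivot the quadratic term in \<open>z\<close> disappears. A nonzero
      linear term could then be made arbitrarily negative; the constant \<open>c\<close> below is
      chosen so that the form takes the value -1.\<close>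
    have \<beta>0: "\<beta> v = 0" for v
    proof (rule ccontr)
      assume nz: "\<beta> v \<noteq> 0"
      define m where "m = (cmod (\<beta> v))\<^sup>2"
      define q where "q = Re (qform n B v)"
      have m: "0 < m" using nz by (simp add: m_def)
      define c where "c = - (q + 1) / (2 * m)"
      have "Re (qform n B v + of_real c * \<beta> v * cnj (\<beta> v) + cnj (of_real c * \<beta> v) * \<beta> v) \<ge> 0"
        using shift[of v "of_real c * \<beta> v"] b True by (simp add: complex_nonneg_Reals_iff)
      moreover have "qform n B v + of_real c * \<beta> v * cnj (\<beta> v) + cnj (of_real c * \<beta> v) * \<beta> v
          = qform n B v + of_real (2 * c * m)"
        unfolding m_def of_real_mult complex_norm_square by (simp add: mult_ac)
      ultimately have "0 \<le> Re (qform n B v + of_real (2 * c * m))" by metis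
      then have "q + 2 * c * m \<ge> 0" by (simp add: q_def)
      moreover have "2 * c * m = - (q + 1)" using m by (simp add: c_def)
      ultimately show False by simp
    qed
    have z: "B k s = 0" if "s < n" for s
    proof -
      have "\<beta> (\<lambda>t. if t = s then 1 else 0) = (\<Sum>t<n. if t = s then B k s else 0)"
        unfolding \<beta>_def by (intro sum.cong refl) auto
      then show ?thesis using \<beta>0 that by simp
    qed
    have z': "B s k = 0" if "s < n" for s
      using z[OF that] psd_hermitian[OF p that k] by simp
    show thesis by (rule that[of "\<lambda>_. 0"]) (use p z z' in auto)
  next
    case False
    then have b0: "0 < b" using b by simp
    \<comment> \<open>The pivot column, normalised so that subtracting the rank-one matrix of
      \<open>u\<close> leaves the Schur complement.\<close>
    define u where "u r = B r k / of_real (sqrt b)" for r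
    have ss: "complex_of_real (sqrt b) * of_real (sqrt b) = of_real b"
      using b0 by (simp flip: of_real_mult)
    have bk: "cnj (B s k) = B k s" if "s < n" for s using psd_hermitian[OF p k that] .
    have uu: "u r * cnj (u s) = B r k * B k s / of_real b" if "s < n" for r s
      using bk[OF that] ss by (simp add: u_def)
    show thesis
    proof (rule that[of u])
      show "psd n (\<lambda>r s. B r s - u r * cnj (u s))"
        unfolding psd_def
      proof
        fix v
        have "(\<Sum>r<n. u r * cnj (v r)) = cnj (\<beta> v) / of_real (sqrt b)"
          unfolding adj[symmetric] u_def sum_divide_distrib by simp
        then have "qform n (\<lambda>r s. u r * cnj (u s)) v = of_real ((cmod (\<beta> v))\<^sup>2 / b)"
          unfolding qform_rank_one using b0 by (simp add: norm_divide power_divide)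
        then have e: "qform n (\<lambda>r s. u r * cnj (u s)) v = \<beta> v * cnj (\<beta> v) / of_real b"
          by (simp only: of_real_divide complex_norm_square)
        \<comment> \<open>Completing the square: this \<open>z\<close> minimises the shifted form,
          and the minimum is exactly the form of the Schur complement at \<open>v\<close>.\<close>
        define z where "z = - \<beta> v / of_real b"
        have "B k k * z = - \<beta> v" using b0 unfolding z_def b(1) by simp
        then have "qform n B v + z * cnj (\<beta> v) + cnj z * \<beta> v + B k k * z * cnj z
            = qform n B v + z * cnj (\<beta> v)" by simp
        also have "\<dots> = qform n B v - \<beta> v * cnj (\<beta> v) / of_real b" by (simp add: z_def)
        finally have eq: "qform n B v + z * cnj (\<beta> v) + cnj z * \<beta> v + B k k * z * cnj z
            = qform n B v - \<beta> v * cnj (\<beta> v) / of_real b" .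
        show "qform n (\<lambda>r s. B r s - u r * cnj (u s)) v \<in> \<real>\<^sub>\<ge>\<^sub>0"
          unfolding qform_diff e eq[symmetric] by (rule shift)
      qed
      show "B k s = u k * cnj (u s)" if "s < n" for s using uu[OF that, of k] b(1) b0 by simp
      show "B s k = u s * cnj (u k)" if "s < n" for s using uu[OF k, of s] b(1) b0 by simp
      show "u r = 0" if "r < n" "B r k = 0" for r using that by (simp add: u_def)
    qed
  qed
qed

text \<open>Cholesky elimination: each step clears one more row and column of the remainder
  \<open>B\<close>. The last clause of \<open>psd_eliminate\<close> is what keeps the rows cleared
  earlier at zero.\<close>

lemma psd_decomp_aux:
  assumes p: "psd n A" and "k \<le> n"
  shows "\<exists>w B. psd n B \<and> (\<forall>r<n. \<forall>s<n. A r s = (\<Sum>t<k. w t r * cnj (w t s)) + B r s) \<and>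
           (\<forall>r<k. \<forall>s<n. B r s = 0 \<and> B s r = 0)"
  using \<open>k \<le> n\<close>
proof (induction k)
  case 0
  show ?case by (rule exI[of _ undefined], rule exI[of _ A]) (use p in simp)
next
  case (Suc k)
  have "k \<le> n" using Suc.prems by simp
  from Suc.IH[OF this] show ?case
  proof (elim exE conjE)
    fix w B
    assume B: "psd n B"
      and "\<forall>r<n. \<forall>s<n. A r s = (\<Sum>t<k. w t r * cnj (w t s)) + B r s"
      and "\<forall>r<k. \<forall>s<n. B r s = 0 \<and> B s r = 0"
    then have A: "\<And>r s. r < n \<Longrightarrow> s < n \<Longrightarrow> A r s = (\<Sum>t<k. w t r * cnj (w t s)) + B r s"
      and z: "\<And>r s. r < k \<Longrightarrow> s < n \<Longrightarrow> B r s = 0 \<and> B s r = 0"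
      by blast+
    have kn: "k < n" using Suc.prems by simp
    obtain u where u: "psd n (\<lambda>r s. B r s - u r * cnj (u s))"
        "\<And>s. s < n \<Longrightarrow> B k s = u k * cnj (u s)" "\<And>s. s < n \<Longrightarrow> B s k = u s * cnj (u k)"
        "\<And>r. r < n \<Longrightarrow> B r k = 0 \<Longrightarrow> u r = 0"
      by (rule psd_eliminate[OF B kn]) (assumption | rule that)+
    let ?B = "\<lambda>r s. B r s - u r * cnj (u s)" and ?w = "w(k := u)"
    show ?case
    proof (rule exI[of _ ?w], rule exI[of _ ?B], intro conjI allI impI)
      show "psd n ?B" by (rule u(1))
      show "A r s = (\<Sum>t<Suc k. ?w t r * cnj (?w t s)) + ?B r s" if "r < n" "s < n" for r s
      proof -
        have "(\<Sum>t<k. ?w t r * cnj (?w t s)) = (\<Sum>t<k. w t r * cnj (w t s))"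
          by (intro sum.cong) auto
        then show ?thesis unfolding A[OF that] by simp
      qed
      fix r s assume r: "r < Suc k" and s: "s < n"
      have "u r = 0 \<and> B r s = 0 \<and> B s r = 0" if "r \<noteq> k"
        using that r kn z[of r k] z[of r s] s u(4)[of r] by simp
      then show "?B r s = 0" "?B s r = 0" using u(2,3)[OF s] by (cases "r = k"; simp)+
    qed
  qed
qed

lemma psd_decomp:
  assumes "psd n A"
  shows "\<exists>w. \<forall>r<n. \<forall>s<n. A r s = (\<Sum>t<n. w t r * cnj (w t s))"
  using psd_decomp_aux[OF assms order_refl]
proof (elim exE conjE)
  fix w B
  assume A: "\<forall>r<n. \<forall>s<n. A r s = (\<Sum>t<n. w t r * cnj (w t s)) + B r s"
    and z: "\<forall>r<n. \<forall>s<n. B r s = 0 \<and> B s r = 0"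
  show "\<exists>w. \<forall>r<n. \<forall>s<n. A r s = (\<Sum>t<n. w t r * cnj (w t s))"
  proof (intro exI[of _ w] allI impI)
    fix r s assume "r < n" "s < n"
    then have "B r s = 0" using z by blast
    then show "A r s = (\<Sum>t<n. w t r * cnj (w t s))" using A \<open>r < n\<close> \<open>s < n\<close> by (metis add_0_right)
  qed
qed

section \<open>Matrices as operators: forms, adjoints and compressions in terms of entries\<close>

lemma Mat_simps [simp]:
  "ops (Mat n) = carrier_mat n n" "add (Mat n) = (+)" "scl (Mat n) = (\<cdot>\<^sub>m)"
  "mul (Mat n) = (*)" "adj (Mat n) = mat_adjoint" "unt (Mat n) = 1\<^sub>m n"
  "vecs (Mat n) = carrier_vec n" "app (Mat n) = (*\<^sub>v)" "ip (Mat n) = (\<lambda>v w. v \<bullet>c w)"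
  by (simp_all add: Mat_def)

lemma app_ip_Mat:
  assumes "A \<in> carrier_mat n n" "v \<in> carrier_vec n" "w \<in> carrier_vec n"
  shows "(A *\<^sub>v v) \<bullet>c w = (\<Sum>r<n. \<Sum>s<n. A $$ (r, s) * vec_index v s * cnj (vec_index w r))"
  using assms
  by (simp add: scalar_prod_def sum_distrib_right atLeast0LessThan Matrix.row_def)

lemma positive_Mat_iff:
  "positive (Mat n) A \<longleftrightarrow> A \<in> carrier_mat n n \<and> psd n (\<lambda>r s. A $$ (r, s))"
proof (cases "A \<in> carrier_mat n n")
  case True
  have *: "(A *\<^sub>v v) \<bullet>c v = qform n (\<lambda>r s. A $$ (r, s)) (vec_index v)" if "v \<in> carrier_vec n" for v
    using app_ip_Mat[OF True that that] by (simp add: qform_def)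
  have "(\<forall>v\<in>carrier_vec n. (A *\<^sub>v v) \<bullet>c v \<in> \<real>\<^sub>\<ge>\<^sub>0) \<longleftrightarrow> psd n (\<lambda>r s. A $$ (r, s))"
    unfolding psd_def
  proof safe
    fix v assume a: "\<forall>v\<in>carrier_vec n. (A *\<^sub>v v) \<bullet>c v \<in> \<real>\<^sub>\<ge>\<^sub>0"
    have "qform n (\<lambda>r s. A $$ (r, s)) v = qform n (\<lambda>r s. A $$ (r, s)) (vec_index (Matrix.vec n v))"
      by (rule qform_cong) auto
    moreover have "Matrix.vec n v \<in> carrier_vec n" by simp
    ultimately show "qform n (\<lambda>r s. A $$ (r, s)) v \<in> \<real>\<^sub>\<ge>\<^sub>0" using a * by metis
  qed (use * in auto)
  then show ?thesis using True by (simp add: positive_def)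
qed (simp add: positive_def)

lemma mat_adjoint_carrier [simp]:
  assumes "G \<in> carrier_mat N n" shows "mat_adjoint G \<in> carrier_mat n N"
  using assms by (auto simp: mat_adjoint_def mat_of_rows_def)

lemma mat_adjoint_index:
  assumes "G \<in> carrier_mat N n" "i < n" "j < N"
  shows "mat_adjoint G $$ (i, j) = cnj (G $$ (j, i))"
  using assms by (simp add: mat_adjoint_def mat_of_rows_index)

lemma mat_mult_index:
  assumes "A \<in> carrier_mat n N" "B \<in> carrier_mat N m" "r < n" "s < m"
  shows "(A * B) $$ (r, s) = (\<Sum>p<N. A $$ (r, p) * B $$ (p, s))"
  using assms by (simp add: scalar_prod_def atLeast0LessThan)

lemma adjoint_mult_index:
  assumes "G \<in> carrier_mat N n" "r < n" "s < n"
  shows "(mat_adjoint G * G) $$ (r, s) = (\<Sum>p<N. cnj (G $$ (p, r)) * G $$ (p, s))"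
  unfolding mat_mult_index[OF mat_adjoint_carrier[OF assms(1)] assms]
  using assms by (intro sum.cong) (simp_all add: mat_adjoint_index[OF assms(1)])

lemma conj_mat_index:
  assumes G: "G \<in> carrier_mat N n" and a: "a \<in> carrier_mat N N" and rs: "r < n" "s < n"
  shows "(mat_adjoint G * a * G) $$ (r, s)
    = (\<Sum>q<N. \<Sum>p<N. cnj (G $$ (p, r)) * a $$ (p, q) * G $$ (q, s))"
proof -
  have "mat_adjoint G * a \<in> carrier_mat n N" using mat_adjoint_carrier[OF G] a by simp
  then show ?thesis
    using rs by (simp add: mat_mult_index[OF _ G] mat_mult_index[OF mat_adjoint_carrier[OF G] a]
        mat_adjoint_index[OF G] sum_distrib_right)
qed

lemma qform_conj_mat:
  assumes G: "G \<in> carrier_mat N n" and a: "a \<in> carrier_mat N N"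
  shows "qform n (\<lambda>r s. (mat_adjoint G * a * G) $$ (r, s)) v
    = qform N (\<lambda>p q. a $$ (p, q)) (\<lambda>p. \<Sum>s<n. G $$ (p, s) * v s)"
proof -
  have "qform n (\<lambda>r s. (mat_adjoint G * a * G) $$ (r, s)) v
    = qform n (\<lambda>r s. \<Sum>q<N. \<Sum>p<N. cnj (G $$ (p, r)) * a $$ (p, q) * G $$ (q, s)) v"
    by (rule qform_cong) (auto simp: conj_mat_index[OF G a])
  also have "\<dots> = (\<Sum>q<N. \<Sum>p<N. qform n (\<lambda>r s. cnj (G $$ (p, r)) * a $$ (p, q) * G $$ (q, s)) v)"
    by (simp add: qform_sum)
  also have "\<dots> = (\<Sum>q<N. \<Sum>p<N. a $$ (p, q) * (\<Sum>s<n. G $$ (q, s) * v s) * cnj (\<Sum>s<n. G $$ (p, s) * v s))"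
  proof (intro sum.cong refl)
    fix p q
    have "qform n (\<lambda>r s. cnj (G $$ (p, r)) * a $$ (p, q) * G $$ (q, s)) v
        = (\<Sum>r<n. \<Sum>s<n. a $$ (p, q) * (G $$ (q, s) * v s) * cnj (G $$ (p, r) * v r))"
      unfolding qform_def by (intro sum.cong refl) simp
    also have "\<dots> = a $$ (p, q) * (\<Sum>s<n. G $$ (q, s) * v s) * cnj (\<Sum>s<n. G $$ (p, s) * v s)"
      unfolding cnj_sum sum_distrib_left sum_distrib_right by (rule refl)
    finally show "qform n (\<lambda>r s. cnj (G $$ (p, r)) * a $$ (p, q) * G $$ (q, s)) v
        = a $$ (p, q) * (\<Sum>s<n. G $$ (q, s) * v s) * cnj (\<Sum>s<n. G $$ (p, s) * v s)" .
  qed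
  finally show ?thesis unfolding qform_def by (subst sum.swap)
qed

lemma qform_adjoint_mult:
  assumes G: "G \<in> carrier_mat N n"
  shows "qform n (\<lambda>r s. (mat_adjoint G * G) $$ (r, s)) v
    = qform N (\<lambda>p q. of_bool (p = q)) (\<lambda>p. \<Sum>s<n. G $$ (p, s) * v s)"
proof -
  have "mat_adjoint G * 1\<^sub>m N = mat_adjoint G"
    using mat_adjoint_carrier[OF G] by simp
  then have "qform n (\<lambda>r s. (mat_adjoint G * G) $$ (r, s)) v
    = qform N (\<lambda>p q. 1\<^sub>m N $$ (p, q)) (\<lambda>p. \<Sum>s<n. G $$ (p, s) * v s)"
    using qform_conj_mat[OF G one_carrier_mat, of v] by simp
  then show ?thesis by (auto intro: qform_cong simp: of_bool_def)
qed

lemma mat_sum_carrier [simp]: "mat_sum n m F \<in> carrier_mat n n"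
  by (simp add: mat_sum_def)

lemma mat_sum_index [simp]:
  "r < n \<Longrightarrow> s < n \<Longrightarrow> mat_sum n m F $$ (r, s) = (\<Sum>j<m. F j $$ (r, s))"
  by (simp add: mat_sum_def)

lemma qform_mat_sum:
  "qform n (\<lambda>r s. mat_sum n m F $$ (r, s)) v = (\<Sum>j<m. qform n (\<lambda>r s. F j $$ (r, s)) v)"
proof -
  have "qform n (\<lambda>r s. mat_sum n m F $$ (r, s)) v = qform n (\<lambda>r s. \<Sum>j<m. F j $$ (r, s)) v"
    by (rule qform_cong) auto
  then show ?thesis by (simp only: qform_sum)
qed

text \<open>An index type is never empty, so some coordinate, here \<open>undefined\<close>, exists
  and fixes the size. This is what allows a graded set to be a plain union.\<close>

lemma tuples_unique:
  assumes "a \<in> tuples n" "a \<in> tuples n'"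
  shows "n = n'"
proof -
  have "a undefined \<in> carrier_mat n n" "a undefined \<in> carrier_mat n' n'"
    using assms by (auto simp: tuples_def)
  then show ?thesis by (metis carrier_matD(1))
qed

lemma sum_div_mod:
  fixes f :: "nat \<Rightarrow> nat \<Rightarrow> 'a::comm_monoid_add"
  assumes "1 \<le> n"
  shows "(\<Sum>j<M * n. f (j div n) (j mod n)) = (\<Sum>i<M. \<Sum>t<n. f i t)"
proof -
  have "(\<Sum>j<M * n. f (j div n) (j mod n)) = (\<Sum>i<M. \<Sum>j\<in>{i * n..<i * n + n}. f (j div n) (j mod n))"
    by (rule sum.nat_group[symmetric])
  also have "\<dots> = (\<Sum>i<M. \<Sum>t<n. f i t)"
  proof (rule sum.cong[OF refl])
    fix i
    have "(\<Sum>j\<in>{i * n..<i * n + n}. f (j div n) (j mod n))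
        = (\<Sum>t\<in>{0..<n}. f ((t + i * n) div n) ((t + i * n) mod n))"
      using sum.shift_bounds_nat_ivl[of "\<lambda>j. f (j div n) (j mod n)" 0 "i * n" n] by (simp add: add.commute)
    also have "\<dots> = (\<Sum>t<n. f i t)"
      unfolding atLeast0LessThan using assms by (intro sum.cong) auto
    finally show "(\<Sum>j\<in>{i * n..<i * n + n}. f (j div n) (j mod n)) = (\<Sum>t<n. f i t)" .
  qed
  finally show ?thesis .
qed

subsection \<open>The matrix convex set over a simplex\<close>

definition affine_form :: "real \<Rightarrow> ('d::finite \<Rightarrow> real) \<Rightarrow> 'd tuple \<Rightarrow> nat \<Rightarrow> nat \<Rightarrow> complex" where
  "affine_form c b a = (\<lambda>r s. of_real c * of_bool (r = s) + (\<Sum>l\<in>UNIV. of_real (b l) * a l $$ (r, s)))"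

lemma qform_affine_form:
  "qform n (affine_form c b a) v = of_real c * qform n (\<lambda>r s. of_bool (r = s)) v
    + (\<Sum>l\<in>UNIV. of_real (b l) * qform n (\<lambda>r s. a l $$ (r, s)) v)"
  unfolding affine_form_def by (simp only: qform_add qform_scale qform_sum)

lemma qform_smult_vec: "qform n A (\<lambda>r. z * v r) = z * cnj z * qform n A v"
  by (simp add: qform_def sum_distrib_left mult_ac)

text \<open>
  \<open>V 0, \<dots>, V (M - 1)\<close> are the vertices and \<open>p \<mapsto> \<alpha> i + \<Sum>l. \<beta> i l * p l\<close> is an affine function that
  extends the \<open>i\<close>-th barycentric coordinate to the whole space; the last two conditions say that
  these extensions sum to one everywhere.
\<close>

locale simplex_coords =
  fixes V :: "nat \<Rightarrow> real^'d" and M :: nat and \<alpha> :: "nat \<Rightarrow> real" and \<beta> :: "nat \<Rightarrow> 'd \<Rightarrow> real"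
  assumes dual: "i < M \<Longrightarrow> j < M \<Longrightarrow> \<alpha> i + (\<Sum>l\<in>UNIV. \<beta> i l * vec_nth (V j) l) = of_bool (i = j)"
    and sum_\<alpha>: "(\<Sum>i<M. \<alpha> i) = 1"
    and sum_\<beta>: "(\<Sum>i<M. \<beta> i l) = 0"
begin

definition Delta :: "(real^'d) set" where
  "Delta = convex hull (V ` {..<M})"

definition nonneg_on :: "real \<Rightarrow> ('d \<Rightarrow> real) \<Rightarrow> bool" where
  "nonneg_on c b \<longleftrightarrow> (\<forall>j<M. 0 \<le> c + (\<Sum>l\<in>UNIV. b l * vec_nth (V j) l))"

text \<open>A dual description: every scalar affine inequality valid at the vertices is imposed on
  the matrices. In this form matrix convexity and closedness are immediate, and
  \<open>K_min\<close>, \<open>K_max\<close> and an arbitrary competitor are each compared with this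
  one set instead of with one another.\<close>

definition nc_simplex :: "'d tuple set" where
  "nc_simplex = {a. \<exists>n\<ge>1. a \<in> tuples n \<and> (\<forall>c b. nonneg_on c b \<longrightarrow> psd n (affine_form c b a))}"

lemma vertex_in_Delta: "i < M \<Longrightarrow> V i \<in> Delta"
  unfolding Delta_def by (rule hull_inc) auto

lemma nonneg_on_Delta:
  assumes "nonneg_on c b" "p \<in> Delta"
  shows "0 \<le> c + (\<Sum>l\<in>UNIV. b l * vec_nth p l)"
proof -
  have eq: "(\<Sum>l\<in>UNIV. b l * vec_nth q l) = inner (\<chi> l. b l) q" for q
    by (simp add: inner_vec_def)
  have "Delta \<subseteq> {q. inner (\<chi> l. b l) q \<ge> - c}"
    unfolding Delta_def
  proof (rule hull_minimal)
    show "V ` {..<M} \<subseteq> {q. inner (\<chi> l. b l) q \<ge> - c}"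
      using assms(1) unfolding nonneg_on_def eq by force
  qed (rule convex_halfspace_ge)
  then show ?thesis using assms(2) unfolding eq by force
qed

lemma nc_simplexD:
  assumes "a \<in> nc_simplex" "a \<in> tuples n"
  shows "1 \<le> n" "nonneg_on c b \<Longrightarrow> psd n (affine_form c b a)"
proof -
  obtain n' where "1 \<le> n'" "a \<in> tuples n'"
      "\<And>c b. nonneg_on c b \<Longrightarrow> psd n' (affine_form c b a)"
    using assms(1) unfolding nc_simplex_def by blast
  moreover have "n' = n" using \<open>a \<in> tuples n'\<close> assms(2) by (rule tuples_unique)
  ultimately show "1 \<le> n" "nonneg_on c b \<Longrightarrow> psd n (affine_form c b a)" by blast+
qed

lemma nc_simplexI:
  assumes "1 \<le> n" "a \<in> tuples n" "\<And>c b. nonneg_on c b \<Longrightarrow> psd n (affine_form c b a)"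
  shows "a \<in> nc_simplex"
  using assms unfolding nc_simplex_def by blast

text \<open>By homogeneity an affine form need only be tested on unit vectors, and there it is the
  value of a scalar affine function at a point \<open>p\<close> of the simplex. Membership is thus a
  condition on the joint numerical range alone.\<close>

lemma nc_simplexI_numerical_range:
  assumes n: "1 \<le> n" and a: "a \<in> tuples n"
    and nr: "\<And>v. (\<Sum>r<n. (cmod (v r))\<^sup>2) = 1 \<Longrightarrow>
      \<exists>p\<in>Delta. \<forall>l. qform n (\<lambda>r s. a l $$ (r, s)) v = of_real (vec_nth p l)"
  shows "a \<in> nc_simplex"
proof (rule nc_simplexI[OF n a])
  fix c b assume cb: "nonneg_on c b"
  show "psd n (affine_form c b a)"
    unfolding psd_def
  proof
    fix v
    define m where "m = (\<Sum>r<n. (cmod (v r))\<^sup>2)"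
    show "qform n (affine_form c b a) v \<in> \<real>\<^sub>\<ge>\<^sub>0"
    proof (cases "m = 0")
      case True
      then have "v r = 0" if "r < n" for r
        using that by (simp add: m_def sum_nonneg_eq_0_iff)
      then have "qform n (affine_form c b a) v = 0" by (simp add: qform_def)
      then show ?thesis by simp
    next
      case False
      moreover have "0 \<le> m" by (simp add: m_def sum_nonneg)
      ultimately have m: "0 < m" by simp
      define z where "z = complex_of_real (1 / sqrt m)"
      have zz: "z * cnj z = of_real (1 / m)"
        using m unfolding z_def by (simp flip: of_real_mult)
      define w where "w r = z * v r" for r
      have "complex_of_real (\<Sum>r<n. (cmod (w r))\<^sup>2) = z * cnj z * of_real m"
        unfolding qform_id[symmetric] w_def m_def by (rule qform_smult_vec)
      also have "\<dots> = of_real 1" using zz m by (simp flip: of_real_mult)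
      finally have w1: "(\<Sum>r<n. (cmod (w r))\<^sup>2) = 1" by (simp only: of_real_eq_iff)
      then obtain p where p: "p \<in> Delta"
          "\<And>l. qform n (\<lambda>r s. a l $$ (r, s)) w = of_real (vec_nth p l)"
        using nr by blast
      have "qform n (affine_form c b a) w = of_real (c + (\<Sum>l\<in>UNIV. b l * vec_nth p l))"
        unfolding qform_affine_form qform_id w1 p(2) by simp
      then have "qform n (affine_form c b a) w \<in> \<real>\<^sub>\<ge>\<^sub>0"
        using nonneg_on_Delta[OF cb p(1)] by (simp only: nonneg_Reals_of_real_iff)
      moreover have "qform n (affine_form c b a) v = of_real m * qform n (affine_form c b a) w"
        unfolding w_def qform_smult_vec zz using m by (simp flip: of_real_mult mult.assoc)
      ultimately show ?thesis using m by (auto simp: complex_nonneg_Reals_iff)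
    qed
  qed
qed

text \<open>The third part is a barycentric expansion with matrix coefficients: an affine function
  that vanishes at all vertices satisfies two opposite inequalities on the simplex, so its value at
  a matrix tuple is both positive and negative, hence zero.\<close>

lemma nc_simplex_coordinates:
  assumes a: "a \<in> nc_simplex" "a \<in> tuples n"
  shows "i < M \<Longrightarrow> psd n (affine_form (\<alpha> i) (\<beta> i) a)"
    and "(\<Sum>i<M. affine_form (\<alpha> i) (\<beta> i) a r s) = of_bool (r = s)"
    and "r < n \<Longrightarrow> s < n \<Longrightarrow>
      a l $$ (r, s) = (\<Sum>i<M. of_real (vec_nth (V i) l) * affine_form (\<alpha> i) (\<beta> i) a r s)"
proof -
  show "psd n (affine_form (\<alpha> i) (\<beta> i) a)" if "i < M"
    by (rule nc_simplexD(2)[OF a]) (use that dual in \<open>simp add: nonneg_on_def\<close>)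
  have "(\<Sum>i<M. affine_form (\<alpha> i) (\<beta> i) a r s)
      = of_real (\<Sum>i<M. \<alpha> i) * of_bool (r = s) + (\<Sum>l\<in>UNIV. of_real (\<Sum>i<M. \<beta> i l) * a l $$ (r, s))"
    unfolding affine_form_def sum.distrib of_real_sum sum_distrib_right
    by (subst sum.swap) (rule refl)
  then show "(\<Sum>i<M. affine_form (\<alpha> i) (\<beta> i) a r s) = of_bool (r = s)"
    by (simp add: sum_\<alpha> sum_\<beta>)
  show "a l $$ (r, s) = (\<Sum>i<M. of_real (vec_nth (V i) l) * affine_form (\<alpha> i) (\<beta> i) a r s)"
    if "r < n" "s < n"
  proof -
    \<comment> \<open>\<open>c\<close> and \<open>b\<close> are the coefficients of the
      \<open>l\<close>-th coordinate function minus its own barycentric expansion.\<close>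
    define c where "c = - (\<Sum>i<M. vec_nth (V i) l * \<alpha> i)"
    define b where "b m = of_bool (m = l) - (\<Sum>i<M. vec_nth (V i) l * \<beta> i m)" for m
    have z: "c + (\<Sum>m\<in>UNIV. b m * vec_nth (V j) m) = 0" if "j < M" for j
    proof -
      have "(\<Sum>m\<in>UNIV. b m * vec_nth (V j) m) = vec_nth (V j) l
          - (\<Sum>i<M. vec_nth (V i) l * (\<Sum>m\<in>UNIV. \<beta> i m * vec_nth (V j) m))"
        unfolding b_def left_diff_distrib sum_subtractf sum_distrib_left sum_distrib_right
        by (subst (2) sum.swap) (simp add: of_bool_def mult.assoc if_distrib[of "\<lambda>x. x * _"] cong: if_cong)
      also have "\<dots> = vec_nth (V j) l - (\<Sum>i<M. vec_nth (V i) l * (of_bool (i = j) - \<alpha> i))"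
        by (intro arg_cong2[where f = minus] sum.cong refl arg_cong2[where f = times])
          (use dual[OF _ that] in \<open>simp add: algebra_simps flip: dual\<close>)
      also have "\<dots> = - c"
        using that by (simp add: c_def right_diff_distrib sum_subtractf of_bool_def
            if_distrib[of "\<lambda>x. _ * x"] cong: if_cong)
      finally show ?thesis by simp
    qed
    have 1: "psd n (affine_form c b a)" by (rule nc_simplexD(2)[OF a]) (simp add: nonneg_on_def z)
    have 2: "psd n (affine_form (- c) (\<lambda>m. - b m) a)"
    proof (rule nc_simplexD(2)[OF a])
      have "- c + (\<Sum>m\<in>UNIV. - b m * vec_nth (V j) m) = 0" if "j < M" for j
        using z[OF that] by (simp add: sum_negf)
      then show "nonneg_on (- c) (\<lambda>m. - b m)" by (simp add: nonneg_on_def)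
    qed
    have "qform n (affine_form c b a) v = 0" for v
    proof -
      have "qform n (affine_form (- c) (\<lambda>m. - b m) a) v = - qform n (affine_form c b a) v"
        unfolding qform_affine_form by (simp add: sum_negf)
      then show ?thesis
        using 1 2 unfolding psd_def by (metis complex_nonneg_Reals_iff complex_eq_iff minus_complex.simps(1)
          neg_0_le_iff_le uminus_complex.simps(1) zero_complex.simps order_antisym)
    qed
    then have "affine_form c b a r s = 0" using that by (rule qform_eq_0_imp)
    moreover have "affine_form c b a r s
        = a l $$ (r, s) - (\<Sum>i<M. of_real (vec_nth (V i) l) * affine_form (\<alpha> i) (\<beta> i) a r s)"
    proof -
      have "(\<Sum>m\<in>UNIV. of_real (b m) * a m $$ (r, s)) = a l $$ (r, s)
          - (\<Sum>i<M. of_real (vec_nth (V i) l) * (\<Sum>m\<in>UNIV. of_real (\<beta> i m) * a m $$ (r, s)))"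
        unfolding b_def of_real_diff left_diff_distrib sum_subtractf sum_distrib_left sum_distrib_right
          of_real_sum
        by (subst (2) sum.swap) (simp add: of_bool_def mult.assoc if_distrib[of "\<lambda>x. of_real x * _"] cong: if_cong)
      then show ?thesis
        unfolding affine_form_def c_def
        by (simp add: distrib_left sum.distrib sum_distrib_right mult.assoc)
    qed
    ultimately show ?thesis by simp
  qed
qed

text \<open>Each positive matrix f_i(a) is split into rank-one pieces, which exhibits
  \<open>a\<close> as a compression of a diagonal tuple of vertices. The pair of vertex
  \<open>i\<close> and piece \<open>t\<close> is coded by the single index
  \<open>j = i * n + t\<close>, and \<open>\<kappa> j\<close> recovers the vertex.\<close>

lemma nc_simplex_rank_one:
  assumes a: "a \<in> nc_simplex" "a \<in> tuples n"
  obtains N :: nat and \<kappa> w where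
    "\<And>j. j < N \<Longrightarrow> \<kappa> j < M"
    "\<And>r s. r < n \<Longrightarrow> s < n \<Longrightarrow> (\<Sum>j<N. w j r * cnj (w j s)) = of_bool (r = s)"
    "\<And>l r s. r < n \<Longrightarrow> s < n \<Longrightarrow>
       a l $$ (r, s) = (\<Sum>j<N. of_real (vec_nth (V (\<kappa> j)) l) * (w j r * cnj (w j s)))"
proof -
  have n: "1 \<le> n" by (rule nc_simplexD(1)[OF a])
  define w where "w i = (SOME w. \<forall>r<n. \<forall>s<n.
      affine_form (\<alpha> i) (\<beta> i) a r s = (\<Sum>t<n. w t r * cnj (w t s)))" for i
  have w: "affine_form (\<alpha> i) (\<beta> i) a r s = (\<Sum>t<n. w i t r * cnj (w i t s))"
    if i: "i < M" and rs: "r < n" "s < n" for i r s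
    using someI_ex[OF psd_decomp[OF nc_simplex_coordinates(1)[OF a i]]] rs unfolding w_def[symmetric]
    by blast
  define \<kappa> where "\<kappa> j = j div n" for j
  define u where "u j = w (j div n) (j mod n)" for j
  have 1: "\<kappa> j < M" if "j < M * n" for j using that n by (simp add: \<kappa>_def less_mult_imp_div_less)
  have 2: "(\<Sum>j<M * n. u j r * cnj (u j s)) = of_bool (r = s)" if rs: "r < n" "s < n" for r s
  proof -
    have "(\<Sum>j<M * n. u j r * cnj (u j s)) = (\<Sum>i<M. \<Sum>t<n. w i t r * cnj (w i t s))"
      unfolding u_def by (rule sum_div_mod[OF n])
    also have "\<dots> = (\<Sum>i<M. affine_form (\<alpha> i) (\<beta> i) a r s)"
      by (intro sum.cong refl) (simp add: w rs)
    finally show ?thesis unfolding nc_simplex_coordinates(2)[OF a] .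
  qed
  have 3: "a l $$ (r, s) = (\<Sum>j<M * n. of_real (vec_nth (V (\<kappa> j)) l) * (u j r * cnj (u j s)))"
    if rs: "r < n" "s < n" for l r s
  proof -
    have "(\<Sum>j<M * n. of_real (vec_nth (V (\<kappa> j)) l) * (u j r * cnj (u j s)))
        = (\<Sum>i<M. \<Sum>t<n. of_real (vec_nth (V i) l) * (w i t r * cnj (w i t s)))"
      unfolding u_def \<kappa>_def by (rule sum_div_mod[OF n])
    also have "\<dots> = (\<Sum>i<M. of_real (vec_nth (V i) l) * affine_form (\<alpha> i) (\<beta> i) a r s)"
      by (intro sum.cong refl) (simp add: w rs sum_distrib_left)
    finally show ?thesis unfolding nc_simplex_coordinates(3)[OF a rs] by (rule sym)
  qed
  show thesis by (rule that[OF 1 2 3])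
qed

end

section \<open>The minimal set, the first level, and uniqueness\<close>

lemma mat_adjoint_row_index:
  "r < n \<Longrightarrow> s < n \<Longrightarrow>
   (mat_adjoint (Matrix.mat 1 n (\<lambda>(_, s). cnj (w s))) * Matrix.mat 1 n (\<lambda>(_, s). cnj (w s))) $$ (r, s)
     = w r * cnj (w s)"
  by (simp add: adjoint_mult_index[of _ 1 n])

context simplex_coords
begin

lemma nc_simplex_eq_K_min: "nc_simplex = K_min (complexify ` Delta)"
proof (intro Set.equalityI subsetI)
  fix a assume a: "a \<in> nc_simplex"
  then obtain n where n: "1 \<le> n" "a \<in> tuples n" unfolding nc_simplex_def by blast
  obtain N :: nat and \<kappa> w where \<kappa>: "\<And>j. j < N \<Longrightarrow> \<kappa> j < M"
    and w: "\<And>r s. r < n \<Longrightarrow> s < n \<Longrightarrow> (\<Sum>j<N. w j r * cnj (w j s)) = of_bool (r = s)"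
    and al: "\<And>l r s. r < n \<Longrightarrow> s < n \<Longrightarrow>
       a l $$ (r, s) = (\<Sum>j<N. of_real (vec_nth (V (\<kappa> j)) l) * (w j r * cnj (w j s)))"
    by (rule nc_simplex_rank_one[OF a n(2)]) (rule that)
  define h where "h j = Matrix.mat n n (\<lambda>(r, s). w j r * cnj (w j s))" for j
  have "positive (Mat n) (h j)" for j
  proof -
    have "psd n (\<lambda>r s. h j $$ (r, s)) \<longleftrightarrow> psd n (\<lambda>r s. w j r * cnj (w j s))"
      by (rule psd_cong) (simp add: h_def)
    then show ?thesis unfolding positive_Mat_iff using psd_rank_one by (simp add: h_def)
  qed
  moreover have "complexify (V (\<kappa> j)) \<in> complexify ` Delta" if "j < N" for j
    using vertex_in_Delta[OF \<kappa>[OF that]] by (rule imageI)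
  moreover have "mat_sum n N h = 1\<^sub>m n"
    by (rule eq_matI) (auto simp: w h_def mat_sum_def)
  moreover have "a l = mat_sum n N (\<lambda>j. vec_nth (complexify (V (\<kappa> j))) l \<cdot>\<^sub>m h j)" for l
  proof (rule eq_matI)
    have "a l \<in> carrier_mat n n" using n(2) by (simp add: tuples_def)
    then show "dim_row (a l) = dim_row (mat_sum n N (\<lambda>j. vec_nth (complexify (V (\<kappa> j))) l \<cdot>\<^sub>m h j))"
      "dim_col (a l) = dim_col (mat_sum n N (\<lambda>j. vec_nth (complexify (V (\<kappa> j))) l \<cdot>\<^sub>m h j))"
      by (simp_all add: mat_sum_def)
    fix r s
    assume "r < dim_row (mat_sum n N (\<lambda>j. vec_nth (complexify (V (\<kappa> j))) l \<cdot>\<^sub>m h j))"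
      "s < dim_col (mat_sum n N (\<lambda>j. vec_nth (complexify (V (\<kappa> j))) l \<cdot>\<^sub>m h j))"
    then have rs: "r < n" "s < n" by (simp_all add: mat_sum_def)
    show "a l $$ (r, s) = mat_sum n N (\<lambda>j. vec_nth (complexify (V (\<kappa> j))) l \<cdot>\<^sub>m h j) $$ (r, s)"
      using rs by (simp add: al h_def complexify_def)
  qed
  ultimately have "\<exists>m h \<mu>. (\<forall>j<m. positive (Mat n) (h j) \<and> \<mu> j \<in> complexify ` Delta) \<and>
        mat_sum n m h = 1\<^sub>m n \<and> (\<forall>l. a l = mat_sum n m (\<lambda>j. vec_nth (\<mu> j) l \<cdot>\<^sub>m h j))"
    by (intro exI[of _ N] exI[of _ h] exI[of _ "\<lambda>j. complexify (V (\<kappa> j))"] conjI allI impI)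
  then show "a \<in> K_min (complexify ` Delta)"
    unfolding K_min_def by (intro CollectI, rule_tac x = n in exI) (intro conjI n)
next
  fix a assume "a \<in> K_min (complexify ` Delta)"
  then obtain n m h \<mu> where n: "1 \<le> n" "a \<in> tuples n"
    and h\<mu>: "\<forall>j<m. positive (Mat n) (h j) \<and> \<mu> j \<in> complexify ` Delta"
    and one: "mat_sum n m h = 1\<^sub>m n"
    and al: "\<forall>l. a l = mat_sum n m (\<lambda>j. vec_nth (\<mu> j) l \<cdot>\<^sub>m h j)"
    unfolding K_min_def by blast
  have h: "\<And>j. j < m \<Longrightarrow> positive (Mat n) (h j)"
    and \<mu>: "\<And>j. j < m \<Longrightarrow> \<mu> j \<in> complexify ` Delta" using h\<mu> by auto
  define p where "p j = (SOME p. p \<in> Delta \<and> \<mu> j = complexify p)" for j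
  have p: "p j \<in> Delta" "\<mu> j = complexify (p j)" if "j < m" for j
    using someI_ex[of "\<lambda>p. p \<in> Delta \<and> \<mu> j = complexify p"] \<mu>[OF that] unfolding p_def by blast+
  have hc: "h j \<in> carrier_mat n n" "psd n (\<lambda>r s. h j $$ (r, s))" if "j < m" for j
    using h[OF that] unfolding positive_Mat_iff by auto
  show "a \<in> nc_simplex"
  proof (rule nc_simplexI[OF n])
    fix c b assume cb: "nonneg_on c b"
    \<comment> \<open>Since the \<open>h j\<close> sum to the identity, the constant term spreads
      over them as well, and each \<open>h j\<close> is weighted by the value of the affine function
      at the point \<open>p j\<close>.\<close>
    have eq: "affine_form c b a r s
        = (\<Sum>j<m. complex_of_real (c + (\<Sum>l\<in>UNIV. b l * vec_nth (p j) l)) * h j $$ (r, s))"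
      if rs: "r < n" "s < n" for r s
    proof -
      have e: "of_bool (r = s) = (\<Sum>j<m. h j $$ (r, s))"
        using arg_cong[OF one, of "\<lambda>A. A $$ (r, s)"] rs by simp
      have "a l $$ (r, s) = (\<Sum>j<m. of_real (vec_nth (p j) l) * h j $$ (r, s))" for l
        unfolding spec[OF al] mat_sum_index[OF rs]
      proof (rule sum.cong[OF refl])
        fix j assume "j \<in> {..<m}"
        then show "(vec_nth (\<mu> j) l \<cdot>\<^sub>m h j) $$ (r, s) = of_real (vec_nth (p j) l) * h j $$ (r, s)"
          using p(2)[of j] hc(1)[of j] rs by (simp add: complexify_def)
      qed
      then have "affine_form c b a r s = (\<Sum>j<m. of_real c * h j $$ (r, s))
          + (\<Sum>l\<in>UNIV. \<Sum>j<m. of_real (b l * vec_nth (p j) l) * h j $$ (r, s))"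
        unfolding affine_form_def e by (simp add: sum_distrib_left mult.assoc)
      also have "(\<Sum>l\<in>UNIV. \<Sum>j<m. of_real (b l * vec_nth (p j) l) * h j $$ (r, s))
          = (\<Sum>j<m. \<Sum>l\<in>UNIV. of_real (b l * vec_nth (p j) l) * h j $$ (r, s))"
        by (rule sum.swap)
      finally show ?thesis by (simp add: sum.distrib distrib_right sum_distrib_right)
    qed
    have "psd n (\<lambda>r s. \<Sum>j<m. complex_of_real (c + (\<Sum>l\<in>UNIV. b l * vec_nth (p j) l)) * h j $$ (r, s))"
      by (intro psd_sum psd_scale) (use hc p nonneg_on_Delta[OF cb] in auto)
    with psd_cong[OF eq] show "psd n (affine_form c b a)" by (rule iffD2)
  qed
qed

text \<open>The normalisation of the \<open>\<gamma> j\<close> lets the constant term split along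
  with the linear ones, so the form of the combination at \<open>v\<close> is the sum of the forms
  of the \<open>a j\<close> at the vectors \<open>\<gamma> j v\<close>.\<close>

lemma matrix_convex_nc_simplex: "matrix_convex nc_simplex"
  unfolding matrix_convex_def
proof (intro conjI ballI allI impI)
  show "\<exists>n\<ge>1. a \<in> tuples n" if "a \<in> nc_simplex" for a using that unfolding nc_simplex_def by blast
  fix n m :: nat and N a \<gamma>
  assume n: "1 \<le> n"
    and "(\<forall>j<m. 1 \<le> N j \<and> a j \<in> level nc_simplex (N j) \<and> \<gamma> j \<in> carrier_mat (N j) n) \<and>
        mat_sum n m (\<lambda>j. mat_adjoint (\<gamma> j) * \<gamma> j) = 1\<^sub>m n"
  then have aj: "\<And>j. j < m \<Longrightarrow> a j \<in> nc_simplex" "\<And>j. j < m \<Longrightarrow> a j \<in> tuples (N j)"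
    and g: "\<And>j. j < m \<Longrightarrow> \<gamma> j \<in> carrier_mat (N j) n"
    and one: "mat_sum n m (\<lambda>j. mat_adjoint (\<gamma> j) * \<gamma> j) = 1\<^sub>m n"
    by (auto simp: level_def)
  define A where "A = (\<lambda>l. mat_sum n m (\<lambda>j. mat_adjoint (\<gamma> j) * a j l * \<gamma> j))"
  have At: "A \<in> tuples n" by (simp add: A_def tuples_def)
  have "A \<in> nc_simplex"
  proof (rule nc_simplexI[OF n At])
    fix c b assume cb: "nonneg_on c b"
    show "psd n (affine_form c b A)"
      unfolding psd_def
    proof
      fix v
      define u where "u j p = (\<Sum>s<n. \<gamma> j $$ (p, s) * v s)" for j p
      have "qform n (\<lambda>r s. of_bool (r = s)) v = qform n (\<lambda>r s. mat_sum n m (\<lambda>j. mat_adjoint (\<gamma> j) * \<gamma> j) $$ (r, s)) v"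
        unfolding one by (rule qform_cong) auto
      also have "\<dots> = (\<Sum>j<m. qform (N j) (\<lambda>r s. of_bool (r = s)) (u j))"
        unfolding qform_mat_sum u_def by (intro sum.cong refl qform_adjoint_mult g) simp
      finally have i: "qform n (\<lambda>r s. of_bool (r = s)) v = (\<Sum>j<m. qform (N j) (\<lambda>r s. of_bool (r = s)) (u j))" .
      have ii: "qform n (\<lambda>r s. A l $$ (r, s)) v = (\<Sum>j<m. qform (N j) (\<lambda>r s. a j l $$ (r, s)) (u j))" for l
        unfolding qform_mat_sum u_def A_def
        by (intro sum.cong refl qform_conj_mat) (use g aj(2) in \<open>auto simp: tuples_def\<close>)
      have "qform n (affine_form c b A) v = (\<Sum>j<m. of_real c * qform (N j) (\<lambda>r s. of_bool (r = s)) (u j))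
          + (\<Sum>l\<in>UNIV. \<Sum>j<m. of_real (b l) * qform (N j) (\<lambda>r s. a j l $$ (r, s)) (u j))"
        unfolding qform_affine_form i ii sum_distrib_left ..
      also have "\<dots> = (\<Sum>j<m. qform (N j) (affine_form c b (a j)) (u j))"
        unfolding qform_affine_form sum.distrib by (subst (2) sum.swap) (rule refl)
      also have "\<dots> \<in> \<real>\<^sub>\<ge>\<^sub>0"
        using nc_simplexD(2)[OF aj cb] unfolding psd_def by (intro nonneg_Reals_sum) auto
      finally show "qform n (affine_form c b A) v \<in> \<real>\<^sub>\<ge>\<^sub>0" .
    qed
  qed
  then show "(\<lambda>l. mat_sum n m (\<lambda>j. mat_adjoint (\<gamma> j) * a j l * \<gamma> j)) \<in> level nc_simplex n"
    using At unfolding A_def level_def by simp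
qed

lemma point_tuple_index: "point_tuple p l $$ (0, 0) = vec_nth p l"
  by (simp add: point_tuple_def)

lemma point_tuple_in_tuples: "point_tuple p \<in> tuples 1"
  by (simp add: point_tuple_def tuples_def)

lemma tuples_1_eq_point_tuple:
  assumes "a \<in> tuples 1" "\<And>l. a l $$ (0, 0) = vec_nth p l"
  shows "a = point_tuple p"
proof
  fix l
  have "a l \<in> carrier_mat 1 1" using assms(1) by (simp add: tuples_def)
  then show "a l = point_tuple p l"
    by (intro eq_matI) (auto simp: point_tuple_def assms(2))
qed

lemma level_1_nc_simplex: "level nc_simplex 1 = point_tuple ` complexify ` Delta"
proof (intro Set.equalityI subsetI)
  fix a assume "a \<in> level nc_simplex 1"
  then have a: "a \<in> nc_simplex" "a \<in> tuples 1" by (auto simp: level_def)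
  obtain N :: nat and \<kappa> w where \<kappa>: "\<And>j. j < N \<Longrightarrow> \<kappa> j < M"
    and w: "\<And>r s. r < 1 \<Longrightarrow> s < 1 \<Longrightarrow> (\<Sum>j<N. w j r * cnj (w j s)) = of_bool (r = s)"
    and al: "\<And>l r s. r < 1 \<Longrightarrow> s < 1 \<Longrightarrow>
       a l $$ (r, s) = (\<Sum>j<N. of_real (vec_nth (V (\<kappa> j)) l) * (w j r * cnj (w j s)))"
    by (rule nc_simplex_rank_one[OF a]) (rule that)
  define t where "t j = (cmod (w j 0))\<^sup>2" for j
  have ww: "w j 0 * cnj (w j 0) = of_real (t j)" for j
    unfolding t_def by (rule complex_norm_square[symmetric])
  define p where "p = (\<Sum>j<N. t j *\<^sub>R V (\<kappa> j))"
  have "(\<Sum>j<N. complex_of_real (t j)) = of_real 1" using w[of 0 0] by (simp add: ww)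
  then have t1: "(\<Sum>j<N. t j) = 1" by (simp only: of_real_eq_iff flip: of_real_sum)
  have "p \<in> Delta"
    unfolding p_def
  proof (rule convex_sum)
    show "convex Delta" by (simp add: Delta_def convex_convex_hull)
  qed (use t1 \<kappa> vertex_in_Delta in \<open>auto simp: t_def\<close>)
  moreover have "a = point_tuple (complexify p)"
    by (rule tuples_1_eq_point_tuple[OF a(2)])
      (simp add: al ww p_def complexify_def sum_component mult.commute)
  ultimately show "a \<in> point_tuple ` complexify ` Delta" by blast
next
  fix a assume "a \<in> point_tuple ` complexify ` Delta"
  then obtain p where p: "p \<in> Delta" and a: "a = point_tuple (complexify p)" by blast
  have t: "a \<in> tuples 1" unfolding a by (rule point_tuple_in_tuples)
  have "a \<in> nc_simplex"
  proof (rule nc_simplexI_numerical_range[OF order_refl t])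
    fix v :: "nat \<Rightarrow> complex" assume "(\<Sum>r<1. (cmod (v r))\<^sup>2) = 1"
    then have "v 0 * cnj (v 0) = of_real 1" using complex_norm_square[of "v 0"] by simp
    then have "qform 1 (\<lambda>r s. a l $$ (r, s)) v = of_real (vec_nth p l)" for l
      by (simp add: qform_def a point_tuple_def complexify_def mult.assoc)
    then show "\<exists>p\<in>Delta. \<forall>l. qform 1 (\<lambda>r s. a l $$ (r, s)) v = of_real (vec_nth p l)" using p by blast
  qed
  then show "a \<in> level nc_simplex 1" using t by (simp add: level_def)
qed

text \<open>Compressing a tuple of \<open>L\<close> by a unit column vector lands in the first
  level, so its numerical range lies in the simplex. Conversely the rank-one representation writes a
  tuple of \<open>nc_simplex\<close> as a matrix convex combination of vertices, with one row vector
  as coefficient for each piece.\<close>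

lemma matrix_convex_unique:
  assumes L: "matrix_convex L" and L1: "level L 1 = point_tuple ` complexify ` Delta"
  shows "L = nc_simplex"
proof (intro Set.equalityI subsetI)
  have mc: "(\<lambda>l. mat_sum n m (\<lambda>j. mat_adjoint (\<gamma> j) * a j l * \<gamma> j)) \<in> level L n"
    if "1 \<le> n" "\<And>j. j < m \<Longrightarrow> 1 \<le> N j \<and> a j \<in> level L (N j) \<and> \<gamma> j \<in> carrier_mat (N j) n"
      "mat_sum n m (\<lambda>j. mat_adjoint (\<gamma> j) * \<gamma> j) = 1\<^sub>m n" for n m N a \<gamma>
    using L that unfolding matrix_convex_def by blast
  fix a
  {
    assume a: "a \<in> L"
    then obtain n where n: "1 \<le> n" "a \<in> tuples n" using L unfolding matrix_convex_def by blast
    then have ac: "a l \<in> carrier_mat n n" for l by (simp add: tuples_def)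
    show "a \<in> nc_simplex"
    proof (rule nc_simplexI_numerical_range[OF n])
      fix v :: "nat \<Rightarrow> complex" assume v: "(\<Sum>r<n. (cmod (v r))\<^sup>2) = 1"
      define g where "g = Matrix.mat n 1 (\<lambda>(r, _). v r)"
      have g: "g \<in> carrier_mat n 1" by (simp add: g_def)
      have "(mat_adjoint g * g) $$ (0, 0) = (\<Sum>p<n. complex_of_real ((cmod (v p))\<^sup>2))"
        unfolding complex_norm_square adjoint_mult_index[OF g, of 0 0, simplified]
        by (intro sum.cong) (simp_all add: g_def mult.commute)
      also have "\<dots> = 1" using v by (metis of_real_1 of_real_sum)
      finally have "mat_sum 1 1 (\<lambda>_. mat_adjoint g * g) = 1\<^sub>m 1"
        by (intro eq_matI) (auto simp: mat_sum_def)
      moreover have "a \<in> level L n" using a n by (simp add: level_def)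
      ultimately have "(\<lambda>l. mat_sum 1 1 (\<lambda>_. mat_adjoint g * a l * g)) \<in> level L 1"
        using mc[of 1 1 "\<lambda>_. n" "\<lambda>_. a" "\<lambda>_. g"] n g by simp
      then obtain p where p: "p \<in> Delta"
          "(\<lambda>l. mat_sum 1 1 (\<lambda>_. mat_adjoint g * a l * g)) = point_tuple (complexify p)"
        unfolding L1 by blast
      have "qform n (\<lambda>r s. a l $$ (r, s)) v = of_real (vec_nth p l)" for l
      proof -
        have "qform n (\<lambda>r s. a l $$ (r, s)) v = qform n (\<lambda>r s. a l $$ (r, s)) (\<lambda>p. \<Sum>s<1. g $$ (p, s) * 1)"
          by (rule qform_cong) (simp_all add: g_def)
        also have "\<dots> = qform 1 (\<lambda>r s. (mat_adjoint g * a l * g) $$ (r, s)) (\<lambda>_. 1)"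
          by (rule qform_conj_mat[OF g ac, symmetric])
        also have "\<dots> = mat_sum 1 1 (\<lambda>_. mat_adjoint g * a l * g) $$ (0, 0)"
          by (simp add: qform_def)
        also have "\<dots> = of_real (vec_nth p l)"
          using fun_cong[OF p(2), of l] by (simp add: point_tuple_index complexify_def)
        finally show ?thesis .
      qed
      then show "\<exists>p\<in>Delta. \<forall>l. qform n (\<lambda>r s. a l $$ (r, s)) v = of_real (vec_nth p l)"
        using p(1) by blast
    qed
  next
    assume a: "a \<in> nc_simplex"
    then obtain n where n: "1 \<le> n" "a \<in> tuples n" unfolding nc_simplex_def by blast
    obtain N :: nat and \<kappa> w where \<kappa>: "\<And>j. j < N \<Longrightarrow> \<kappa> j < M"
      and w: "\<And>r s. r < n \<Longrightarrow> s < n \<Longrightarrow> (\<Sum>j<N. w j r * cnj (w j s)) = of_bool (r = s)"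
      and al: "\<And>l r s. r < n \<Longrightarrow> s < n \<Longrightarrow>
         a l $$ (r, s) = (\<Sum>j<N. of_real (vec_nth (V (\<kappa> j)) l) * (w j r * cnj (w j s)))"
      by (rule nc_simplex_rank_one[OF a n(2)]) (rule that)
    define g where "g j = Matrix.mat 1 n (\<lambda>(_, s). cnj (w j s))" for j
    have g: "g j \<in> carrier_mat 1 n" for j by (simp add: g_def)
    define A where "A j = point_tuple (complexify (V (\<kappa> j)))" for j
    have Ac: "A j l \<in> carrier_mat 1 1" for j l by (simp add: A_def point_tuple_def)
    have "A j \<in> level L 1" if "j < N" for j
      unfolding L1 A_def using vertex_in_Delta[OF \<kappa>[OF that]] by blast
    moreover have "mat_sum n N (\<lambda>j. mat_adjoint (g j) * g j) = 1\<^sub>m n"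
      by (rule eq_matI) (auto simp: mat_sum_def g_def mat_adjoint_row_index w simp del: One_nat_def)
    ultimately have "(\<lambda>l. mat_sum n N (\<lambda>j. mat_adjoint (g j) * A j l * g j)) \<in> level L n"
      using mc[of n N "\<lambda>_. 1" A g] n g by simp
    moreover have "mat_sum n N (\<lambda>j. mat_adjoint (g j) * A j l * g j) = a l" for l
    proof (rule eq_matI)
      have "a l \<in> carrier_mat n n" using n(2) by (simp add: tuples_def)
      then show "dim_row (mat_sum n N (\<lambda>j. mat_adjoint (g j) * A j l * g j)) = dim_row (a l)"
        "dim_col (mat_sum n N (\<lambda>j. mat_adjoint (g j) * A j l * g j)) = dim_col (a l)"
        by (simp_all add: mat_sum_def)
      fix r s assume "r < dim_row (a l)" "s < dim_col (a l)"
      then have rs: "r < n" "s < n" using \<open>a l \<in> carrier_mat n n\<close> by auto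
      then show "mat_sum n N (\<lambda>j. mat_adjoint (g j) * A j l * g j) $$ (r, s) = a l $$ (r, s)"
        by (simp add: conj_mat_index[OF g Ac] al)
          (simp add: g_def A_def point_tuple_index complexify_def mult_ac)
    qed
    ultimately show "a \<in> L" by (simp add: level_def)
  }
qed

end

subsection \<open>Unital completely positive maps\<close>

lemma cstar_gen_closed:
  shows "S \<in> cstar_gen R X \<Longrightarrow> T \<in> cstar_gen R X \<Longrightarrow> add R S T \<in> cstar_gen R X"
    and "T \<in> cstar_gen R X \<Longrightarrow> scl R c T \<in> cstar_gen R X"
    and "X \<subseteq> cstar_gen R X"
  unfolding cstar_gen_def cstar_subalg_def lin_subspace_def by blast+

lemma op_system_members: "unt R \<in> op_system R x" "x l \<in> op_system R x"
  unfolding op_system_def by auto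

abbreviation cstar :: "('a, 'v) op_alg \<Rightarrow> ('d \<Rightarrow> 'a) \<Rightarrow> 'a set" where
  "cstar R x \<equiv> cstar_gen R (op_system R x)"

lemma cstar_members: "unt R \<in> cstar R x" "x l \<in> cstar R x"
  by (rule subsetD[OF cstar_gen_closed(3) op_system_members(1)],
      rule subsetD[OF cstar_gen_closed(3) op_system_members(2)])

text \<open>The record \<open>op_alg\<close> offers only a binary addition, so the affine
  combination is folded over a list; \<open>affine_op\<close> fixes one enumeration of the finite
  index type.\<close>

fun affine_list :: "('a, 'v) op_alg \<Rightarrow> real \<Rightarrow> ('d \<Rightarrow> real) \<Rightarrow> ('d \<Rightarrow> 'a) \<Rightarrow> 'd list \<Rightarrow> 'a" where
  "affine_list R c b x [] = scl R (of_real c) (unt R)"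
| "affine_list R c b x (l # ls) = add R (scl R (of_real (b l)) (x l)) (affine_list R c b x ls)"

definition affine_op :: "('a, 'v) op_alg \<Rightarrow> real \<Rightarrow> ('d::finite \<Rightarrow> real) \<Rightarrow> ('d \<Rightarrow> 'a) \<Rightarrow> 'a" where
  "affine_op R c b x = affine_list R c b x (SOME ls. set ls = UNIV \<and> distinct ls)"

lemma enum_list: "set (SOME ls. set ls = (UNIV :: 'd::finite set) \<and> distinct ls) = UNIV"
  "distinct (SOME ls. set ls = (UNIV :: 'd::finite set) \<and> distinct ls)"
proof -
  have "\<exists>ls. set ls = (UNIV :: 'd set) \<and> distinct ls" by (rule finite_distinct_list) simp
  from someI_ex[OF this]
  show "set (SOME ls. set ls = (UNIV :: 'd set) \<and> distinct ls) = UNIV"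
    "distinct (SOME ls. set ls = (UNIV :: 'd set) \<and> distinct ls)" by (rule conjunct1, rule conjunct2)
qed

lemma ucp_affine_list:
  assumes "ucp R (cstar R x) n \<phi>" "distinct ls"
  shows "affine_list R c b x ls \<in> cstar R x \<and> (\<forall>r<n. \<forall>s<n. \<phi> (affine_list R c b x ls) $$ (r, s)
      = of_real c * of_bool (r = s) + (\<Sum>l\<in>set ls. of_real (b l) * \<phi> (x l) $$ (r, s)))"
  using assms(2)
proof (induction ls)
  case Nil
  have "\<phi> (scl R (of_real c) (unt R)) = of_real c \<cdot>\<^sub>m 1\<^sub>m n"
    using assms(1) cstar_members(1)[of R x] unfolding ucp_def by simp
  then show ?case by (simp add: cstar_gen_closed cstar_members)
next
  case (Cons l ls)
  have A: "affine_list R c b x ls \<in> cstar R x" using Cons by simp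
  have l: "scl R (of_real (b l)) (x l) \<in> cstar R x" by (simp add: cstar_gen_closed cstar_members)
  have "\<phi> (affine_list R c b x (l # ls)) = of_real (b l) \<cdot>\<^sub>m \<phi> (x l) + \<phi> (affine_list R c b x ls)"
    using assms(1) A l cstar_members(2)[of x l R] unfolding ucp_def by simp
  moreover have "\<phi> (x l) \<in> carrier_mat n n" "\<phi> (affine_list R c b x ls) \<in> carrier_mat n n"
    using assms(1) A cstar_members(2)[of x l R] unfolding ucp_def by simp_all
  ultimately show ?case
    using Cons A l by (auto simp: cstar_gen_closed)
qed

lemma ucp_positive:
  assumes \<phi>: "ucp R A n \<phi>" and T: "T \<in> A" "positive R T"
  shows "psd n (\<lambda>r s. \<phi> T $$ (r, s))"
proof -
  have "mat_positive R 1 (\<lambda>_ _. T)" using T by (simp add: mat_positive_def positive_def)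
  moreover have "\<forall>k F. (\<forall>i<k. \<forall>j<k. F i j \<in> A) \<and> mat_positive R k F \<longrightarrow>
        mat_positive (Mat n) k (\<lambda>i j. \<phi> (F i j))"
    using \<phi> unfolding ucp_def by (elim conjE)
  ultimately have mp: "mat_positive (Mat n) 1 (\<lambda>_ _. \<phi> T)"
    using T(1) by (elim allE[of _ 1] allE[of _ "\<lambda>_ _. T"]) simp
  have "positive (Mat n) (\<phi> T)"
    unfolding positive_def
  proof (intro conjI ballI)
    show "\<phi> T \<in> ops (Mat n)" using mp unfolding mat_positive_def by simp
    fix v assume "v \<in> vecs (Mat n)"
    then show "ip (Mat n) (app (Mat n) (\<phi> T) v) v \<in> \<real>\<^sub>\<ge>\<^sub>0"
      using mp unfolding mat_positive_def by (elim conjE allE[of _ "\<lambda>_. v"]) simp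
  qed
  then show ?thesis unfolding positive_Mat_iff by simp
qed

lemma ucp_affine_form:
  assumes \<phi>: "ucp R (cstar R x) n \<phi>" and p: "positive R (affine_op R c b x)"
  shows "psd n (affine_form c b (\<lambda>l. \<phi> (x l)))"
proof -
  note A = ucp_affine_list[OF \<phi> enum_list(2), of c b, folded affine_op_def, unfolded enum_list(1)]
  have "psd n (\<lambda>r s. \<phi> (affine_op R c b x) $$ (r, s))"
    by (rule ucp_positive[OF \<phi> _ p]) (use A in simp)
  moreover have "psd n (\<lambda>r s. \<phi> (affine_op R c b x) $$ (r, s)) \<longleftrightarrow> psd n (affine_form c b (\<lambda>l. \<phi> (x l)))"
    by (rule psd_cong) (use A in \<open>simp add: affine_form_def\<close>)
  ultimately show ?thesis by simp
qed

lemma ucp_tuple: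
  assumes "ucp R (cstar R x) n \<phi>"
  shows "(\<lambda>l. \<phi> (x l)) \<in> tuples n"
  using assms cstar_members(2)[of x _ R] unfolding ucp_def tuples_def by simp

lemma (in simplex_coords) matrix_range_subset_nc_simplex:
  assumes "\<And>c b. nonneg_on c b \<Longrightarrow> positive R (affine_op R c b x)"
  shows "matrix_range R x \<subseteq> nc_simplex"
proof
  fix a assume "a \<in> matrix_range R x"
  then obtain n \<phi> where n: "1 \<le> n" and \<phi>: "ucp R (cstar R x) n \<phi>" and a: "a = (\<lambda>l. \<phi> (x l))"
    unfolding matrix_range_def by blast
  show "a \<in> nc_simplex" unfolding a
    by (rule nc_simplexI[OF n ucp_tuple[OF \<phi>]]) (rule ucp_affine_form[OF \<phi> assms])
qed

text \<open>A scalar-valued map with complete positivity built in: \<open>ucp_of_states\<close>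
  needs the scalar matrix of values \<open>\<psi> (F i j)\<close> to be positive semidefinite for
  every \<open>k\<close>. For limits of vector states this can be checked directly, by testing
  \<open>F\<close> on multiples of one vector.\<close>

definition state_on :: "('a, 'v) op_alg \<Rightarrow> 'a set \<Rightarrow> ('a \<Rightarrow> complex) \<Rightarrow> bool" where
  "state_on R A \<psi> \<longleftrightarrow>
     (\<forall>S\<in>A. \<forall>T\<in>A. \<psi> (add R S T) = \<psi> S + \<psi> T) \<and>
     (\<forall>c. \<forall>T\<in>A. \<psi> (scl R c T) = c * \<psi> T) \<and>
     \<psi> (unt R) = 1 \<and>
     (\<forall>k F z. (\<forall>i<k. \<forall>j<k. F i j \<in> A) \<and> mat_positive R k F \<longrightarrow>
        (\<Sum>i<k. \<Sum>j<k. \<psi> (F i j) * z j * cnj (z i)) \<in> \<real>\<^sub>\<ge>\<^sub>0)"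

text \<open>
  A map \<open>T \<mapsto> \<Sum>j. \<psi> j T * w j (w j)\<^sup>*\<close> with states \<open>\<psi> j\<close> is completely positive, because it
  factors through a commutative algebra.
\<close>

lemma ucp_of_states:
  fixes m n :: nat
  assumes \<psi>: "\<And>j. j < m \<Longrightarrow> state_on R A (\<psi> j)"
    and w: "\<And>r s. r < n \<Longrightarrow> s < n \<Longrightarrow> (\<Sum>j<m. w j r * cnj (w j s)) = of_bool (r = s)"
  shows "ucp R A n (\<lambda>T. Matrix.mat n n (\<lambda>(r, s). \<Sum>j<m. \<psi> j T * (w j r * cnj (w j s))))"
    (is "ucp R A n ?\<phi>")
  unfolding ucp_def
proof (intro conjI ballI allI impI)
  show "?\<phi> T \<in> carrier_mat n n" for T by simp
  show "?\<phi> (add R S T) = ?\<phi> S + ?\<phi> T" if "S \<in> A" "T \<in> A" for S T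
    by (rule eq_matI) (use \<psi> that in \<open>auto simp: state_on_def distrib_right sum.distrib\<close>)
  show "?\<phi> (scl R c T) = c \<cdot>\<^sub>m ?\<phi> T" if "T \<in> A" for c T
    by (rule eq_matI) (use \<psi> that in \<open>auto simp: state_on_def sum_distrib_left mult.assoc\<close>)
  show "?\<phi> (unt R) = 1\<^sub>m n"
    by (rule eq_matI) (use \<psi> w in \<open>auto simp: state_on_def\<close>)
  fix k F
  assume F: "(\<forall>i<k. \<forall>j<k. F i j \<in> A) \<and> mat_positive R k F"
  show "mat_positive (Mat n) k (\<lambda>i j. ?\<phi> (F i j))"
    unfolding mat_positive_def
  proof (intro conjI allI impI)
    fix \<xi> :: "nat \<Rightarrow> complex Matrix.vec"
    assume \<xi>: "\<forall>i<k. \<xi> i \<in> vecs (Mat n)"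
    \<comment> \<open>The inner product of \<open>\<xi> j\<close> with \<open>w p\<close>. For each
      \<open>p\<close>, what remains is the form of the state \<open>\<psi> p\<close> at the scalars
      \<open>z p\<close>.\<close>
    define z where "z p j = (\<Sum>s<n. cnj (w p s) * vec_index (\<xi> j) s)" for p j
    have "ip (Mat n) (app (Mat n) (?\<phi> (F i j)) (\<xi> j)) (\<xi> i) = (\<Sum>p<m. \<psi> p (F i j) * z p j * cnj (z p i))"
      if ij: "i < k" "j < k" for i j
    proof -
      have "ip (Mat n) (app (Mat n) (?\<phi> (F i j)) (\<xi> j)) (\<xi> i)
          = (\<Sum>r<n. \<Sum>s<n. ?\<phi> (F i j) $$ (r, s) * vec_index (\<xi> j) s * cnj (vec_index (\<xi> i) r))"
        unfolding Mat_simps by (rule app_ip_Mat) (use \<xi> ij in auto)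
      also have "\<dots> = (\<Sum>r<n. \<Sum>s<n. \<Sum>p<m. \<psi> p (F i j) * (w p r * cnj (w p s)) * vec_index (\<xi> j) s * cnj (vec_index (\<xi> i) r))"
        by (intro sum.cong refl) (simp add: sum_distrib_right)
      also have "\<dots> = (\<Sum>r<n. \<Sum>p<m. \<psi> p (F i j) * z p j * (w p r * cnj (vec_index (\<xi> i) r)))"
      proof (rule sum.cong[OF refl])
        fix r
        have "(\<Sum>s<n. \<Sum>p<m. \<psi> p (F i j) * (w p r * cnj (w p s)) * vec_index (\<xi> j) s * cnj (vec_index (\<xi> i) r))
            = (\<Sum>p<m. \<Sum>s<n. \<psi> p (F i j) * (w p r * cnj (w p s)) * vec_index (\<xi> j) s * cnj (vec_index (\<xi> i) r))"
          by (rule sum.swap)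
        also have "\<dots> = (\<Sum>p<m. \<psi> p (F i j) * z p j * (w p r * cnj (vec_index (\<xi> i) r)))"
          by (rule sum.cong[OF refl]) (simp add: z_def sum_distrib_left sum_distrib_right mult_ac)
        finally show "(\<Sum>s<n. \<Sum>p<m. \<psi> p (F i j) * (w p r * cnj (w p s)) * vec_index (\<xi> j) s * cnj (vec_index (\<xi> i) r))
            = (\<Sum>p<m. \<psi> p (F i j) * z p j * (w p r * cnj (vec_index (\<xi> i) r)))" .
      qed
      also have "\<dots> = (\<Sum>p<m. \<Sum>r<n. \<psi> p (F i j) * z p j * (w p r * cnj (vec_index (\<xi> i) r)))"
        by (rule sum.swap)
      also have "\<dots> = (\<Sum>p<m. \<psi> p (F i j) * z p j * cnj (z p i))"
        by (rule sum.cong[OF refl]) (simp add: z_def[of _ i] sum_distrib_left)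
      finally show ?thesis .
    qed
    then have "(\<Sum>i<k. \<Sum>j<k. ip (Mat n) (app (Mat n) (?\<phi> (F i j)) (\<xi> j)) (\<xi> i))
        = (\<Sum>i<k. \<Sum>j<k. \<Sum>p<m. \<psi> p (F i j) * z p j * cnj (z p i))" by simp
    also have "\<dots> = (\<Sum>i<k. \<Sum>p<m. \<Sum>j<k. \<psi> p (F i j) * z p j * cnj (z p i))"
      by (rule sum.cong[OF refl], rule sum.swap)
    also have "\<dots> = (\<Sum>p<m. \<Sum>i<k. \<Sum>j<k. \<psi> p (F i j) * z p j * cnj (z p i))" by (rule sum.swap)
    also have "\<dots> \<in> \<real>\<^sub>\<ge>\<^sub>0"
      by (rule nonneg_Reals_sum) (use \<psi> F in \<open>auto simp: state_on_def\<close>)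
    finally show "(\<Sum>i<k. \<Sum>j<k. ip (Mat n) (app (Mat n) (?\<phi> (F i j)) (\<xi> j)) (\<xi> i)) \<in> \<real>\<^sub>\<ge>\<^sub>0" .
  qed simp
qed

section \<open>Vector states on matrices and the maximal set\<close>

lemma affine_list_Mat:
  assumes "\<And>l. a l \<in> carrier_mat n n" "distinct ls"
  shows "affine_list (Mat n) c b a ls \<in> carrier_mat n n \<and>
    (\<forall>r<n. \<forall>s<n. affine_list (Mat n) c b a ls $$ (r, s)
      = of_real c * of_bool (r = s) + (\<Sum>l\<in>set ls. of_real (b l) * a l $$ (r, s)))"
  using assms(2)
proof (induction ls)
  case (Cons l ls)
  then show ?case using assms(1)[of l] by auto
qed simp

lemma cstar_Mat_subset:
  assumes "a \<in> tuples n"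
  shows "cstar (Mat n) a \<subseteq> carrier_mat n n"
proof -
  have "lin_subspace (Mat n) (carrier_mat n n)"
    unfolding lin_subspace_def using zero_carrier_mat[of n n] by auto
  moreover have "cstar_subalg (Mat n) (carrier_mat n n)"
    unfolding cstar_subalg_def using calculation by simp
  moreover have "op_system (Mat n) a \<subseteq> carrier_mat n n"
    unfolding op_system_def using calculation(1) assms by (intro Inter_lower) (auto simp: tuples_def)
  ultimately show ?thesis unfolding cstar_gen_def by blast
qed

lemma vector_state_Mat:
  assumes A: "A \<subseteq> carrier_mat n n" and v: "(\<Sum>r<n. (cmod (v r))\<^sup>2) = 1"
  shows "state_on (Mat n) A (\<lambda>T. qform n (\<lambda>r s. T $$ (r, s)) v)"
  unfolding state_on_def
proof (intro conjI ballI allI impI)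
  show "qform n (\<lambda>r s. add (Mat n) S T $$ (r, s)) v = qform n (\<lambda>r s. S $$ (r, s)) v + qform n (\<lambda>r s. T $$ (r, s)) v"
    if "S \<in> A" "T \<in> A" for S T
    unfolding qform_add[symmetric] by (rule qform_cong) (use that A in auto)
  show "qform n (\<lambda>r s. scl (Mat n) c T $$ (r, s)) v = c * qform n (\<lambda>r s. T $$ (r, s)) v" if "T \<in> A" for c T
    unfolding qform_scale[symmetric] by (rule qform_cong) (use that A in auto)
  have "qform n (\<lambda>r s. unt (Mat n) $$ (r, s)) v = qform n (\<lambda>r s. of_bool (r = s)) v"
    by (rule qform_cong) auto
  then show "qform n (\<lambda>r s. unt (Mat n) $$ (r, s)) v = 1" by (simp add: qform_id v)
  fix k :: nat and F :: "nat \<Rightarrow> nat \<Rightarrow> complex mat" and z :: "nat \<Rightarrow> complex"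
  assume F: "(\<forall>i<k. \<forall>j<k. F i j \<in> A) \<and> mat_positive (Mat n) k F"
  define \<xi> where "\<xi> i = Matrix.vec n (\<lambda>r. z i * v r)" for i
  have "(\<Sum>i<k. \<Sum>j<k. ip (Mat n) (app (Mat n) (F i j) (\<xi> j)) (\<xi> i)) \<in> \<real>\<^sub>\<ge>\<^sub>0"
    using F unfolding mat_positive_def by (auto simp: \<xi>_def)
  moreover have "ip (Mat n) (app (Mat n) (F i j) (\<xi> j)) (\<xi> i)
      = qform n (\<lambda>r s. F i j $$ (r, s)) v * z j * cnj (z i)" if "i < k" "j < k" for i j
  proof -
    have "ip (Mat n) (app (Mat n) (F i j) (\<xi> j)) (\<xi> i)
        = (\<Sum>r<n. \<Sum>s<n. F i j $$ (r, s) * vec_index (\<xi> j) s * cnj (vec_index (\<xi> i) r))"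
      unfolding Mat_simps by (rule app_ip_Mat) (use F A that in \<open>auto simp: \<xi>_def\<close>)
    also have "\<dots> = (\<Sum>r<n. \<Sum>s<n. F i j $$ (r, s) * v s * cnj (v r) * (z j * cnj (z i)))"
      by (intro sum.cong refl) (simp add: \<xi>_def)
    finally show ?thesis by (simp add: qform_def sum_distrib_right mult.assoc)
  qed
  ultimately show "(\<Sum>i<k. \<Sum>j<k. qform n (\<lambda>r s. F i j $$ (r, s)) v * z j * cnj (z i)) \<in> \<real>\<^sub>\<ge>\<^sub>0" by simp
qed

lemma matrix_range_state:
  assumes "state_on R (cstar R x) \<psi>"
  shows "ucp R (cstar R x) 1 (\<lambda>T. Matrix.mat 1 1 (\<lambda>_. \<psi> T))"
  using ucp_of_states[of 1 R "cstar R x" "\<lambda>_. \<psi>" 1 "\<lambda>_ _. 1"] assms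
  by (simp add: case_prod_unfold)

text \<open>Unital completely positive maps preserve the affine inequalities, so a tuple of
  \<open>nc_simplex\<close> keeps its whole matrix range there. In the other direction vector states
  put the numerical range of a tuple into the first level of its matrix range.\<close>

lemma (in simplex_coords) nc_simplex_eq_K_max: "nc_simplex = K_max (complexify ` Delta)"
proof (intro Set.equalityI subsetI)
  fix a assume a: "a \<in> nc_simplex"
  then obtain n where n: "1 \<le> n" "a \<in> tuples n" unfolding nc_simplex_def by blast
  have "matrix_range (Mat n) a \<subseteq> nc_simplex"
  proof (rule matrix_range_subset_nc_simplex)
    fix c b assume "nonneg_on c b"
    then have p: "psd n (affine_form c b a)" by (rule nc_simplexD(2)[OF a n(2)])
    have "a l \<in> carrier_mat n n" for l using n(2) by (simp add: tuples_def)
    note A = affine_list_Mat[OF this enum_list(2), of c b, folded affine_op_def, unfolded enum_list(1)]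
    have "psd n (\<lambda>r s. affine_op (Mat n) c b a $$ (r, s)) \<longleftrightarrow> psd n (affine_form c b a)"
      by (rule psd_cong) (use A in \<open>simp add: affine_form_def\<close>)
    then show "positive (Mat n) (affine_op (Mat n) c b a)"
      unfolding positive_Mat_iff using A p by simp
  qed
  then have "level (matrix_range (Mat n) a) 1 \<subseteq> point_tuple ` complexify ` Delta"
    unfolding level_1_nc_simplex[symmetric] level_def by blast
  then show "a \<in> K_max (complexify ` Delta)" unfolding K_max_def using n by blast
next
  fix a assume "a \<in> K_max (complexify ` Delta)"
  then obtain n where n: "1 \<le> n" "a \<in> tuples n"
    and K: "level (matrix_range (Mat n) a) 1 \<subseteq> point_tuple ` complexify ` Delta"
    unfolding K_max_def by blast
  show "a \<in> nc_simplex"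
  proof (rule nc_simplexI_numerical_range[OF n])
    fix v :: "nat \<Rightarrow> complex" assume v: "(\<Sum>r<n. (cmod (v r))\<^sup>2) = 1"
    define \<phi> where "\<phi> T = Matrix.mat 1 1 (\<lambda>_. qform n (\<lambda>r s. T $$ (r, s)) v)" for T
    have "ucp (Mat n) (cstar (Mat n) a) 1 \<phi>"
      unfolding \<phi>_def by (rule matrix_range_state[OF vector_state_Mat[OF cstar_Mat_subset[OF n(2)] v]])
    then have "(\<lambda>l. \<phi> (a l)) \<in> matrix_range (Mat n) a"
      unfolding matrix_range_def by blast
    moreover have "(\<lambda>l. \<phi> (a l)) \<in> tuples 1" by (simp add: tuples_def \<phi>_def)
    ultimately have "(\<lambda>l. \<phi> (a l)) \<in> point_tuple ` complexify ` Delta"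
      using K unfolding level_def by blast
    then obtain p where p: "p \<in> Delta" "(\<lambda>l. \<phi> (a l)) = point_tuple (complexify p)" by blast
    have "qform n (\<lambda>r s. a l $$ (r, s)) v = of_real (vec_nth p l)" for l
      using arg_cong[OF fun_cong[OF p(2), of l], of "\<lambda>A. A $$ (0, 0)"]
      by (simp add: \<phi>_def point_tuple_def complexify_def)
    then show "\<exists>p\<in>Delta. \<forall>l. qform n (\<lambda>r s. a l $$ (r, s)) v = of_real (vec_nth p l)"
      using p(1) by blast
  qed
qed

subsection \<open>Compactness of the levels\<close>

text \<open>Tychonoff's theorem for a full function type. It serves both for the levels of the
  matrix convex set and for the cluster points of vector states.\<close>

lemma compact_fun:
  fixes S :: "'a \<Rightarrow> 'b::topological_space set"
  assumes "\<And>i. compact (S i)"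
  shows "compact {f. \<forall>i. f i \<in> S i}"
proof -
  have "{f. \<forall>i. f i \<in> S i} = Pi\<^sub>E UNIV S" by (auto simp: PiE_def Pi_def)
  moreover have "compactin (product_topology (\<lambda>_. euclidean) UNIV) (Pi\<^sub>E UNIV S)"
    unfolding compactin_PiE using assms by simp
  ultimately show ?thesis by (simp add: euclidean_product_topology)
qed

lemma continuous_on_fun3: "continuous_on UNIV (\<lambda>f. f l r c)"
  using continuous_on_product_coordinates continuous_on_product_then_coordinatewise by metis

text \<open>For each \<open>t\<close> the squared moduli of the numbers \<open>w j t\<close> sum to
  one over \<open>j\<close>; together with the arithmetic-geometric mean inequality this bounds the
  entries uniformly over the whole level.\<close>

lemma (in simplex_coords) entry_bound:
  assumes a: "a \<in> nc_simplex" "a \<in> tuples n" and rs: "r < n" "s < n"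
  shows "cmod (a l $$ (r, s)) \<le> (\<Sum>i<M. norm (V i))"
proof -
  let ?B = "\<Sum>i<M. norm (V i)"
  obtain N :: nat and \<kappa> w where \<kappa>: "\<And>j. j < N \<Longrightarrow> \<kappa> j < M"
    and w: "\<And>r s. r < n \<Longrightarrow> s < n \<Longrightarrow> (\<Sum>j<N. w j r * cnj (w j s)) = of_bool (r = s)"
    and al: "\<And>l r s. r < n \<Longrightarrow> s < n \<Longrightarrow>
       a l $$ (r, s) = (\<Sum>j<N. of_real (vec_nth (V (\<kappa> j)) l) * (w j r * cnj (w j s)))"
    by (rule nc_simplex_rank_one[OF a]) (rule that)
  have one: "(\<Sum>j<N. (cmod (w j t))\<^sup>2) = 1" if "t < n" for t
  proof -
    have "complex_of_real (\<Sum>j<N. (cmod (w j t))\<^sup>2) = of_real 1"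
      using w[OF that that] unfolding of_real_sum complex_norm_square by simp
    then show ?thesis by (simp only: of_real_eq_iff)
  qed
  have "cmod (a l $$ (r, s)) \<le> (\<Sum>j<N. ?B * (((cmod (w j r))\<^sup>2 + (cmod (w j s))\<^sup>2) / 2))"
    unfolding al[OF rs]
  proof (rule sum_norm_le)
    fix j assume "j \<in> {..<N}"
    then have "norm (V (\<kappa> j)) \<le> ?B" using \<kappa> by (intro member_le_sum) auto
    then have 1: "\<bar>vec_nth (V (\<kappa> j)) l\<bar> \<le> ?B" using component_le_norm_cart[of "V (\<kappa> j)" l] by linarith
    have 2: "cmod (w j r) * cmod (w j s) \<le> ((cmod (w j r))\<^sup>2 + (cmod (w j s))\<^sup>2) / 2"
      using sum_squares_bound[of "cmod (w j r)" "cmod (w j s)"] by simp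
    have "cmod (of_real (vec_nth (V (\<kappa> j)) l) * (w j r * cnj (w j s)))
        = \<bar>vec_nth (V (\<kappa> j)) l\<bar> * (cmod (w j r) * cmod (w j s))" by (simp add: norm_mult)
    also have "\<dots> \<le> ?B * (((cmod (w j r))\<^sup>2 + (cmod (w j s))\<^sup>2) / 2)"
      by (rule mult_mono[OF 1 2]) (auto intro: sum_nonneg)
    finally show "cmod (of_real (vec_nth (V (\<kappa> j)) l) * (w j r * cnj (w j s)))
        \<le> ?B * (((cmod (w j r))\<^sup>2 + (cmod (w j s))\<^sup>2) / 2)" .
  qed
  also have "\<dots> = ?B * (((\<Sum>j<N. (cmod (w j r))\<^sup>2) + (\<Sum>j<N. (cmod (w j s))\<^sup>2)) / 2)"
    by (simp add: sum_distrib_left[symmetric] sum_divide_distrib[symmetric] sum.distrib)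
  also have "\<dots> = ?B" by (simp add: one rs)
  finally show ?thesis .
qed

text \<open>The level is a closed subset of a compact box: every defining inequality, tested at one
  vector \<open>v\<close>, is a closed condition on finitely many entries. Positions outside the
  \<open>n\<close> by \<open>n\<close> block are pinned to zero, the default that
  \<open>entries\<close> puts there.\<close>

lemma (in simplex_coords) compact_level_nc_simplex:
  assumes n: "1 \<le> n"
  shows "compact (entries n ` level nc_simplex n)"
proof -
  define B where "B = (\<Sum>i<M. norm (V i))"
  define box :: "('d \<Rightarrow> nat \<Rightarrow> nat \<Rightarrow> complex) set" where
    "box = {f. \<forall>l. f l \<in> {g. \<forall>r. g r \<in> {h. \<forall>c. h c \<in> (if r < n \<and> c < n then cball 0 B else {0})}}}"
  define \<Phi> where "\<Phi> c b v f = of_real c * qform n (\<lambda>r s. of_bool (r = s)) v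
    + (\<Sum>l\<in>UNIV. of_real (b l) * qform n (f l) v)" for c and b :: "'d \<Rightarrow> real" and v f
  define cond where "cond = (\<Inter>c. \<Inter>b\<in>{b. nonneg_on c b}. \<Inter>v. {f. \<Phi> c b v f \<in> \<real>\<^sub>\<ge>\<^sub>0})"
  have "compact box"
    unfolding box_def by (intro compact_fun) auto
  moreover have "closed cond"
    unfolding cond_def
  proof (intro closed_INT ballI)
    fix c b v
    have "continuous_on UNIV (\<Phi> c b v)"
      unfolding \<Phi>_def qform_def by (intro continuous_intros continuous_on_fun3)
    then have "closed (\<Phi> c b v -` \<real>\<^sub>\<ge>\<^sub>0)"
      by (rule closed_vimage[OF closed_nonneg_Reals_complex])
    then show "closed {f. \<Phi> c b v f \<in> \<real>\<^sub>\<ge>\<^sub>0}" by (simp add: vimage_def)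
  qed
  moreover have "entries n ` level nc_simplex n = box \<inter> cond"
  proof (intro Set.equalityI subsetI)
    fix f assume "f \<in> entries n ` level nc_simplex n"
    then obtain a where a: "a \<in> nc_simplex" "a \<in> tuples n" and f: "f = entries n a" by (auto simp: level_def)
    have "\<Phi> c b v f = qform n (affine_form c b a) v" for c b v
      unfolding \<Phi>_def qform_affine_form f entries_def
      by (intro arg_cong2[where f = "(+)"] refl sum.cong arg_cong2[where f = "(*)"] qform_cong) auto
    then have "f \<in> cond" unfolding cond_def using nc_simplexD(2)[OF a] by (auto simp: psd_def)
    moreover have "f \<in> box"
      unfolding box_def f entries_def using entry_bound[OF a] by (auto simp: B_def)
    ultimately show "f \<in> box \<inter> cond" by simp
  next
    fix f assume f: "f \<in> box \<inter> cond"
    define a where "a l = Matrix.mat n n (\<lambda>(r, c). f l r c)" for l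
    have at: "a \<in> tuples n" by (simp add: a_def tuples_def)
    have "a \<in> nc_simplex"
    proof (rule nc_simplexI[OF n at])
      fix c b assume cb: "nonneg_on c b"
      have "qform n (affine_form c b a) v = \<Phi> c b v f" for v
        unfolding \<Phi>_def qform_affine_form a_def
        by (intro arg_cong2[where f = "(+)"] refl sum.cong arg_cong2[where f = "(*)"] qform_cong) auto
      then show "psd n (affine_form c b a)" using f cb unfolding psd_def cond_def by auto
    qed
    moreover have "f l r c = 0" if "\<not> (r < n \<and> c < n)" for l r c
    proof -
      have "f l r c \<in> (if r < n \<and> c < n then cball 0 B else {0})" using f unfolding box_def by blast
      then show ?thesis using that by auto
    qed
    then have "f = entries n a"
      by (auto simp: fun_eq_iff entries_def a_def)
    ultimately show "f \<in> entries n ` level nc_simplex n" using at by (auto simp: level_def)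
  qed
  ultimately show ?thesis by (simp add: compact_Int_closed)
qed

section \<open>Barycentric coordinates of a simplex\<close>

lemma linear_functional_coords:
  fixes g :: "real^'d \<Rightarrow> real"
  assumes "linear g"
  shows "g p = (\<Sum>l\<in>UNIV. g (axis l 1) * vec_nth p l)"
proof -
  have "p = (\<Sum>l\<in>UNIV. vec_nth p l *\<^sub>R axis l 1)"
    using basis_expansion[of p] by (simp add: scalar_mult_eq_scaleR)
  then have "g p = g (\<Sum>l\<in>UNIV. vec_nth p l *\<^sub>R axis l 1)" by simp
  also have "\<dots> = (\<Sum>l\<in>UNIV. g (axis l 1) * vec_nth p l)"
    by (simp add: linear_sum[OF assms] linear_scale[OF assms] mult.commute)
  finally show ?thesis .
qed

text \<open>After one vertex \<open>a\<close> is moved to the origin the other vertices are linearly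
  independent, so functionals \<open>g i\<close> dual to them exist on the whole space. The
  coordinate of vertex \<open>i\<close> is g_i(p) - g_i(a), and that of \<open>a\<close> is defined
  as one minus all the others, which makes the sum equal to one everywhere and not only on the
  affine hull.\<close>

lemma simplex_coords_exist:
  fixes K :: "(real^'d) set" and m :: int
  assumes K: "m simplex K" and m: "0 \<le> m"
  shows "\<exists>V M \<alpha> \<beta>. simplex_coords V M \<alpha> \<beta> \<and> K = simplex_coords.Delta V M"
proof -
  obtain C where ind: "\<not> affine_dependent C" and c: "int (card C) = m + 1" and KC: "K = convex hull C"
    using K unfolding simplex_def by blast
  define M where "M = card C"
  have fin: "finite C" using ind by (rule aff_independent_finite)
  \<comment> \<open>Here \<open>0 \<le> m\<close> excludes the empty simplex of dimension
    -1.\<close>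
  have M: "0 < M" using c m unfolding M_def by linarith
  obtain V where V: "bij_betw V {0..<M} C" using ex_bij_betw_nat_finite[OF fin] unfolding M_def by blast
  have VC: "V ` {..<M} = C" using V by (simp add: bij_betw_def atLeast0LessThan)
  have Vinj: "V i = V j \<longleftrightarrow> i = j" if "i < M" "j < M" for i j
    using V that by (auto simp: bij_betw_def inj_on_def)
  define a where "a = V 0"
  have aC: "a \<in> C" unfolding a_def VC[symmetric] using M by simp
  define B where "B = (\<lambda>x. - a + x) ` (C - {a})"
  have indB: "independent B"
    using ind affine_dependent_iff_dependent2[OF aC] unfolding B_def by simp
  have "\<forall>i. \<exists>g :: real^'d \<Rightarrow> real. linear g \<and> (\<forall>x\<in>B. g x = of_bool (x = - a + V i))"
    by (rule allI, rule linear_independent_extend[OF indB])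
  from choice[OF this] obtain g :: "nat \<Rightarrow> real^'d \<Rightarrow> real" where
    gg: "\<forall>i. linear (g i) \<and> (\<forall>x\<in>B. g i x = of_bool (x = - a + V i))" by (rule exE)
  have lin: "linear (g i)" for i using gg by simp
  have gB: "g i x = of_bool (x = - a + V i)" if "x \<in> B" for i x using gg that by simp
  have g: "g i (V j) - g i a = of_bool (i = j)" if i: "i < M" "i \<noteq> 0" and j: "j < M" for i j
  proof (cases "j = 0")
    case True
    then show ?thesis using i by (simp add: a_def)
  next
    case False
    then have "V j \<noteq> a" using Vinj[OF j M] by (simp add: a_def)
    then have "- a + V j \<in> B" unfolding B_def using VC j by blast
    then have "g i (- a + V j) = of_bool (i = j)" using gB Vinj[OF j i(1)] by auto
    then show ?thesis by (simp add: linear_diff[OF lin])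
  qed
  define J where "J = {..<M} - {0}"
  have split: "(\<Sum>i<M. f i) = f 0 + (\<Sum>i\<in>J. f i)" for f :: "nat \<Rightarrow> real"
    unfolding J_def using M by (intro sum.remove) simp_all
  define \<alpha> where "\<alpha> i = (if i = 0 then 1 + (\<Sum>i\<in>J. g i a) else - g i a)" for i
  define \<beta> where "\<beta> i l = (if i = 0 then - (\<Sum>i\<in>J. g i (axis l 1)) else g i (axis l 1))" for i l
  have J: "i \<noteq> 0" if "i \<in> J" for i using that by (simp add: J_def)
  have sc: "simplex_coords V M \<alpha> \<beta>"
  proof
    show "(\<Sum>i<M. \<alpha> i) = 1" unfolding split by (simp add: \<alpha>_def J sum_negf)
    show "(\<Sum>i<M. \<beta> i l) = 0" for l unfolding split by (simp add: \<beta>_def J)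
    fix i j assume ij: "i < M" "j < M"
    show "\<alpha> i + (\<Sum>l\<in>UNIV. \<beta> i l * vec_nth (V j) l) = of_bool (i = j)"
    proof (cases "i = 0")
      case False
      then show ?thesis
        using g[OF ij(1) False ij(2)] linear_functional_coords[OF lin, of i "V j"]
        by (simp add: \<alpha>_def \<beta>_def)
    next
      case True
      have "(\<Sum>l\<in>UNIV. \<beta> i l * vec_nth (V j) l) = - (\<Sum>l\<in>UNIV. \<Sum>k\<in>J. g k (axis l 1) * vec_nth (V j) l)"
        using True by (simp add: \<beta>_def sum_negf sum_distrib_right)
      also have "\<dots> = - (\<Sum>k\<in>J. \<Sum>l\<in>UNIV. g k (axis l 1) * vec_nth (V j) l)" by (subst sum.swap) (rule refl)
      also have "\<dots> = - (\<Sum>k\<in>J. g k (V j))" by (simp only: linear_functional_coords[OF lin, of _ "V j", symmetric])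
      finally have "\<alpha> i + (\<Sum>l\<in>UNIV. \<beta> i l * vec_nth (V j) l) = 1 - (\<Sum>k\<in>J. g k (V j) - g k a)"
        using True by (simp add: \<alpha>_def sum_subtractf)
      also have "(\<Sum>k\<in>J. g k (V j) - g k a) = (\<Sum>k\<in>J. of_bool (k = j))"
        by (rule sum.cong[OF refl], rule g) (use ij J_def in auto)
      also have "\<dots> = of_bool (j \<noteq> 0)" using ij(2) unfolding J_def of_bool_def
        by (simp add: sum.delta)
      finally show ?thesis using True by auto
    qed
  qed
  moreover have "K = simplex_coords.Delta V M"
    unfolding simplex_coords.Delta_def[OF sc] VC KC ..
  ultimately show ?thesis by (intro exI[of _ V] exI[of _ M] exI[of _ \<alpha>] exI[of _ \<beta>] conjI)
qed

subsection \<open>The Hilbert space\<close>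

lemma ell2_eqI: "(\<And>n. ell2_coord f n = ell2_coord g n) \<Longrightarrow> f = g"
  by (simp add: ell2_coord_inject[symmetric] fun_eq_iff)

lemma ell2_coord_simps [simp]:
  "ell2_coord 0 n = 0"
  "ell2_coord (f + g) n = ell2_coord f n + ell2_coord g n"
  "ell2_coord (- f) n = - ell2_coord f n"
  "ell2_coord (f - g) n = ell2_coord f n - ell2_coord g n"
  "ell2_coord (cscale c f) n = c * ell2_coord f n"
  "ell2_coord (r *\<^sub>R f) n = of_real r * ell2_coord f n"
  unfolding zero_ell2.rep_eq plus_ell2.rep_eq uminus_ell2.rep_eq cscale.rep_eq scaleR_ell2_def
    minus_ell2_def
  by (simp_all only: diff_conv_add_uminus)

lemma cscale_simps:
  "cscale c (f + g) = cscale c f + cscale c g"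
  "cscale c (f - g) = cscale c f - cscale c g"
  "cscale c (- f) = - cscale c f"
  "cscale (c + d) f = cscale c f + cscale d f"
  "cscale c (cscale d f) = cscale (c * d) f"
  "cscale c (r *\<^sub>R f) = r *\<^sub>R cscale c f"
  "cscale (of_real r) f = r *\<^sub>R f"
  "cscale 1 f = f" "cscale 0 f = 0" "cscale c 0 = 0"
  by (rule ell2_eqI; simp add: algebra_simps)+

lemma summable_coord: "summable (\<lambda>n. (cmod (ell2_coord f n))\<^sup>2)"
  using ell2_coord[of f] by simp

lemma summable_cip: "summable (\<lambda>n. ell2_coord f n * cnj (ell2_coord g n))"
  by (rule summable_ell2_prod[OF summable_coord summable_coord])

lemma cip_cnj: "cnj (cip f g) = cip g f"
proof -
  have "(\<lambda>n. cnj (ell2_coord f n * cnj (ell2_coord g n))) sums cnj (cip f g)"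
    unfolding cip.rep_eq sums_cnj by (rule summable_sums[OF summable_cip])
  then have "(\<lambda>n. ell2_coord g n * cnj (ell2_coord f n)) sums cnj (cip f g)"
    by (simp add: mult.commute)
  then show ?thesis unfolding cip.rep_eq by (simp add: sums_iff)
qed

lemma cip_add_left: "cip (f + g) h = cip f h + cip g h"
  unfolding cip.rep_eq suminf_add[OF summable_cip summable_cip]
  by (rule suminf_cong) (simp add: distrib_right)

lemma cip_cscale_left: "cip (cscale c f) h = c * cip f h"
  unfolding cip.rep_eq suminf_mult[OF summable_cip, symmetric]
  by (rule suminf_cong) simp

lemma cip_minus_left: "cip (- f) h = - cip f h"
proof -
  have "- f = cscale (- 1) f" by (rule ell2_eqI) simp
  then show ?thesis by (simp add: cip_cscale_left)
qed

lemma cip_scaleR_left: "cip (r *\<^sub>R f) h = of_real r * cip f h"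
  unfolding scaleR_ell2_def by (rule cip_cscale_left)

lemma cip_diff_left: "cip (f - g) h = cip f h - cip g h"
  unfolding minus_ell2_def cip_add_left cip_minus_left by simp

lemma cip_zero_left: "cip 0 h = 0"
  by (simp add: cip.rep_eq)

lemma cip_right:
  "cip h (f + g) = cip h f + cip h g" "cip h (f - g) = cip h f - cip h g"
  "cip h (cscale c f) = cnj c * cip h f" "cip h (- f) = - cip h f"
  "cip h (r *\<^sub>R f) = of_real r * cip h f" "cip h 0 = 0"
  unfolding cip_cnj[of _ h, symmetric]
  by (simp_all add: cip_add_left cip_diff_left cip_cscale_left cip_minus_left cip_scaleR_left cip_zero_left)

lemmas cip_simps = cip_add_left cip_diff_left cip_cscale_left cip_minus_left cip_scaleR_left
  cip_zero_left cip_right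

lemma cip_sum_left: "cip (\<Sum>i\<in>I. f i) h = (\<Sum>i\<in>I. cip (f i) h)"
  by (induction I rule: infinite_finite_induct) (simp_all add: cip_simps)

lemma Re_cip: "Re (cip f g) = inner f g"
  by (simp add: inner_ell2_def)

lemma Im_cip: "Im (cip f g) = inner f (cscale \<i> g)"
  by (simp add: inner_ell2_def cip_simps)

lemma cip_self: "cip f f = of_real ((norm f)\<^sup>2)"
proof -
  have "cnj (cip f f) = cip f f" by (rule cip_cnj)
  then have "Im (cip f f) = 0" by (simp add: complex_eq_iff)
  then show ?thesis by (simp add: complex_eq_iff Re_cip power2_norm_eq_inner)
qed

lemma cip_bound: "cmod (cip f g) \<le> norm f * norm g"
proof (cases "cip f g = 0")
  case False
  define z where "z = cnj (cip f g) / cmod (cip f g)"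
  have z: "cmod z = 1" using False by (simp add: z_def norm_divide)
  have "cip (cscale z f) g = (cip f g * cnj (cip f g)) / cmod (cip f g)"
    by (simp add: z_def cip_simps)
  also have "\<dots> = of_real ((cmod (cip f g))\<^sup>2 / cmod (cip f g))"
    unfolding complex_norm_square[symmetric] by simp
  finally have "cip (cscale z f) g = of_real (cmod (cip f g))"
    by (simp add: power2_eq_square)
  then have "cmod (cip f g) = inner (cscale z f) g" unfolding Re_cip[symmetric] by simp
  also have "\<dots> \<le> norm (cscale z f) * norm g" by (rule norm_cauchy_schwarz)
  finally show ?thesis by (simp add: norm_cscale z)
qed simp

lemma cip_eqI:
  assumes "\<And>v. cip v f = cip v g" shows "f = g"
proof -
  have "cip (f - g) (f - g) = 0" using assms[of "f - g"] by (simp add: cip_simps)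
  then show ?thesis by (simp add: cip_self)
qed

lemma sum_coord_le: "(\<Sum>i<N. (cmod (ell2_coord f i))\<^sup>2) \<le> (norm f)\<^sup>2"
  unfolding cmod_coord_square by (rule sum_le_suminf[OF summable_coord]) auto

lemma coord_le_norm: "cmod (ell2_coord f i) \<le> norm f"
proof -
  have "(cmod (ell2_coord f i))\<^sup>2 \<le> (\<Sum>j<Suc i. (cmod (ell2_coord f j))\<^sup>2)"
    by (rule member_le_sum) auto
  also have "\<dots> \<le> (norm f)\<^sup>2" by (rule sum_coord_le)
  finally show ?thesis by (rule power2_le_imp_le) simp
qed

lemma ell2_of_bounded:
  assumes "\<And>N. (\<Sum>i<N. (cmod (f i))\<^sup>2) \<le> B"
  obtains g where "\<And>i. ell2_coord g i = f i" "(norm g)\<^sup>2 \<le> B"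
proof -
  have s: "summable (\<lambda>i. (cmod (f i))\<^sup>2)" by (rule summableI_nonneg_bounded[OF _ assms]) simp
  then have c: "ell2_coord (Abs_ell2 f) = f" by (simp add: Abs_ell2_inverse)
  have "(norm (Abs_ell2 f))\<^sup>2 \<le> B"
    unfolding cmod_coord_square c by (rule suminf_le_const[OF s assms])
  then show thesis using c by (intro that[of "Abs_ell2 f"]) simp_all
qed

text \<open>Completeness is needed twice: to pass from total boundedness to compactness, and to take
  norm limits of operators. The Cauchy estimate is carried to the coordinatewise limit on finite
  partial sums, uniformly in their length.\<close>

instance ell2 :: banach
proof
  fix X :: "nat \<Rightarrow> ell2"
  assume X: "Cauchy X"
  have "Cauchy (\<lambda>n. ell2_coord (X n) i)" for i
  proof (rule CauchyI)
    fix e :: real assume "0 < e"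
    then obtain N where N: "\<And>m n. m \<ge> N \<Longrightarrow> n \<ge> N \<Longrightarrow> norm (X m - X n) < e"
      using CauchyD[OF X] by blast
    have "norm (ell2_coord (X m) i - ell2_coord (X n) i) < e" if "m \<ge> N" "n \<ge> N" for m n
      using coord_le_norm[of "X m - X n" i] N[OF that] by simp
    then show "\<exists>N. \<forall>m\<ge>N. \<forall>n\<ge>N. norm (ell2_coord (X m) i - ell2_coord (X n) i) < e" by blast
  qed
  then have "\<forall>i. \<exists>L. (\<lambda>n. ell2_coord (X n) i) \<longlonglongrightarrow> L"
    using Cauchy_convergent_iff convergent_def by blast
  from choice[OF this] obtain L where L: "\<And>i. (\<lambda>n. ell2_coord (X n) i) \<longlonglongrightarrow> L i" by blast
  have tail: "\<exists>N. \<forall>m\<ge>N. \<forall>K. (\<Sum>i<K. (cmod (ell2_coord (X m) i - L i))\<^sup>2) \<le> e\<^sup>2" if e: "0 < e" for e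
  proof -
    obtain N where N: "\<And>m n. m \<ge> N \<Longrightarrow> n \<ge> N \<Longrightarrow> norm (X m - X n) < e"
      using CauchyD[OF X e] by blast
    have "(\<Sum>i<K. (cmod (ell2_coord (X m) i - L i))\<^sup>2) \<le> e\<^sup>2" if m: "m \<ge> N" for m K
    proof (rule tendsto_upperbound)
      show "(\<lambda>n. \<Sum>i<K. (cmod (ell2_coord (X m) i - ell2_coord (X n) i))\<^sup>2)
          \<longlonglongrightarrow> (\<Sum>i<K. (cmod (ell2_coord (X m) i - L i))\<^sup>2)"
        by (intro tendsto_intros L)
      show "\<forall>\<^sub>F n in sequentially. (\<Sum>i<K. (cmod (ell2_coord (X m) i - ell2_coord (X n) i))\<^sup>2) \<le> e\<^sup>2"
      proof (rule eventually_sequentiallyI)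
        fix n assume "n \<ge> N"
        then have "(norm (X m - X n))\<^sup>2 \<le> e\<^sup>2" using less_imp_le[OF N[OF m]] by (intro power_mono) simp_all
        then show "(\<Sum>i<K. (cmod (ell2_coord (X m) i - ell2_coord (X n) i))\<^sup>2) \<le> e\<^sup>2"
          using sum_coord_le[where f = "X m - X n" and N = K] by simp
      qed
    qed simp
    then show ?thesis by blast
  qed
  obtain N where N: "(\<Sum>i<K. (cmod (ell2_coord (X N) i - L i))\<^sup>2) \<le> 1\<^sup>2" for K
    using tail[of 1] by auto
  obtain d where d: "\<And>i. ell2_coord d i = ell2_coord (X N) i - L i"
    by (rule ell2_of_bounded[OF N]) (rule that)
  define l where "l = X N - d"
  have l: "ell2_coord l i = L i" for i by (simp add: l_def d)
  have "X \<longlonglongrightarrow> l"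
  proof (rule LIMSEQ_I)
    fix r :: real assume r: "0 < r"
    obtain N where N: "\<forall>m\<ge>N. \<forall>K. (\<Sum>i<K. (cmod (ell2_coord (X m) i - L i))\<^sup>2) \<le> (r / 2)\<^sup>2"
      using tail[of "r / 2"] r by auto
    have "norm (X m - l) < r" if "m \<ge> N" for m
    proof -
      have "(\<Sum>i<K. (cmod (ell2_coord (X m - l) i))\<^sup>2) \<le> (r / 2)\<^sup>2" for K
        using N that by (simp add: l)
      then have "(norm (X m - l))\<^sup>2 \<le> (r / 2)\<^sup>2"
        unfolding cmod_coord_square by (intro suminf_le_const summable_coord)
      then have "norm (X m - l) \<le> r / 2" by (rule power2_le_imp_le) (use r in simp)
      then show ?thesis using r by simp
    qed
    then show "\<exists>N. \<forall>m\<ge>N. norm (X m - l) < r" by blast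
  qed
  then show "convergent X" by (rule convergentI)
qed

subsection \<open>Coordinate projections\<close>

text \<open>The orthogonal projection onto the first \<open>N\<close> basis vectors. The condition
  \<open>trunc N v = 0\<close> expresses throughout that \<open>v\<close> lives beyond the cut-off
  \<open>N\<close>, in a subspace of finite codimension.\<close>

lift_definition trunc :: "nat \<Rightarrow> ell2 \<Rightarrow> ell2" is "\<lambda>N f n. if n < N then f n else 0"
proof -
  fix N and f :: "nat \<Rightarrow> complex"
  show "summable (\<lambda>n. (cmod (if n < N then f n else 0))\<^sup>2)"
    by (rule summable_finite[of "{..<N}"]) auto
qed

lift_definition ket :: "nat \<Rightarrow> ell2" is "\<lambda>i n. of_bool (n = i)"
proof -
  fix i :: nat
  show "summable (\<lambda>n. (cmod (of_bool (n = i)))\<^sup>2)"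
    by (rule summable_finite[of "{i}"]) auto
qed

lemma trunc_coord [simp]: "ell2_coord (trunc N f) n = (if n < N then ell2_coord f n else 0)"
  by (simp add: trunc.rep_eq)

lemma ket_coord [simp]: "ell2_coord (ket i) n = of_bool (n = i)"
  by (simp add: ket.rep_eq)

lemma trunc_simps:
  "trunc N (f + g) = trunc N f + trunc N g" "trunc N (f - g) = trunc N f - trunc N g"
  "trunc N (r *\<^sub>R f) = r *\<^sub>R trunc N f" "trunc N (cscale c f) = cscale c (trunc N f)"
  "trunc N 0 = 0"
  by (rule ell2_eqI; simp add: algebra_simps)+

lemma trunc_trunc: "trunc N (trunc M f) = trunc (min N M) f"
  by (rule ell2_eqI) simp

lemma coord_sum: "ell2_coord (\<Sum>i\<in>I. f i) n = (\<Sum>i\<in>I. ell2_coord (f i) n)"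
  by (induction I rule: infinite_finite_induct) simp_all

lemma trunc_eq_sum: "trunc N f = (\<Sum>i<N. cscale (ell2_coord f i) (ket i))"
  by (rule ell2_eqI) (simp add: coord_sum of_bool_def if_distrib[of "\<lambda>x. _ * x"] cong: if_cong)

lemma cip_eq_sum_trunc: "cip (trunc N f) g = (\<Sum>i<N. ell2_coord f i * cnj (ell2_coord g i))"
  unfolding cip.rep_eq by (subst suminf_finite[of "{..<N}"]) auto

lemma cip_trunc: "cip (trunc N f) g = cip f (trunc N g)"
proof -
  have "cip f (trunc N g) = cnj (cip (trunc N g) f)" by (simp add: cip_cnj)
  then show ?thesis unfolding cip_eq_sum_trunc by (simp add: mult.commute)
qed

lemma inner_trunc: "inner (trunc N f) g = inner f (trunc N g)"
  unfolding Re_cip[symmetric] cip_trunc ..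

lemma norm_trunc_le: "norm (trunc N f) \<le> norm f"
proof -
  have "(norm (trunc N f))\<^sup>2 = (\<Sum>i<N. (cmod (ell2_coord f i))\<^sup>2)"
    unfolding cmod_coord_square by (subst suminf_finite[of "{..<N}"]) auto
  also have "\<dots> \<le> (norm f)\<^sup>2" by (rule sum_coord_le)
  finally show ?thesis by (rule power2_le_imp_le) simp
qed

lemma inner_trunc_tail: "inner (trunc N f) (g - trunc N g) = 0"
  unfolding inner_trunc trunc_simps trunc_trunc by simp

lemma norm_trunc_square: "(norm f)\<^sup>2 = (norm (trunc N f))\<^sup>2 + (norm (f - trunc N f))\<^sup>2"
proof -
  have "(norm (trunc N f + (f - trunc N f)))\<^sup>2 = (norm (trunc N f))\<^sup>2 + (norm (f - trunc N f))\<^sup>2"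
    by (rule norm_add_Pythagorean) (simp add: real_inner_class.orthogonal_def inner_trunc_tail)
  then show ?thesis by simp
qed

lemma norm_tail_le: "norm (f - trunc N f) \<le> norm f"
  by (rule power2_le_imp_le) (use norm_trunc_square[of f N] in auto)

lemma trunc_tendsto: "(\<lambda>N. trunc N f) \<longlonglongrightarrow> f"
proof -
  have "(\<lambda>N. (norm f)\<^sup>2 - (\<Sum>i<N. (cmod (ell2_coord f i))\<^sup>2)) \<longlonglongrightarrow> (norm f)\<^sup>2 - (norm f)\<^sup>2"
    unfolding cmod_coord_square by (intro tendsto_intros summable_LIMSEQ summable_coord)
  moreover have "(norm f)\<^sup>2 - (\<Sum>i<N. (cmod (ell2_coord f i))\<^sup>2) = (norm (trunc N f - f))\<^sup>2" for N
  proof -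
    have "(norm (trunc N f))\<^sup>2 = (\<Sum>i<N. (cmod (ell2_coord f i))\<^sup>2)"
      unfolding cmod_coord_square by (subst suminf_finite[of "{..<N}"]) auto
    then show ?thesis using norm_trunc_square[of f N] by (simp add: norm_minus_commute)
  qed
  ultimately have "(\<lambda>N. (norm (trunc N f - f))\<^sup>2) \<longlonglongrightarrow> 0" by simp
  then have "(\<lambda>N. sqrt ((norm (trunc N f - f))\<^sup>2)) \<longlonglongrightarrow> sqrt 0" by (rule tendsto_real_sqrt)
  then have "(\<lambda>N. norm (trunc N f - f)) \<longlonglongrightarrow> 0" by simp
  then show ?thesis by (rule LIM_zero_cancel[OF tendsto_norm_zero_cancel])
qed

lift_definition trunc_op :: "nat \<Rightarrow> ell2 \<Rightarrow>\<^sub>L ell2" is trunc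
  by (rule bounded_linear_intro[where K = 1]) (simp_all add: trunc_simps norm_trunc_le)

declare trunc_op.rep_eq [simp]

section \<open>Complex-linear operators and their adjoints\<close>

lemma bounded_ops_iff: "T \<in> bounded_ops \<longleftrightarrow> (\<forall>c v. T (cscale c v) = cscale c (T v))"
  by (simp add: bounded_ops_def)

lemma bounded_ops_closed:
  "S \<in> bounded_ops \<Longrightarrow> T \<in> bounded_ops \<Longrightarrow> S + T \<in> bounded_ops"
  "S \<in> bounded_ops \<Longrightarrow> T \<in> bounded_ops \<Longrightarrow> S - T \<in> bounded_ops"
  "T \<in> bounded_ops \<Longrightarrow> r *\<^sub>R T \<in> bounded_ops"
  "T \<in> bounded_ops \<Longrightarrow> cscale_op c T \<in> bounded_ops"
  "S \<in> bounded_ops \<Longrightarrow> T \<in> bounded_ops \<Longrightarrow> S o\<^sub>L T \<in> bounded_ops"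
  "id_blinfun \<in> bounded_ops" "0 \<in> bounded_ops" "trunc_op N \<in> bounded_ops"
  by (simp_all add: bounded_ops_iff cscale_simps trunc_simps blinfun.add_left blinfun.diff_left
      blinfun.scaleR_left mult.commute)

lemma bounded_ops_sum: "(\<And>i. i \<in> I \<Longrightarrow> T i \<in> bounded_ops) \<Longrightarrow> (\<Sum>i\<in>I. T i) \<in> bounded_ops"
  by (induction I rule: infinite_finite_induct) (auto intro: bounded_ops_closed)

text \<open>Riesz representation by coordinates: the value of the adjoint at \<open>w\<close> must
  have the coordinates \<open>cip w (T (ket i))\<close>. They are square-summable because evaluating
  \<open>T\<close> at their own truncation \<open>u\<close> gives
  \<open>norm u \<le> norm T * norm w\<close>.\<close>

lemma adjoint_exists:
  assumes T: "T \<in> bounded_ops"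
  shows "\<exists>S\<in>bounded_ops. \<forall>v w. cip (blinfun_apply T v) w = cip v (blinfun_apply S w)"
proof -
  have "\<exists>x. \<forall>v. cip (T v) w = cip v x" for w
  proof -
    define c where "c i = cip w (T (ket i))" for i
    have Tt: "cip (T (trunc N v)) w = (\<Sum>i<N. ell2_coord v i * cnj (c i))" for N v
      using T by (simp add: trunc_eq_sum blinfun.sum_right cip_sum_left bounded_ops_iff cip_simps c_def cip_cnj)
    have bound: "(\<Sum>i<N. (cmod (c i))\<^sup>2) \<le> (norm T * norm w)\<^sup>2" for N
    proof -
      define s where "s = (\<Sum>i<N. (cmod (c i))\<^sup>2)"
      define u where "u = (\<Sum>i<N. cscale (c i) (ket i))"
      have u: "ell2_coord u i = (if i < N then c i else 0)" for i
        by (simp add: u_def coord_sum of_bool_def if_distrib[of "\<lambda>x. _ * x"] cong: if_cong)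
      have us: "(norm u)\<^sup>2 = s"
        unfolding cmod_coord_square s_def by (subst suminf_finite[of "{..<N}"]) (auto simp: u)
      have "trunc N u = u" by (rule ell2_eqI) (simp add: u)
      then have "cip (T u) w = (\<Sum>i<N. ell2_coord u i * cnj (c i))" using Tt[of N u] by simp
      also have "\<dots> = of_real s" unfolding s_def of_real_sum complex_norm_square
        by (rule sum.cong) (simp_all add: u)
      finally have "cip (T u) w = of_real s" .
      moreover have "0 \<le> s" by (simp add: s_def sum_nonneg)
      ultimately have "cmod (cip (T u) w) = s" by simp
      then have "s \<le> norm (T u) * norm w" using cip_bound[of "T u" w] by simp
      also have "\<dots> \<le> norm T * norm u * norm w" by (intro mult_right_mono norm_blinfun) simp
      finally have "norm u * norm u \<le> norm u * (norm T * norm w)"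
        using us by (simp add: power2_eq_square mult_ac)
      then have "norm u \<le> norm T * norm w" by (cases "norm u = 0") auto
      then show ?thesis unfolding s_def[symmetric] us[symmetric] by (rule power_mono) simp
    qed
    obtain x where x: "\<And>i. ell2_coord x i = c i"
      by (rule ell2_of_bounded[OF bound]) (rule that)
    have "cip (T v) w = cip v x" for v
    proof (rule LIMSEQ_unique)
      have lim: "(\<lambda>N. cip (f (trunc N v)) y) \<longlonglongrightarrow> cip (f v) y" if "bounded_linear f" for f :: "ell2 \<Rightarrow> ell2" and y
      proof -
        have "(\<lambda>N. norm (f (trunc N v) - f v) * norm y) \<longlonglongrightarrow> norm (f v - f v) * norm y"
          by (intro tendsto_intros bounded_linear.tendsto[OF that] trunc_tendsto)
        then have lim0: "(\<lambda>N. norm (f (trunc N v) - f v) * norm y) \<longlonglongrightarrow> 0" by simp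
        have "(\<lambda>N. cip (f (trunc N v) - f v) y) \<longlonglongrightarrow> 0"
          by (rule Lim_null_comparison[OF _ lim0]) (simp add: cip_bound)
        then show ?thesis by (simp add: cip_simps LIM_zero_iff)
      qed
      show "(\<lambda>N. cip (T (trunc N v)) w) \<longlonglongrightarrow> cip (T v) w" by (rule lim[OF blinfun.bounded_linear_right])
      have "(\<lambda>N. cip (trunc N v) x) \<longlonglongrightarrow> cip v x" by (rule lim[OF bounded_linear_ident])
      then show "(\<lambda>N. cip (T (trunc N v)) w) \<longlonglongrightarrow> cip v x"
        by (simp add: cip_eq_sum_trunc Tt x)
    qed
    then show ?thesis by blast
  qed
  then have "\<forall>w. \<exists>x. \<forall>v. cip (T v) w = cip v x" by (rule allI)
  from choice[OF this] obtain A where AA: "\<forall>w v. cip (T v) w = cip v (A w)" by (rule exE)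
  then have A: "cip (T v) w = cip v (A w)" for v w by simp
  have bl: "bounded_linear A"
  proof (rule bounded_linear_intro[where K = "norm T"])
    show "A (x + y) = A x + A y" for x y by (rule cip_eqI) (simp add: A[symmetric] cip_simps)
    show "A (r *\<^sub>R x) = r *\<^sub>R A x" for r x by (rule cip_eqI) (simp add: A[symmetric] cip_simps)
    show "norm (A x) \<le> norm x * norm T" for x
    proof -
      have "(norm (A x))\<^sup>2 = cmod (cip (A x) (A x))" by (simp add: cip_self norm_power)
      also have "\<dots> = cmod (cip (T (A x)) x)" by (simp add: A)
      also have "\<dots> \<le> norm (T (A x)) * norm x" by (rule cip_bound)
      also have "\<dots> \<le> norm T * norm (A x) * norm x" by (intro mult_right_mono norm_blinfun) simp
      finally have "norm (A x) * norm (A x) \<le> norm (A x) * (norm x * norm T)"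
        by (simp add: power2_eq_square mult_ac)
      then show ?thesis by (cases "norm (A x) = 0") auto
    qed
  qed
  have "A (cscale c w) = cscale c (A w)" for c w by (rule cip_eqI) (simp add: A[symmetric] cip_simps)
  then show ?thesis
    by (intro bexI[of _ "Blinfun A"]) (simp_all add: bounded_linear_Blinfun_apply[OF bl] bounded_ops_iff A)
qed

text \<open>Only a compact superset is claimed. That is enough for a covering argument and makes the
  induction easy: one more coordinate adds a disc.\<close>

lemma trunc_ball_compact: "\<exists>K. compact K \<and> (\<forall>f. norm f \<le> B \<longrightarrow> trunc N f \<in> K)"
proof (induction N)
  case 0
  have "trunc 0 f = 0" for f by (rule ell2_eqI) simp
  then show ?case by (intro exI[of _ "{0}"]) simp
next
  case (Suc N)
  then obtain K where K: "compact K" "\<And>f. norm f \<le> B \<Longrightarrow> trunc N f \<in> K" by blast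
  let ?L = "(\<lambda>z. cscale z (ket N)) ` cball 0 B"
  have "bounded_linear (\<lambda>z. cscale z (ket N))"
  proof (rule bounded_linear_intro[where K = "norm (ket N)"])
    show "cscale (r *\<^sub>R z) (ket N) = r *\<^sub>R cscale z (ket N)" for r z
      by (rule ell2_eqI) (simp add: scaleR_conv_of_real)
  qed (simp_all add: cscale_simps norm_cscale)
  then have "compact ?L"
    by (intro compact_continuous_image linear_continuous_on compact_cball)
  then have "compact {x + y |x y. x \<in> K \<and> y \<in> ?L}" using K(1) by (intro compact_sums)
  moreover have "trunc (Suc N) f \<in> {x + y |x y. x \<in> K \<and> y \<in> ?L}" if f: "norm f \<le> B" for f
  proof -
    have "trunc (Suc N) f = trunc N f + cscale (ell2_coord f N) (ket N)"
      by (rule ell2_eqI) (auto simp: less_Suc_eq)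
    moreover have "ell2_coord f N \<in> cball 0 B" using f coord_le_norm[of f N] by simp
    ultimately show ?thesis using K(2)[OF f] by blast
  qed
  ultimately show ?case by blast
qed

section \<open>Compactness of operators read off from quadratic forms\<close>

lemma form_polarization:
  assumes S: "S \<in> bounded_ops"
  shows "4 * cip (blinfun_apply S v) w
    = (cip (S (v + w)) (v + w) - cip (S (v - w)) (v - w))
      + \<i> * (cip (S (v + cscale \<i> w)) (v + cscale \<i> w) - cip (S (v - cscale \<i> w)) (v - cscale \<i> w))"
  using S by (simp add: bounded_ops_iff blinfun.add_right blinfun.diff_right cip_simps algebra_simps)

text \<open>Polarization and the parallelogram law, applied inside the subspace beyond
  \<open>N\<close>, give the bound \<open>e\<close> times the sum of the squared norms; normalising
  both vectors turns that sum into twice the product.\<close>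

lemma form_bound:
  assumes S: "S \<in> bounded_ops"
    and e: "\<And>v. trunc N v = 0 \<Longrightarrow> cmod (cip (blinfun_apply S v) v) \<le> e * (norm v)\<^sup>2"
    and vw: "trunc N v = 0" "trunc N w = 0"
  shows "cmod (cip (blinfun_apply S v) w) \<le> 2 * e * norm v * norm w"
proof -
  have *: "cmod (cip (S v) w) \<le> e * ((norm v)\<^sup>2 + (norm w)\<^sup>2)" if vw: "trunc N v = 0" "trunc N w = 0" for v w
  proof -
    have b: "cmod (cip (S (v + w)) (v + w) - cip (S (v - w)) (v - w)) \<le> e * (2 * (norm v)\<^sup>2 + 2 * (norm w)\<^sup>2)"
      if vw: "trunc N v = 0" "trunc N w = 0" for v w
    proof -
      have "cmod (cip (S (v + w)) (v + w) - cip (S (v - w)) (v - w))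
          \<le> e * (norm (v + w))\<^sup>2 + e * (norm (v - w))\<^sup>2"
        by (rule order_trans[OF norm_triangle_ineq4 add_mono[OF e e]]) (simp_all add: trunc_simps vw)
      also have "\<dots> = e * ((norm (v + w))\<^sup>2 + (norm (v - w))\<^sup>2)" by (simp add: distrib_left)
      also have "(norm (v + w))\<^sup>2 + (norm (v - w))\<^sup>2 = 2 * (norm v)\<^sup>2 + 2 * (norm w)\<^sup>2"
        by (simp add: power2_norm_eq_inner inner_add_left inner_add_right inner_diff_left inner_diff_right)
      finally show ?thesis .
    qed
    have "4 * cmod (cip (S v) w) = cmod (4 * cip (S v) w)" by (simp add: norm_mult)
    also have "\<dots> \<le> e * (2 * (norm v)\<^sup>2 + 2 * (norm w)\<^sup>2) + e * (2 * (norm v)\<^sup>2 + 2 * (norm (cscale \<i> w))\<^sup>2)"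
      unfolding form_polarization[OF S, of v w]
    proof (rule order_trans[OF norm_triangle_ineq add_mono])
      show "cmod (cip (S (v + w)) (v + w) - cip (S (v - w)) (v - w)) \<le> e * (2 * (norm v)\<^sup>2 + 2 * (norm w)\<^sup>2)"
        by (rule b[OF vw])
      show "cmod (\<i> * (cip (S (v + cscale \<i> w)) (v + cscale \<i> w) - cip (S (v - cscale \<i> w)) (v - cscale \<i> w)))
          \<le> e * (2 * (norm v)\<^sup>2 + 2 * (norm (cscale \<i> w))\<^sup>2)"
        unfolding norm_mult using b[of v "cscale \<i> w"] vw by (simp add: trunc_simps cscale_simps)
    qed
    also have "\<dots> = 4 * (e * ((norm v)\<^sup>2 + (norm w)\<^sup>2))" by (simp add: norm_cscale algebra_simps)
    finally show ?thesis by simp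
  qed
  show ?thesis
  proof (cases "v = 0 \<or> w = 0")
    case True
    then show ?thesis by (auto simp: cip_simps)
  next
    case False
    define v' where "v' = (1 / norm v) *\<^sub>R v"
    define w' where "w' = (1 / norm w) *\<^sub>R w"
    have "cip (S v) w = cip (S (norm v *\<^sub>R v')) (norm w *\<^sub>R w')"
      using False by (simp add: v'_def w'_def)
    then have "cmod (cip (S v) w) = norm v * norm w * cmod (cip (S v') w')"
      by (simp add: blinfun.scaleR_right cip_simps norm_mult)
    also have "\<dots> \<le> norm v * norm w * (e * ((norm v')\<^sup>2 + (norm w')\<^sup>2))"
      by (intro mult_left_mono *) (simp_all add: v'_def w'_def trunc_simps vw)
    also have "\<dots> = 2 * e * norm v * norm w"
      using False by (simp add: v'_def w'_def)
    finally show ?thesis .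
  qed
qed

text \<open>With P the projection \<open>trunc N\<close>, the vector S v is the sum of S P v, P S (1
  - P) v and (1 - P) S (1 - P) v. On the unit ball the first two stay in a fixed compact set, and
  the third is small by \<open>form_bound\<close>, so the image is totally bounded.\<close>

lemma compact_opI:
  assumes S: "S \<in> bounded_ops"
    and small: "\<And>e. 0 < e \<Longrightarrow> \<exists>N. \<forall>v. trunc N v = 0 \<longrightarrow> cmod (cip (blinfun_apply S v) v) \<le> e * (norm v)\<^sup>2"
  shows "compact_op S"
proof -
  let ?X = "blinfun_apply S ` cball 0 1"
  have "\<exists>k. finite k \<and> closure ?X \<subseteq> (\<Union>x\<in>k. ball x e)" if e: "0 < e" for e
  proof -
    \<comment> \<open>\<open>form_bound\<close> doubles e / 8 to e / 4 for the remainder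
      \<open>q\<close>. A net of radius e / 4 for the compact part then yields closed balls of
      radius e / 2, which leaves room for the closure inside open balls of radius
      \<open>e\<close>.\<close>
    obtain N where N: "\<And>v. trunc N v = 0 \<Longrightarrow> cmod (cip (S v) v) \<le> e / 8 * (norm v)\<^sup>2"
      using small[of "e / 8"] e by auto
    obtain K1 where K1: "compact K1" "\<And>f. norm f \<le> 1 \<Longrightarrow> trunc N f \<in> K1"
      using trunc_ball_compact by blast
    obtain K2 where K2: "compact K2" "\<And>f. norm f \<le> norm S \<Longrightarrow> trunc N f \<in> K2"
      using trunc_ball_compact by blast
    define K where "K = {x + y |x y. x \<in> blinfun_apply S ` K1 \<and> y \<in> K2}"
    have "compact K" unfolding K_def
      by (intro compact_sums compact_continuous_image K1 K2 linear_continuous_on blinfun.bounded_linear_right)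
    then obtain k where k: "finite k" "K \<subseteq> (\<Union>x\<in>k. ball x (e / 4))"
      using e unfolding compact_eq_totally_bounded by (metis divide_pos_pos zero_less_numeral)
    have "?X \<subseteq> (\<Union>x\<in>k. cball x (e / 2))"
    proof
      fix y assume "y \<in> ?X"
      then obtain v where v: "norm v \<le> 1" and y: "y = S v" by auto
      define t where "t = v - trunc N v"
      have t0: "trunc N t = 0" by (simp add: t_def trunc_simps trunc_trunc)
      have t1: "norm t \<le> 1" using norm_tail_le[of v N] v by (simp add: t_def)
      define q where "q = S t - trunc N (S t)"
      have q0: "trunc N q = 0" by (simp add: q_def trunc_simps trunc_trunc)
      have "(norm q)\<^sup>2 = inner (S t) q - inner (trunc N (S t)) q"
        by (simp add: q_def power2_norm_eq_inner inner_diff_left)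
      also have "\<dots> = inner (S t) q" by (simp add: inner_trunc q0)
      also have "\<dots> \<le> cmod (cip (S t) q)" unfolding Re_cip[symmetric] by (rule complex_Re_le_cmod)
      also have "\<dots> \<le> 2 * (e / 8) * norm t * norm q" by (rule form_bound[OF S N t0 q0])
      also have "\<dots> \<le> 2 * (e / 8) * 1 * norm q"
        using e t1 by (intro mult_right_mono mult_left_mono) simp_all
      finally have "norm q * norm q \<le> e / 4 * norm q" by (simp add: power2_eq_square)
      then have q: "norm q \<le> e / 4" using e by (cases "norm q = 0") auto
      have "norm (S t) \<le> norm S * norm t" by (rule norm_blinfun)
      also have "\<dots> \<le> norm S * 1" using t1 by (intro mult_left_mono) simp_all
      finally have "trunc N (S t) \<in> K2" using K2(2) by simp
      then have "S (trunc N v) + trunc N (S t) \<in> K" unfolding K_def using K1(2)[OF v] by blast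
      then obtain x where x: "x \<in> k" "dist x (S (trunc N v) + trunc N (S t)) < e / 4" using k(2) by auto
      have "y = S (trunc N v) + trunc N (S t) + q"
        by (simp add: y q_def t_def blinfun.diff_right)
      then have "dist x y \<le> dist x (S (trunc N v) + trunc N (S t)) + norm q"
        using dist_triangle[of x y "S (trunc N v) + trunc N (S t)"] by (simp add: dist_norm)
      then have "y \<in> cball x (e / 2)" using x(2) q by simp
      then show "y \<in> (\<Union>x\<in>k. cball x (e / 2))" using x(1) by blast
    qed
    moreover have "closed (\<Union>x\<in>k. cball x (e / 2))" using k(1) by (intro closed_UN) auto
    ultimately have "closure ?X \<subseteq> (\<Union>x\<in>k. cball x (e / 2))" by (rule closure_minimal)
    also have "\<dots> \<subseteq> (\<Union>x\<in>k. ball x e)" using e by (intro UN_mono) auto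
    finally show ?thesis using k(1) by blast
  qed
  then have "compact (closure ?X)"
    unfolding compact_eq_totally_bounded by (simp add: complete_eq_closed)
  then show ?thesis unfolding compact_op_def using S by simp
qed

text \<open>The vectors T (v n) stay near finitely many centres \<open>y\<close>, and each
  \<open>y\<close> is eventually close to its truncation \<open>trunc n y\<close>, which is
  orthogonal to \<open>v n\<close>.\<close>

lemma compact_form_tendsto_0:
  assumes T: "compact_op T" and v: "\<And>n. norm (v n) = 1" "\<And>n. trunc n (v n) = 0"
  shows "(\<lambda>n. cip (blinfun_apply T (v n)) (v n)) \<longlonglongrightarrow> 0"
proof (rule LIMSEQ_I)
  fix r :: real assume r: "0 < r"
  let ?X = "closure (blinfun_apply T ` cball 0 1)"
  have "compact ?X" using T by (simp add: compact_op_def)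
  then obtain k where k: "finite k" "?X \<subseteq> (\<Union>x\<in>k. ball x (r / 2))"
    using r unfolding compact_eq_totally_bounded by (metis divide_pos_pos zero_less_numeral)
  have "\<forall>\<^sub>F n in sequentially. \<forall>y\<in>k. norm (trunc n y - y) < r / 2"
  proof (rule eventually_ball_finite[OF k(1)], rule ballI)
    fix y
    show "\<forall>\<^sub>F n in sequentially. norm (trunc n y - y) < r / 2"
      using tendstoD[OF trunc_tendsto[of y], of "r / 2"] r by (simp add: dist_norm)
  qed
  then obtain N where N: "\<And>n y. n \<ge> N \<Longrightarrow> y \<in> k \<Longrightarrow> norm (trunc n y - y) < r / 2"
    unfolding eventually_sequentially by blast
  have "norm (cip (T (v n)) (v n) - 0) < r" if n: "n \<ge> N" for n
  proof -
    have "T (v n) \<in> ?X" using v(1)[of n] by (intro subsetD[OF closure_subset]) auto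
    then obtain y where y: "y \<in> k" "norm (T (v n) - y) < r / 2"
      using k(2) by (auto simp: dist_norm norm_minus_commute)
    have "cip (trunc n y) (v n) = 0" unfolding cip_trunc v(2) by (simp add: cip_simps)
    then have "cip (T (v n)) (v n) = cip (T (v n) - y) (v n) - cip (trunc n y - y) (v n)"
      by (simp add: cip_simps)
    also have "cmod \<dots> \<le> cmod (cip (T (v n) - y) (v n)) + cmod (cip (trunc n y - y) (v n))"
      by (rule norm_triangle_ineq4)
    also have "\<dots> \<le> norm (T (v n) - y) * norm (v n) + norm (trunc n y - y) * norm (v n)"
      by (intro add_mono cip_bound)
    also have "\<dots> < r" using y(2) N[OF n y(1)] v(1)[of n] by simp
    finally show ?thesis by simp
  qed
  then show "\<exists>N. \<forall>n\<ge>N. norm (cip (T (v n)) (v n) - 0) < r" by blast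
qed

subsection \<open>Limits of vector states\<close>

lemma BH_simps [simp]:
  "ops BH = bounded_ops" "add BH = (+)" "scl BH = cscale_op" "mul BH = (o\<^sub>L)" "adj BH = adj_op"
  "unt BH = id_blinfun" "vecs BH = UNIV" "app BH = blinfun_apply" "ip BH = cip"
  by (simp_all add: BH_def)

text \<open>The vector states are points of a product of discs indexed by all operators, so they
  have a cluster point \<psi>. A subsequence that works for all operators at once need not exist;
  instead the neighbourhoods of \<psi> are pulled back to the indices and refine
  \<open>sequentially\<close> to a filter \<open>U\<close> along which every operator
  converges.\<close>

lemma limit_state:
  fixes v :: "nat \<Rightarrow> ell2"
  assumes v: "\<And>n. norm (v n) = 1"
  shows "\<exists>U \<psi>. U \<noteq> bot \<and> U \<le> sequentially \<and>
    (\<forall>T. ((\<lambda>n. cip (blinfun_apply T (v n)) (v n)) \<longlongrightarrow> \<psi> T) U)"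
proof -
  define \<Psi> where "\<Psi> n T = cip (blinfun_apply T (v n)) (v n)" for n T
  let ?B = "{f. \<forall>T. f T \<in> cball (0::complex) (norm (T :: ell2 \<Rightarrow>\<^sub>L ell2))}"
  have "compact ?B" by (rule compact_fun) simp
  moreover have "filtermap \<Psi> sequentially \<noteq> bot" by (simp add: filtermap_bot_iff)
  moreover have "\<Psi> n \<in> ?B" for n
  proof -
    have "cmod (\<Psi> n T) \<le> norm T" for T
      using order_trans[OF cip_bound[of "T (v n)" "v n"], of "norm T"] norm_blinfun[of T "v n"] v[of n]
      by (simp add: \<Psi>_def)
    then show ?thesis by simp
  qed
  then have "eventually (\<lambda>f. f \<in> ?B) (filtermap \<Psi> sequentially)" by (simp add: eventually_filtermap)
  ultimately obtain \<psi> where \<psi>: "inf (nhds \<psi>) (filtermap \<Psi> sequentially) \<noteq> bot"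
    unfolding compact_filter by blast
  define U where "U = inf (filtercomap \<Psi> (nhds \<psi>)) sequentially"
  have "U \<noteq> bot"
  proof
    assume "U = bot"
    then have "eventually (\<lambda>_. False) U" by simp
    then obtain P Q where P: "eventually P (filtercomap \<Psi> (nhds \<psi>))" and Q: "eventually Q sequentially"
      and PQ: "\<And>n. P n \<Longrightarrow> Q n \<Longrightarrow> False"
      unfolding U_def eventually_inf by blast
    from P obtain P' where P': "eventually P' (nhds \<psi>)" "\<And>n. P' (\<Psi> n) \<Longrightarrow> P n"
      unfolding eventually_filtercomap by blast
    have "eventually (\<lambda>f. \<not> P' f) (filtermap \<Psi> sequentially)"
      unfolding eventually_filtermap using Q by (rule eventually_mono) (use P'(2) PQ in blast)
    then have "eventually (\<lambda>_. False) (inf (nhds \<psi>) (filtermap \<Psi> sequentially))"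
      unfolding eventually_inf using P'(1) by blast
    then show False using \<psi> by (simp add: trivial_limit_def)
  qed
  moreover have "((\<lambda>n. \<Psi> n T) \<longlongrightarrow> \<psi> T) U" for T
  proof -
    have "filterlim \<Psi> (nhds \<psi>) (filtercomap \<Psi> (nhds \<psi>))" by (rule filterlim_filtercomap)
    then have "(\<Psi> \<longlongrightarrow> \<psi>) U" unfolding U_def by (rule filterlim_mono) simp_all
    have cont: "continuous_on UNIV (\<lambda>f :: (ell2 \<Rightarrow>\<^sub>L ell2) \<Rightarrow> complex. f T)"
      using continuous_map_product_projection[of T UNIV "\<lambda>_. euclidean :: complex topology"]
      by (simp add: euclidean_product_topology)
    show ?thesis
    proof (rule topological_tendstoI)
      fix V assume V: "open V" "\<psi> T \<in> V"
      have "open ((\<lambda>f. f T) -` V)" using open_vimage[OF V(1) cont] .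
      from topological_tendstoD[OF \<open>(\<Psi> \<longlongrightarrow> \<psi>) U\<close> this]
      show "\<forall>\<^sub>F n in U. \<Psi> n T \<in> V" using V(2) by simp
    qed
  qed
  ultimately show ?thesis unfolding \<Psi>_def U_def
    by (intro exI[of _ "inf (filtercomap (\<lambda>n T. cip (blinfun_apply T (v n)) (v n)) (nhds \<psi>)) sequentially"]
        exI[of _ \<psi>] conjI allI) (simp_all add: \<Psi>_def[abs_def])
qed

lemma mat_positive_BH_vector:
  assumes F: "mat_positive BH k F"
  shows "(\<Sum>i<k. \<Sum>j<k. cip (blinfun_apply (F i j) v) v * z j * cnj (z i)) \<in> \<real>\<^sub>\<ge>\<^sub>0"
proof -
  have F': "F i j \<in> bounded_ops" if "i < k" "j < k" for i j
    using F that unfolding mat_positive_def by simp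
  have "(\<Sum>i<k. \<Sum>j<k. cip (blinfun_apply (F i j) (cscale (z j) v)) (cscale (z i) v)) \<in> \<real>\<^sub>\<ge>\<^sub>0"
    using F unfolding mat_positive_def by simp
  also have "(\<Sum>i<k. \<Sum>j<k. cip (blinfun_apply (F i j) (cscale (z j) v)) (cscale (z i) v))
      = (\<Sum>i<k. \<Sum>j<k. cip (blinfun_apply (F i j) v) v * z j * cnj (z i))"
    by (intro sum.cong refl) (use F' in \<open>simp add: bounded_ops_iff cip_simps\<close>)
  finally show ?thesis .
qed

lemma limit_state_on:
  assumes v: "\<And>n. norm (v n) = 1" and U: "U \<noteq> bot"
    and lim: "\<And>T. ((\<lambda>n. cip (blinfun_apply T (v n)) (v n)) \<longlongrightarrow> \<psi> T) U"
  shows "state_on BH A \<psi>"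
  unfolding state_on_def
proof (intro conjI ballI allI impI)
  show "\<psi> (add BH S T) = \<psi> S + \<psi> T" for S T
  proof (rule tendsto_unique[OF U lim])
    show "((\<lambda>n. cip (blinfun_apply (add BH S T) (v n)) (v n)) \<longlongrightarrow> \<psi> S + \<psi> T) U"
      using tendsto_add[OF lim[of S] lim[of T]] by (simp add: blinfun.add_left cip_simps)
  qed
  show "\<psi> (scl BH c T) = c * \<psi> T" for c T
  proof (rule tendsto_unique[OF U lim])
    show "((\<lambda>n. cip (blinfun_apply (scl BH c T) (v n)) (v n)) \<longlongrightarrow> c * \<psi> T) U"
      using tendsto_mult[OF tendsto_const lim[of T], of c] by (simp add: cip_simps)
  qed
  show "\<psi> (unt BH) = 1"
    using tendsto_unique[OF U lim[of "unt BH"], of 1] by (simp add: cip_self v)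
  fix k :: nat and F and z :: "nat \<Rightarrow> complex"
  assume F: "(\<forall>i<k. \<forall>j<k. F i j \<in> A) \<and> mat_positive BH k F"
  show "(\<Sum>i<k. \<Sum>j<k. \<psi> (F i j) * z j * cnj (z i)) \<in> \<real>\<^sub>\<ge>\<^sub>0"
  proof (rule Lim_in_closed_set[OF closed_nonneg_Reals_complex _ U])
    show "\<forall>\<^sub>F n in U. (\<Sum>i<k. \<Sum>j<k. cip (blinfun_apply (F i j) (v n)) (v n) * z j * cnj (z i)) \<in> \<real>\<^sub>\<ge>\<^sub>0"
      using mat_positive_BH_vector F by simp
  qed (intro tendsto_intros lim)
qed

lemma vector_state_BH:
  assumes "norm v = 1"
  shows "state_on BH A (\<lambda>T. cip (blinfun_apply T v) v)"
  by (rule limit_state_on[of "\<lambda>_. v" sequentially]) (simp_all add: assms)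

text \<open>Otherwise there are unit vectors beyond every cut-off whose tuples of values stay away
  from the simplex. A limit state along them vanishes on the compact operators, so its values on
  \<open>x\<close> form a point of the first level of the essential range and hence of the simplex.
  Finiteness of the index type makes the approximation simultaneous in all \<open>l\<close>, a
  contradiction.\<close>

lemma (in simplex_coords) essential_numerical_range:
  assumes x: "ess_matrix_range x \<subseteq> nc_simplex" and e: "0 < e"
  shows "\<exists>N. \<forall>v. norm v = 1 \<and> trunc N v = 0 \<longrightarrow>
    (\<exists>p\<in>Delta. \<forall>l. cmod (cip (blinfun_apply (x l) v) v - of_real (vec_nth p l)) < e)"
proof (rule ccontr)
  assume neg: "\<not> ?thesis"
  then have "\<forall>N. \<exists>v. norm v = 1 \<and> trunc N v = 0 \<and>
    \<not> (\<exists>p\<in>Delta. \<forall>l. cmod (cip (blinfun_apply (x l) v) v - of_real (vec_nth p l)) < e)" by blast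
  from choice[OF this] obtain v where v: "\<And>n. norm (v n) = 1" "\<And>n. trunc n (v n) = 0"
    and no: "\<And>n. \<not> (\<exists>p\<in>Delta. \<forall>l. cmod (cip (blinfun_apply (x l) (v n)) (v n) - of_real (vec_nth p l)) < e)"
    by blast
  obtain U \<psi> where U: "U \<noteq> bot" "U \<le> sequentially"
    and lim: "\<And>T. ((\<lambda>n. cip (blinfun_apply T (v n)) (v n)) \<longlongrightarrow> \<psi> T) U"
    using limit_state[of v, OF v(1)] by blast
  have "\<psi> T = 0" if "compact_op T" for T
    by (rule tendsto_unique[OF U(1) lim tendsto_mono[OF U(2) compact_form_tendsto_0[where v = v, OF that v]]])
  then have van: "\<forall>T\<in>cstar BH x. compact_op T \<longrightarrow> Matrix.mat 1 1 (\<lambda>_. \<psi> T) = 0\<^sub>m 1 1"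
    by (auto intro!: eq_matI)
  have "ucp BH (cstar BH x) 1 (\<lambda>T. Matrix.mat 1 1 (\<lambda>_. \<psi> T))"
    by (rule matrix_range_state[OF limit_state_on[where v = v, OF v(1) U(1) lim]])
  then have "(\<lambda>l. Matrix.mat 1 1 (\<lambda>_. \<psi> (x l))) \<in> ess_matrix_range x"
    unfolding ess_matrix_range_def using van
    by (intro CollectI exI[of _ 1] exI[of _ "\<lambda>T. Matrix.mat 1 1 (\<lambda>_. \<psi> T)"] conjI) simp_all
  then have "(\<lambda>l. Matrix.mat 1 1 (\<lambda>_. \<psi> (x l))) \<in> level nc_simplex 1"
    using x by (auto simp: level_def tuples_def)
  then obtain p where p: "p \<in> Delta"
    and pt: "(\<lambda>l. Matrix.mat 1 1 (\<lambda>_. \<psi> (x l))) = point_tuple (complexify p)"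
    unfolding level_1_nc_simplex by blast
  have "\<psi> (x l) = of_real (vec_nth p l)" for l
    using arg_cong[OF fun_cong[OF pt, of l], of "\<lambda>A. A $$ (0, 0)"]
    by (simp add: point_tuple_def complexify_def)
  then have "\<forall>\<^sub>F n in U. cmod (cip (blinfun_apply (x l) (v n)) (v n) - of_real (vec_nth p l)) < e" for l
    using tendstoD[OF lim[of "x l"] e] by (simp add: dist_norm)
  then have "\<forall>\<^sub>F n in U. \<forall>l\<in>UNIV. cmod (cip (blinfun_apply (x l) (v n)) (v n) - of_real (vec_nth p l)) < e"
    by (intro eventually_ball_finite) simp_all
  then have "\<exists>n. \<forall>l\<in>UNIV. cmod (cip (blinfun_apply (x l) (v n)) (v n) - of_real (vec_nth p l)) < e"
    by (rule eventually_happens'[OF U(1)])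
  then show False using no p by blast
qed

subsection \<open>Lifting a positive partition of unity\<close>

text \<open>Symmetry is stated for the real inner product, so that the lifting can be carried out
  with real forms; complex linearity upgrades it to the complex one in
  \<open>selfadj_cip\<close>.\<close>

definition selfadj :: "(ell2 \<Rightarrow>\<^sub>L ell2) \<Rightarrow> bool" where
  "selfadj T \<longleftrightarrow> T \<in> bounded_ops \<and> (\<forall>v w. inner (blinfun_apply T v) w = inner v (blinfun_apply T w))"

lemma selfadj_bounded: "selfadj T \<Longrightarrow> T \<in> bounded_ops"
  by (simp add: selfadj_def)

lemma selfadj_inner: "selfadj T \<Longrightarrow> inner (blinfun_apply T v) w = inner v (blinfun_apply T w)"
  by (simp add: selfadj_def)

lemma selfadj_simps:
  "selfadj S \<Longrightarrow> selfadj T \<Longrightarrow> selfadj (S + T)" "selfadj S \<Longrightarrow> selfadj T \<Longrightarrow> selfadj (S - T)"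
  "selfadj T \<Longrightarrow> selfadj (r *\<^sub>R T)" "selfadj id_blinfun" "selfadj 0" "selfadj (trunc_op n)"
  by (auto simp: selfadj_def bounded_ops_closed blinfun.add_left blinfun.diff_left blinfun.scaleR_left
      inner_add_left inner_add_right inner_diff_left inner_diff_right inner_trunc)

lemma selfadj_sum: "(\<And>i. i \<in> I \<Longrightarrow> selfadj (T i)) \<Longrightarrow> selfadj (\<Sum>i\<in>I. T i)"
  by (induction I rule: infinite_finite_induct) (auto intro: selfadj_simps)

lemma selfadj_conj: "selfadj S \<Longrightarrow> selfadj T \<Longrightarrow> selfadj (S o\<^sub>L T o\<^sub>L S)"
  by (auto simp: selfadj_def bounded_ops_closed)

lemma selfadj_cip:
  assumes "selfadj T"
  shows "cip (blinfun_apply T v) v = of_real (inner (T v) v)"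
proof -
  have "inner (T v) (cscale \<i> v) = inner v (cscale \<i> (T v))"
    using assms by (simp add: selfadj_def bounded_ops_iff)
  also have "\<dots> = inner (cscale \<i> (T v)) v" by (rule inner_commute)
  also have "\<dots> = - inner (T v) (cscale \<i> v)"
    unfolding Re_cip[symmetric] by (simp add: cip_simps)
  finally have "inner (T v) (cscale \<i> v) = 0" by simp
  then show ?thesis by (simp add: complex_eq_iff Re_cip Im_cip)
qed

text \<open>This is \<open>form_bound\<close> at cut-off 0, where the condition on the vectors is
  empty. The factor 2 is not sharp, but the bound only has to make the successive changes
  summable.\<close>

lemma norm_le_of_form:
  assumes S: "selfadj S" and c: "0 \<le> c"
    and f: "\<And>v. \<bar>inner (blinfun_apply S v) v\<bar> \<le> c * (norm v)\<^sup>2"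
  shows "norm S \<le> 2 * c"
proof (rule norm_blinfun_bound)
  show "norm (S v) \<le> 2 * c * norm v" for v
  proof -
    have "cmod (cip (S v) (S v)) \<le> 2 * c * norm v * norm (S v)"
    proof (rule form_bound[where N = 0])
      show "S \<in> bounded_ops" by (rule selfadj_bounded[OF S])
      show "cmod (cip (S v) v) \<le> c * (norm v)\<^sup>2" for v using f by (simp add: selfadj_cip[OF S])
    qed (rule ell2_eqI, simp)+
    then have "norm (S v) * norm (S v) \<le> (2 * c * norm v) * norm (S v)"
      by (simp add: cip_self norm_power norm_mult power2_eq_square)
    then show ?thesis using c by (cases "norm (S v) = 0") auto
  qed
qed (use c in simp)

text \<open>The finitely many images \<open>T i (ket j)\<close> with \<open>j < n\<close> have small
  tails beyond some common \<open>N\<close>. So \<open>T i\<close> hardly connects the first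
  \<open>n\<close> coordinates with those beyond \<open>N\<close>.\<close>

lemma trunc_far:
  fixes T :: "nat \<Rightarrow> ell2 \<Rightarrow>\<^sub>L ell2"
  assumes T: "\<And>i. i < M \<Longrightarrow> selfadj (T i)" and \<kappa>: "0 < \<kappa>"
  shows "\<exists>N\<ge>n. \<forall>i<M. \<forall>v w. trunc N v = 0 \<longrightarrow>
    \<bar>inner (blinfun_apply (T i) v) (trunc n w)\<bar> \<le> \<kappa> * norm v * norm w"
proof -
  let ?s = "\<lambda>i N. \<Sum>j<n. norm (trunc N (T i (ket j)) - T i (ket j))"
  have "(\<lambda>N. ?s i N) \<longlonglongrightarrow> (\<Sum>j<n. norm (T i (ket j) - T i (ket j)))" for i
    by (intro tendsto_intros trunc_tendsto)
  then have "\<forall>\<^sub>F N in sequentially. ?s i N < \<kappa>" for i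
    using \<kappa> by (intro order_tendstoD) (auto simp: tendsto_def)
  then have "\<forall>\<^sub>F N in sequentially. \<forall>i\<in>{..<M}. ?s i N < \<kappa>"
    by (intro eventually_ball_finite) simp_all
  with eventually_ge_at_top[of n] have "\<forall>\<^sub>F N in sequentially. n \<le> N \<and> (\<forall>i\<in>{..<M}. ?s i N < \<kappa>)"
    by (rule eventually_conj)
  then obtain N where N: "n \<le> N" "\<And>i. i < M \<Longrightarrow> ?s i N < \<kappa>"
    unfolding eventually_sequentially by auto
  have "\<bar>inner (T i v) (trunc n w)\<bar> \<le> \<kappa> * norm v * norm w" if i: "i < M" and v: "trunc N v = 0" for i v w
  proof -
    let ?y = "T i (trunc n w)"
    have b: "T i \<in> bounded_ops" by (rule selfadj_bounded[OF T[OF i]])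
    have "?y - trunc N ?y = (\<Sum>j<n. cscale (ell2_coord w j) (T i (ket j) - trunc N (T i (ket j))))"
      using b unfolding trunc_eq_sum[of n]
      by (induction n) (simp_all add: blinfun.add_right trunc_simps bounded_ops_iff cscale_simps)
    also have "norm \<dots> \<le> (\<Sum>j<n. norm w * norm (trunc N (T i (ket j)) - T i (ket j)))"
      by (rule sum_norm_le) (simp add: norm_cscale norm_minus_commute mult_right_mono coord_le_norm)
    also have "\<dots> \<le> norm w * \<kappa>"
      unfolding sum_distrib_left[symmetric] by (rule mult_left_mono) (use N(2)[OF i] in simp_all)
    finally have y: "norm (?y - trunc N ?y) \<le> norm w * \<kappa>" .
    have "inner (T i v) (trunc n w) = inner v ?y" by (rule selfadj_inner[OF T[OF i]])
    also have "\<dots> = inner v (?y - trunc N ?y)" by (simp add: inner_diff_right inner_trunc[symmetric] v)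
    finally have "\<bar>inner (T i v) (trunc n w)\<bar> \<le> norm v * norm (?y - trunc N ?y)"
      by (simp add: Cauchy_Schwarz_ineq2)
    also have "\<dots> \<le> norm v * (norm w * \<kappa>)" by (rule mult_left_mono[OF y]) simp
    finally show ?thesis by (simp add: mult_ac)
  qed
  then show ?thesis using N(1) by blast
qed

section \<open>Cut-offs, off-diagonal corners and averaged pinchings\<close>

lemma inner_split_trunc:
  assumes "selfadj T"
  shows "inner (blinfun_apply T v) v = inner (T (trunc n v)) (trunc n v)
    + inner (T (v - trunc n v)) (v - trunc n v) + 2 * inner (T (v - trunc n v)) (trunc n v)"
proof -
  have "inner (T (trunc n v)) (v - trunc n v) = inner (T (v - trunc n v)) (trunc n v)"
    by (metis assms selfadj_inner inner_commute)
  then have "inner (T (trunc n v + (v - trunc n v))) (trunc n v + (v - trunc n v))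
      = inner (T (trunc n v)) (trunc n v) + inner (T (v - trunc n v)) (v - trunc n v)
        + 2 * inner (T (v - trunc n v)) (trunc n v)"
    unfolding blinfun.add_right inner_add_left inner_add_right by simp
  then show ?thesis by simp
qed

text \<open>
  For rapidly increasing cut-offs the operator is almost block tridiagonal, so the off-diagonal
  corners of successive cut-offs are almost orthogonal and their sum stays bounded.
\<close>

lemma off_diagonal_sum:
  fixes N :: "nat \<Rightarrow> nat"
  assumes mono: "\<And>j. N j \<le> N (Suc j)" and \<kappa>: "0 \<le> \<kappa>"
    and far: "\<And>j v w. trunc (N (Suc j)) v = 0 \<Longrightarrow>
      \<bar>inner (blinfun_apply T v) (trunc (N j) w)\<bar> \<le> \<kappa> * norm v * norm w"
  shows "\<bar>\<Sum>j<L. inner (T (v - trunc (N (Suc j)) v)) (trunc (N (Suc j)) v)\<bar>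
    \<le> (2 * real L * \<kappa> + norm T) * (norm v)\<^sup>2"
proof -
  define P where "P j = trunc (N j) v" for j
  define E where "E j = P (Suc j) - P j" for j
  have PP: "trunc (N i) (P j) = P i" if "i \<le> j" for i j
    using lift_Suc_mono_le[of N, OF mono that] by (simp add: P_def trunc_trunc min_absorb1)
  have E2: "(norm (E j))\<^sup>2 = (norm (P (Suc j)))\<^sup>2 - (norm (P j))\<^sup>2" for j
    using norm_trunc_square[of "P (Suc j)" "N j"] PP[of j "Suc j"] by (simp add: E_def)
  have Pv: "norm (P j) \<le> norm v" for j by (simp add: P_def norm_trunc_le)
  have Ev: "norm (E j) \<le> norm v" for j
  proof (rule power2_le_imp_le)
    have "(norm (P (Suc j)))\<^sup>2 \<le> (norm v)\<^sup>2" using Pv by (intro power_mono) simp_all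
    then show "(norm (E j))\<^sup>2 \<le> (norm v)\<^sup>2" unfolding E2 using zero_le_power2[of "norm (P j)"] by linarith
  qed simp
  have "\<bar>inner (T (v - P (Suc j))) (P (Suc j))\<bar>
      \<le> 2 * \<kappa> * (norm v)\<^sup>2 + norm T * (((norm (E (Suc j)))\<^sup>2 + (norm (E j))\<^sup>2) / 2)" for j
  proof -
    \<comment> \<open>Both vectors are split at the neighbouring cut-offs. In two of the three
      resulting terms a full block separates the vectors, so \<open>far\<close> applies; only the
      adjacent blocks \<open>E (Suc j)\<close> and \<open>E j\<close> really interact.\<close>
    have "T (v - P (Suc j)) = T (v - P (Suc (Suc j))) + T (E (Suc j))"
      by (simp add: E_def flip: blinfun.add_right)
    then have "inner (T (v - P (Suc j))) (P (Suc j))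
        = inner (T (v - P (Suc (Suc j)))) (P (Suc j)) + inner (T (E (Suc j))) (P (Suc j))"
      by (simp add: inner_add_left)
    also have "inner (T (E (Suc j))) (P (Suc j)) = inner (T (E (Suc j))) (P j) + inner (T (E (Suc j))) (E j)"
      by (simp add: E_def inner_diff_right)
    finally have eq: "inner (T (v - P (Suc j))) (P (Suc j))
        = inner (T (v - P (Suc (Suc j)))) (P (Suc j)) + inner (T (E (Suc j))) (P j)
          + inner (T (E (Suc j))) (E j)" by simp
    have "trunc (N (Suc (Suc j))) (v - P (Suc (Suc j))) = 0"
      by (simp add: P_def trunc_simps trunc_trunc)
    then have "\<bar>inner (T (v - P (Suc (Suc j)))) (P (Suc j))\<bar> \<le> \<kappa> * norm (v - P (Suc (Suc j))) * norm v"
      unfolding P_def[of "Suc j"] by (rule far)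
    also have "\<dots> \<le> \<kappa> * norm v * norm v"
      by (intro mult_right_mono mult_left_mono) (simp_all add: P_def norm_tail_le \<kappa>)
    finally have 1: "\<bar>inner (T (v - P (Suc (Suc j)))) (P (Suc j))\<bar> \<le> \<kappa> * (norm v)\<^sup>2"
      by (simp add: power2_eq_square mult_ac)
    have "trunc (N (Suc j)) (E (Suc j)) = 0"
      by (simp add: E_def trunc_simps PP)
    then have "\<bar>inner (T (E (Suc j))) (P j)\<bar> \<le> \<kappa> * norm (E (Suc j)) * norm v"
      unfolding P_def by (rule far)
    also have "\<dots> \<le> \<kappa> * norm v * norm v"
      by (intro mult_right_mono mult_left_mono) (simp_all add: Ev \<kappa>)
    finally have 2: "\<bar>inner (T (E (Suc j))) (P j)\<bar> \<le> \<kappa> * (norm v)\<^sup>2"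
      by (simp add: power2_eq_square mult_ac)
    have "\<bar>inner (T (E (Suc j))) (E j)\<bar> \<le> norm (T (E (Suc j))) * norm (E j)" by (rule Cauchy_Schwarz_ineq2)
    also have "\<dots> \<le> norm T * norm (E (Suc j)) * norm (E j)" by (intro mult_right_mono norm_blinfun) simp
    also have "\<dots> = norm T * (norm (E (Suc j)) * norm (E j))" by simp
    also have "\<dots> \<le> norm T * (((norm (E (Suc j)))\<^sup>2 + (norm (E j))\<^sup>2) / 2)"
      using sum_squares_bound[of "norm (E (Suc j))" "norm (E j)"] by (intro mult_left_mono) simp_all
    finally have 3: "\<bar>inner (T (E (Suc j))) (E j)\<bar> \<le> norm T * (((norm (E (Suc j)))\<^sup>2 + (norm (E j))\<^sup>2) / 2)" .
    show ?thesis unfolding eq using 1 2 3 by linarith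
  qed
  then have "\<bar>\<Sum>j<L. inner (T (v - P (Suc j))) (P (Suc j))\<bar>
      \<le> (\<Sum>j<L. 2 * \<kappa> * (norm v)\<^sup>2 + norm T * (((norm (E (Suc j)))\<^sup>2 + (norm (E j))\<^sup>2) / 2))"
    by (intro order_trans[OF sum_abs sum_mono])
  also have "\<dots> = 2 * real L * \<kappa> * (norm v)\<^sup>2
      + norm T * (((\<Sum>j<L. (norm (E (Suc j)))\<^sup>2) + (\<Sum>j<L. (norm (E j))\<^sup>2)) / 2)"
    by (simp add: sum.distrib sum_distrib_left[symmetric] sum_divide_distrib[symmetric])
  also have "\<dots> \<le> 2 * real L * \<kappa> * (norm v)\<^sup>2 + norm T * (norm v)\<^sup>2"
  proof (intro add_left_mono mult_left_mono)
    \<comment> \<open>The squared norms of the blocks telescope, which keeps the interaction of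
      adjacent blocks below \<open>norm T\<close> times the squared norm of \<open>v\<close>,
      however large \<open>L\<close> is.\<close>
    have "(\<Sum>j<L. (norm (E (Suc j)))\<^sup>2) = (norm (P (Suc L)))\<^sup>2 - (norm (P (Suc 0)))\<^sup>2"
      unfolding E2 by (rule sum_lessThan_telescope)
    moreover have "(\<Sum>j<L. (norm (E j))\<^sup>2) = (norm (P L))\<^sup>2 - (norm (P 0))\<^sup>2"
      unfolding E2 by (rule sum_lessThan_telescope)
    moreover have "(norm (P j))\<^sup>2 \<le> (norm v)\<^sup>2" for j using Pv by (intro power_mono) simp_all
    from this[of L] this[of "Suc L"] have "(norm (P L))\<^sup>2 + (norm (P (Suc L)))\<^sup>2 \<le> 2 * (norm v)\<^sup>2" by linarith
    ultimately show "((\<Sum>j<L. (norm (E (Suc j)))\<^sup>2) + (\<Sum>j<L. (norm (E j))\<^sup>2)) / 2 \<le> (norm v)\<^sup>2"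
      using zero_le_power2[of "norm (P 0)"] zero_le_power2[of "norm (P (Suc 0))"] by argo
  qed simp
  finally show ?thesis by (simp add: P_def distrib_right)
qed

text \<open>The two corners may come from different operators: averaging puts a repaired operator on
  the finite corner and leaves the tail as it was, and the final construction puts coordinate
  projections there.\<close>

definition pinch :: "nat \<Rightarrow> (ell2 \<Rightarrow>\<^sub>L ell2) \<Rightarrow> (ell2 \<Rightarrow>\<^sub>L ell2) \<Rightarrow> (ell2 \<Rightarrow>\<^sub>L ell2)" where
  "pinch n S T = (trunc_op n o\<^sub>L S o\<^sub>L trunc_op n)
     + ((id_blinfun - trunc_op n) o\<^sub>L T o\<^sub>L (id_blinfun - trunc_op n))"

lemma pinch_apply:
  "blinfun_apply (pinch n S T) v
    = trunc n (S (trunc n v)) + (T (v - trunc n v) - trunc n (T (v - trunc n v)))"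
  by (simp add: pinch_def blinfun.add_left blinfun.diff_left)

lemma selfadj_pinch: "selfadj S \<Longrightarrow> selfadj T \<Longrightarrow> selfadj (pinch n S T)"
  unfolding pinch_def by (intro selfadj_simps selfadj_conj)

lemma inner_pinch:
  "inner (blinfun_apply (pinch n S T) v) v
    = inner (S (trunc n v)) (trunc n v) + inner (T (v - trunc n v)) (v - trunc n v)"
  by (simp add: pinch_apply inner_add_left inner_diff_left inner_diff_right inner_trunc)

lemma sum_pinch:
  fixes M :: nat
  assumes "\<And>v. (\<Sum>i<M. blinfun_apply (S i) (trunc n v)) = trunc n v"
    and "\<And>v. (\<Sum>i<M. blinfun_apply (T i) v) = v"
  shows "(\<Sum>i<M. blinfun_apply (pinch n (S i) (T i)) v) = v"
proof -
  have t: "(\<Sum>i<M. trunc n (f i)) = trunc n (\<Sum>i<M. f i)" for f :: "nat \<Rightarrow> ell2"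
    by (induction M) (simp_all add: trunc_simps)
  show ?thesis
    unfolding pinch_apply sum.distrib sum_subtractf t assms by (simp add: trunc_simps trunc_trunc)
qed

text \<open>On a finite corner each \<open>T i\<close> is replaced by a positive \<open>W i\<close>,
  a mixture with the identity that still sums to one over \<open>i\<close>; on the tail the bound
  \<open>- d\<close> already holds. So every pinching has lower bound \<open>- d\<close>, and the
  average over \<open>L\<close> cut-offs keeps it while making the discarded corners small. Beyond
  the last cut-off the forms are unchanged, which lets the next round start from the same asymptotic
  information.\<close>

lemma averaging_step:
  fixes T :: "nat \<Rightarrow> ell2 \<Rightarrow>\<^sub>L ell2"
  assumes M: "0 < M" and e: "0 < e" and d: "0 \<le> d"
    and sa: "\<And>i. i < M \<Longrightarrow> selfadj (T i)"
    and one: "\<And>v. (\<Sum>i<M. blinfun_apply (T i) v) = v"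
    and low: "\<And>i v. i < M \<Longrightarrow> - e * (norm v)\<^sup>2 \<le> inner (blinfun_apply (T i) v) v"
    and far: "\<And>i v. i < M \<Longrightarrow> trunc n v = 0 \<Longrightarrow> - d * (norm v)\<^sup>2 \<le> inner (blinfun_apply (T i) v) v"
  shows "\<exists>T'. (\<forall>i<M. selfadj (T' i)) \<and> (\<forall>v. (\<Sum>i<M. blinfun_apply (T' i) v) = v) \<and>
    (\<forall>i<M. \<forall>v. - d * (norm v)\<^sup>2 \<le> inner (blinfun_apply (T' i) v) v) \<and>
    (\<exists>N. \<forall>i<M. \<forall>v. trunc N v = 0 \<longrightarrow> inner (blinfun_apply (T' i) v) v = inner (blinfun_apply (T i) v) v) \<and>
    (\<forall>i<M. \<forall>v. \<bar>inner (blinfun_apply (T' i - T i) v) v\<bar> \<le> (real M + 2) * e * (norm v)\<^sup>2)"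
proof -
  define \<kappa> where "\<kappa> = e / 8"
  have \<kappa>: "0 < \<kappa>" using e by (simp add: \<kappa>_def)
  have "\<forall>n. \<exists>N\<ge>n. \<forall>i<M. \<forall>v w. trunc N v = 0 \<longrightarrow>
      \<bar>inner (T i v) (trunc n w)\<bar> \<le> \<kappa> * norm v * norm w"
    using trunc_far[OF sa \<kappa>] by (rule allI)
  from choice[OF this] obtain nx where nx: "\<forall>n. n \<le> nx n \<and> (\<forall>i<M. \<forall>v w. trunc (nx n) v = 0 \<longrightarrow>
      \<bar>inner (T i v) (trunc n w)\<bar> \<le> \<kappa> * norm v * norm w)" by (rule exE)
  define N where "N j = (nx ^^ j) n" for j
  have Nmono: "N j \<le> N (Suc j)" for j using nx by (simp add: N_def)
  have Nfar: "\<bar>inner (T i v) (trunc (N j) w)\<bar> \<le> \<kappa> * norm v * norm w"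
    if "i < M" "trunc (N (Suc j)) v = 0" for i j v w
    using nx that by (simp add: N_def)
  define B where "B = (\<Sum>i<M. norm (T i))"
  have TB: "norm (T i) \<le> B" if "i < M" for i
    unfolding B_def by (rule member_le_sum) (use that in auto)
  \<comment> \<open>With \<open>\<kappa> = e / 8\<close> and \<open>L \<ge> 4 * B / e\<close> the
    discarded corners contribute at most \<open>2 * (2 * L * \<kappa> + B) / L \<le> e\<close> to
    the averaged form. The \<open>Suc\<close> keeps \<open>L\<close> positive.\<close>
  define L where "L = Suc (nat \<lceil>4 * B / e\<rceil>)"
  have L: "4 * B / e \<le> L" unfolding L_def by linarith
  have L0: "0 < real L" by (simp add: L_def)
  have LB: "2 * (2 * real L * \<kappa> + B) \<le> real L * e"
    using L e by (simp add: \<kappa>_def field_simps)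
  \<comment> \<open>The weight for which \<open>(1 - s) * (- e) + s / M = 0\<close>, the smallest
    that the bound \<open>- e\<close> allows for making \<open>W i\<close> positive.\<close>
  define s where "s = real M * e / (1 + real M * e)"
  have Me: "0 < 1 + real M * e" using e M by (simp add: add_pos_nonneg)
  have s: "0 \<le> s" "1 - s = 1 / (1 + real M * e)" "s / M = e / (1 + real M * e)"
  proof -
    show "0 \<le> s" using Me e by (simp add: s_def)
    show "1 - s = 1 / (1 + real M * e)" using Me by (simp add: s_def diff_divide_eq_iff)
    show "s / M = e / (1 + real M * e)" using M by (simp add: s_def)
  qed
  define W where "W i = (1 - s) *\<^sub>R T i + (s / M) *\<^sub>R id_blinfun" for i
  have W: "blinfun_apply (W i) v = (1 - s) *\<^sub>R T i v + (s / M) *\<^sub>R v" for i v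
    by (simp add: W_def blinfun.add_left blinfun.scaleR_left)
  have Wsa: "selfadj (W i)" if "i < M" for i
    unfolding W_def by (intro selfadj_simps sa that)
  have Wone: "(\<Sum>i<M. W i v) = v" for v
  proof -
    have "(\<Sum>i<M. W i v) = (1 - s) *\<^sub>R (\<Sum>i<M. T i v) + (real M * (s / real M)) *\<^sub>R v"
      unfolding W sum.distrib scaleR_sum_right[symmetric] by (simp add: sum_constant_scaleR)
    then show ?thesis using M by (simp add: one scaleR_left_diff_distrib)
  qed
  have Wform: "inner (W i v) v = (1 - s) * inner (T i v) v + s / M * (norm v)\<^sup>2" for i v
    by (simp add: W inner_add_left power2_norm_eq_inner)
  have Wpos: "0 \<le> inner (W i v) v" if "i < M" for i v
  proof -
    have "0 = (1 - s) * (- e * (norm v)\<^sup>2) + s / M * (norm v)\<^sup>2" by (simp add: s)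
    also have "\<dots> \<le> inner (W i v) v"
      unfolding Wform using Me by (intro add_right_mono mult_left_mono low that) (simp add: s)
    finally show ?thesis .
  qed
  \<comment> \<open>The operators sum to one, so the lower bounds of the others bound
    \<open>T i\<close> from above. The bound does not involve \<open>norm (T i)\<close>, and
    therefore the mixing with weight \<open>s\<close> costs only a multiple of
    \<open>e\<close>.\<close>
  have upper: "\<bar>inner (T i v) v\<bar> \<le> (1 + real M * e) * (norm v)\<^sup>2" if i: "i < M" for i v
  proof -
    have "(norm v)\<^sup>2 = (\<Sum>k<M. inner (T k v) v)"
      unfolding inner_sum_left[symmetric] one by (simp add: power2_norm_eq_inner)
    also have "\<dots> = inner (T i v) v + (\<Sum>k\<in>{..<M} - {i}. inner (T k v) v)"
      using i by (intro sum.remove) simp_all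
    finally have eq: "inner (T i v) v = (norm v)\<^sup>2 - (\<Sum>k\<in>{..<M} - {i}. inner (T k v) v)" by simp
    have "(\<Sum>k\<in>{..<M} - {i}. - e * (norm v)\<^sup>2) \<le> (\<Sum>k\<in>{..<M} - {i}. inner (T k v) v)"
      by (rule sum_mono) (use low in auto)
    moreover have "(\<Sum>k\<in>{..<M} - {i}. - e * (norm v)\<^sup>2) = - ((real M - 1) * e * (norm v)\<^sup>2)"
      using i by (simp add: of_nat_diff Suc_leI)
    ultimately have "inner (T i v) v \<le> (norm v)\<^sup>2 + (real M - 1) * e * (norm v)\<^sup>2" using eq by linarith
    moreover have "(norm v)\<^sup>2 + (real M - 1) * e * (norm v)\<^sup>2 \<le> (1 + real M * e) * (norm v)\<^sup>2"
      using e by (simp add: algebra_simps)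
    moreover have "- ((1 + real M * e) * (norm v)\<^sup>2) \<le> - e * (norm v)\<^sup>2"
    proof -
      have "e \<le> 1 + real M * e" using M e by (cases M) (simp_all add: algebra_simps)
      then have "e * (norm v)\<^sup>2 \<le> (1 + real M * e) * (norm v)\<^sup>2" by (rule mult_right_mono) simp
      then show ?thesis by simp
    qed
    ultimately show ?thesis using low[OF i, of v] by linarith
  qed
  define T' where "T' i = (1 / real L) *\<^sub>R (\<Sum>j<L. pinch (N (Suc j)) (W i) (T i))" for i
  have T'a: "blinfun_apply (T' i) v = (1 / real L) *\<^sub>R (\<Sum>j<L. pinch (N (Suc j)) (W i) (T i) v)" for i v
    by (simp add: T'_def blinfun.scaleR_left blinfun.sum_left)
  have T'form: "inner (T' i v) v = (1 / real L) * (\<Sum>j<L. inner (pinch (N (Suc j)) (W i) (T i) v) v)" for i v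
    by (simp add: T'a inner_sum_left)
  have n_le: "n \<le> N j" for j
    using lift_Suc_mono_le[of N 0 j, OF Nmono] by (simp add: N_def)
  have 1: "selfadj (T' i)" if "i < M" for i
    unfolding T'_def by (intro selfadj_simps selfadj_sum selfadj_pinch Wsa sa that)
  have 2: "(\<Sum>i<M. T' i v) = v" for v
  proof -
    have "(\<Sum>i<M. T' i v) = (1 / real L) *\<^sub>R (\<Sum>j<L. \<Sum>i<M. pinch (N (Suc j)) (W i) (T i) v)"
      unfolding T'a scaleR_sum_right[symmetric] by (subst sum.swap) (rule refl)
    also have "\<dots> = v"
      unfolding sum_pinch[OF Wone one] using L0 by (simp add: sum_constant_scaleR)
    finally show ?thesis .
  qed
  have 3: "- d * (norm v)\<^sup>2 \<le> inner (T' i v) v" if i: "i < M" for i v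
  proof -
    have "- d * (norm v)\<^sup>2 \<le> inner (pinch (N (Suc j)) (W i) (T i) v) v" for j
    proof -
      let ?q = "v - trunc (N (Suc j)) v"
      have "trunc n ?q = 0" using n_le[of "Suc j"] by (simp add: trunc_simps trunc_trunc min_absorb1)
      then have "- d * (norm ?q)\<^sup>2 \<le> inner (T i ?q) ?q" by (rule far[OF i])
      then have "- (d * (norm ?q)\<^sup>2) \<le> inner (T i ?q) ?q" by simp
      moreover have "d * (norm ?q)\<^sup>2 \<le> d * (norm v)\<^sup>2"
        by (intro mult_left_mono power_mono norm_tail_le d) simp
      ultimately have "- (d * (norm v)\<^sup>2) \<le> inner (T i ?q) ?q" by linarith
      then show ?thesis unfolding inner_pinch using Wpos[OF i, of "trunc (N (Suc j)) v"] by simp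
    qed
    then have "(\<Sum>j<L. - d * (norm v)\<^sup>2) \<le> (\<Sum>j<L. inner (pinch (N (Suc j)) (W i) (T i) v) v)"
      by (intro sum_mono)
    then have "(1 / real L) * (\<Sum>j<L. - d * (norm v)\<^sup>2) \<le> inner (T' i v) v"
      unfolding T'form using L0 by (intro mult_left_mono) simp_all
    then show ?thesis using L0 by simp
  qed
  have 4: "inner (T' i v) v = inner (T i v) v" if i: "i < M" and v: "trunc (N L) v = 0" for i v
  proof -
    have "trunc (N (Suc j)) v = 0" if "j < L" for j
    proof -
      have "N (Suc j) \<le> N L" using that by (intro lift_Suc_mono_le[of N, OF Nmono]) simp
      then have "trunc (N (Suc j)) v = trunc (N (Suc j)) (trunc (N L) v)"
        by (simp add: trunc_trunc min_absorb1)
      then show ?thesis by (simp add: v trunc_simps)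
    qed
    then have "inner (pinch (N (Suc j)) (W i) (T i) v) v = inner (T i v) v" if "j < L" for j
      using that by (simp add: inner_pinch)
    then show ?thesis unfolding T'form using L0 by simp
  qed
  have 5: "\<bar>inner ((T' i - T i) v) v\<bar> \<le> (real M + 2) * e * (norm v)\<^sup>2" if i: "i < M" for i v
  proof -
    \<comment> \<open>For the cut-off of index \<open>Suc j\<close>, \<open>a j\<close> is the
      effect of replacing \<open>T i\<close> by \<open>W i\<close> on the finite corner, and
      \<open>D j\<close> below is the off-diagonal corner that the pinching discards.\<close>
    define a where "a j = s / M * (norm (trunc (N (Suc j)) v))\<^sup>2
        - s * inner (T i (trunc (N (Suc j)) v)) (trunc (N (Suc j)) v)" for j
    define D where "D j = inner (T i (v - trunc (N (Suc j)) v)) (trunc (N (Suc j)) v)" for j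
    have "inner (pinch (N (Suc j)) (W i) (T i) v) v = inner (T i v) v + (a j - 2 * D j)" for j
      unfolding inner_pinch Wform inner_split_trunc[OF sa[OF i], of v "N (Suc j)"] a_def D_def
      by (simp add: algebra_simps)
    then have "inner (T' i v) v = inner (T i v) v + (1 / real L) * ((\<Sum>j<L. a j) - 2 * (\<Sum>j<L. D j))"
      unfolding T'form using L0 by (simp add: sum.distrib sum_subtractf sum_distrib_left distrib_left)
    then have diff: "inner ((T' i - T i) v) v = (1 / real L) * ((\<Sum>j<L. a j) - 2 * (\<Sum>j<L. D j))"
      by (simp add: blinfun.diff_left inner_diff_left)
    have aj: "\<bar>a j\<bar> \<le> (real M + 1) * e * (norm v)\<^sup>2" for j
    proof -
      let ?p = "trunc (N (Suc j)) v"
      have "\<bar>a j\<bar> \<le> s / M * (norm ?p)\<^sup>2 + s * \<bar>inner (T i ?p) ?p\<bar>"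
        unfolding a_def by (rule order_trans[OF abs_triangle_ineq4]) (simp add: abs_mult s(1))
      also have "\<dots> \<le> e / (1 + real M * e) * (norm ?p)\<^sup>2 + s * ((1 + real M * e) * (norm ?p)\<^sup>2)"
        unfolding s(3) by (intro add_left_mono mult_left_mono upper i s)
      also have "s * ((1 + real M * e) * (norm ?p)\<^sup>2) = real M * e * (norm ?p)\<^sup>2"
        using Me by (simp add: s_def)
      also have "e / (1 + real M * e) * (norm ?p)\<^sup>2 + real M * e * (norm ?p)\<^sup>2 \<le> e * (norm ?p)\<^sup>2 + real M * e * (norm ?p)\<^sup>2"
        using e by (intro add_right_mono mult_right_mono) (simp_all add: divide_le_eq)
      also have "\<dots> = (real M + 1) * e * (norm ?p)\<^sup>2" by (simp add: algebra_simps)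
      also have "\<dots> \<le> (real M + 1) * e * (norm v)\<^sup>2"
        using e by (intro mult_left_mono power_mono norm_trunc_le) simp_all
      finally show ?thesis .
    qed
    have "\<bar>\<Sum>j<L. a j\<bar> \<le> (\<Sum>j<L. (real M + 1) * e * (norm v)\<^sup>2)"
      by (rule order_trans[OF sum_abs sum_mono[OF aj]])
    then have sa: "\<bar>\<Sum>j<L. a j\<bar> \<le> real L * ((real M + 1) * e * (norm v)\<^sup>2)" by simp
    have "\<bar>\<Sum>j<L. D j\<bar> \<le> (2 * real L * \<kappa> + norm (T i)) * (norm v)\<^sup>2"
      unfolding D_def by (rule off_diagonal_sum[where N = N and T = "T i" and \<kappa> = \<kappa>, OF Nmono less_imp_le[OF \<kappa>] Nfar[OF i]])
    also have "\<dots> \<le> (2 * real L * \<kappa> + B) * (norm v)\<^sup>2" by (intro mult_right_mono add_left_mono TB i) simp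
    finally have "2 * \<bar>\<Sum>j<L. D j\<bar> \<le> 2 * ((2 * real L * \<kappa> + B) * (norm v)\<^sup>2)" by linarith
    also have "\<dots> = (2 * (2 * real L * \<kappa> + B)) * (norm v)\<^sup>2" by (simp only: mult.assoc)
    also have "\<dots> \<le> (real L * e) * (norm v)\<^sup>2" by (rule mult_right_mono[OF LB]) simp
    finally have "\<bar>(\<Sum>j<L. a j) - 2 * (\<Sum>j<L. D j)\<bar> \<le> real L * ((real M + 1) * e * (norm v)\<^sup>2) + real L * e * (norm v)\<^sup>2"
      using sa by linarith
    also have "\<dots> = real L * ((real M + 2) * e * (norm v)\<^sup>2)" by (simp add: algebra_simps)
    finally have "(1 / real L) * \<bar>(\<Sum>j<L. a j) - 2 * (\<Sum>j<L. D j)\<bar> \<le> (1 / real L) * (real L * ((real M + 2) * e * (norm v)\<^sup>2))"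
      by (rule mult_left_mono) simp
    then show ?thesis unfolding diff abs_mult using L0 by simp
  qed
  show ?thesis
  proof (rule exI[of _ T'], intro conjI)
    show "\<forall>i<M. selfadj (T' i)" using 1 by simp
    show "\<forall>v. (\<Sum>i<M. blinfun_apply (T' i) v) = v" using 2 by simp
    show "\<forall>i<M. \<forall>v. - d * (norm v)\<^sup>2 \<le> inner (blinfun_apply (T' i) v) v" using 3 by simp
    show "\<exists>N. \<forall>i<M. \<forall>v. trunc N v = 0 \<longrightarrow> inner (blinfun_apply (T' i) v) v = inner (blinfun_apply (T i) v) v"
      using 4 by (intro exI[of _ "N L"]) simp
    show "\<forall>i<M. \<forall>v. \<bar>inner (blinfun_apply (T' i - T i) v) v\<bar> \<le> (real M + 2) * e * (norm v)\<^sup>2"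
      using 5 by blast
  qed
qed

text \<open>\<open>averaging_step\<close> is iterated with bounds \<open>e k\<close> that are halved
  each time. Round \<open>k\<close> moves the operators by a multiple of \<open>e k\<close>, so they
  converge in norm and the negativity disappears in the limit. The invariant that the forms agree
  with those of \<open>R\<close> beyond some cut-off supplies the better tail bound for each round
  and, at the end, shows that the limit differs from \<open>R\<close> only by a form small on
  tails.\<close>

lemma positive_lift:
  fixes R :: "nat \<Rightarrow> ell2 \<Rightarrow>\<^sub>L ell2"
  assumes M: "0 < M"
    and sa: "\<And>i. i < M \<Longrightarrow> selfadj (R i)"
    and one: "\<And>v. (\<Sum>i<M. blinfun_apply (R i) v) = v"
    and far: "\<And>d. 0 < d \<Longrightarrow> \<exists>N. \<forall>i<M. \<forall>v. trunc N v = 0 \<longrightarrow> - d * (norm v)\<^sup>2 \<le> inner (blinfun_apply (R i) v) v"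
  shows "\<exists>h. (\<forall>i<M. selfadj (h i)) \<and> (\<forall>v. (\<Sum>i<M. blinfun_apply (h i) v) = v) \<and>
    (\<forall>i<M. \<forall>v. 0 \<le> inner (blinfun_apply (h i) v) v) \<and>
    (\<forall>i<M. \<forall>d>0. \<exists>N. \<forall>v. trunc N v = 0 \<longrightarrow>
       \<bar>inner (blinfun_apply (h i) v) v - inner (blinfun_apply (R i) v) v\<bar> \<le> d * (norm v)\<^sup>2)"
proof -
  define e0 where "e0 = 1 + (\<Sum>i<M. norm (R i))"
  have e0: "0 < e0" unfolding e0_def by (intro add_pos_nonneg sum_nonneg) simp_all
  define e where "e k = e0 * (1 / 2) ^ k" for k :: nat
  have e: "0 < e k" for k using e0 by (simp add: e_def)
  define Inv where "Inv k T \<longleftrightarrow> (\<forall>i<M. selfadj (T i)) \<and> (\<forall>v. (\<Sum>i<M. blinfun_apply (T i) v) = v) \<and>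
    (\<forall>i<M. \<forall>v. - e k * (norm v)\<^sup>2 \<le> inner (blinfun_apply (T i) v) v) \<and>
    (\<exists>N. \<forall>i<M. \<forall>v. trunc N v = 0 \<longrightarrow> inner (blinfun_apply (T i) v) v = inner (blinfun_apply (R i) v) v)"
    for k and T :: "nat \<Rightarrow> ell2 \<Rightarrow>\<^sub>L ell2"
  \<comment> \<open>The factor \<open>M + 2\<close> is the form estimate of
    \<open>averaging_step\<close>; the 2 is lost in passing from forms to norms by
    \<open>norm_le_of_form\<close>.\<close>
  define Close where "Close k T T' \<longleftrightarrow> (\<forall>i<M. norm (T' i - T i) \<le> 2 * ((M + 2) * e k))"
    for k and T T' :: "nat \<Rightarrow> ell2 \<Rightarrow>\<^sub>L ell2"
  have start: "Inv 0 R"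
  proof -
    have "- e 0 * (norm v)\<^sup>2 \<le> inner (R i v) v" if i: "i < M" for i v
    proof -
      have "norm (R i) \<le> (\<Sum>i<M. norm (R i))" by (rule member_le_sum) (use i in auto)
      then have "norm (R i) \<le> e 0" by (simp add: e_def e0_def)
      then have "norm (R i) * norm v * norm v \<le> e 0 * norm v * norm v" by (intro mult_right_mono) simp_all
      moreover have "\<bar>inner (R i v) v\<bar> \<le> norm (R i) * norm v * norm v"
        by (rule order_trans[OF Cauchy_Schwarz_ineq2]) (intro mult_right_mono norm_blinfun norm_ge_zero)
      ultimately have "- (e 0 * norm v * norm v) \<le> inner (R i v) v" by linarith
      then show ?thesis by (simp add: power2_eq_square mult_ac)
    qed
    then show ?thesis unfolding Inv_def using sa one by (intro conjI exI[of _ 0]) auto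
  qed
  have step: "\<exists>T'. Inv (Suc k) T' \<and> Close k T T'" if T: "Inv k T" for k T
  proof -
    obtain n1 where n1: "\<forall>i<M. \<forall>v. trunc n1 v = 0 \<longrightarrow> inner (T i v) v = inner (R i v) v"
      using T unfolding Inv_def by blast
    obtain n2 where n2: "\<forall>i<M. \<forall>v. trunc n2 v = 0 \<longrightarrow> - e (Suc k) * (norm v)\<^sup>2 \<le> inner (R i v) v"
      using far[OF e[of "Suc k"]] by blast
    have tz: "trunc n v = 0" if "trunc m v = 0" "n \<le> m" for n m v
    proof -
      have "trunc n v = trunc n (trunc m v)" using that(2) by (simp add: trunc_trunc min_absorb1)
      then show ?thesis by (simp add: that(1) trunc_simps)
    qed
    have Tsa: "selfadj (T i)" if "i < M" for i using T that unfolding Inv_def by simp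
    obtain T' where T': "\<forall>i<M. selfadj (T' i)" "\<forall>v. (\<Sum>i<M. blinfun_apply (T' i) v) = v"
      "\<forall>i<M. \<forall>v. - e (Suc k) * (norm v)\<^sup>2 \<le> inner (blinfun_apply (T' i) v) v"
      and TN: "\<exists>N. \<forall>i<M. \<forall>v. trunc N v = 0 \<longrightarrow> inner (blinfun_apply (T' i) v) v = inner (blinfun_apply (T i) v) v"
      and TC: "\<forall>i<M. \<forall>v. \<bar>inner (blinfun_apply (T' i - T i) v) v\<bar> \<le> (real M + 2) * e k * (norm v)\<^sup>2"
    \<comment> \<open>Beyond \<open>n1\<close> the form of \<open>T i\<close> is that of
      \<open>R i\<close>, and beyond \<open>n2\<close> the latter is at least
      \<open>- e (Suc k)\<close> times the squared norm.\<close>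
    proof (atomize_elim, rule averaging_step[where n = "max n1 n2"])
      show "- e (Suc k) * (norm v)\<^sup>2 \<le> inner (T i v) v" if "i < M" "trunc (max n1 n2) v = 0" for i v
        using n1 n2 that(1) tz[OF that(2), of n1] tz[OF that(2), of n2] by simp
    qed (use M T e[of k] e[of "Suc k"] in \<open>simp_all add: Inv_def less_imp_le\<close>)
    obtain n3 where n3: "\<forall>i<M. \<forall>v. trunc n3 v = 0 \<longrightarrow> inner (T' i v) v = inner (T i v) v" using TN by blast
    have "\<forall>i<M. \<forall>v. trunc (max n1 n3) v = 0 \<longrightarrow> inner (T' i v) v = inner (R i v) v"
    proof (intro allI impI)
      fix i v assume "i < M" "trunc (max n1 n3) v = 0"
      then show "inner (T' i v) v = inner (R i v) v"
        using n1 n3 tz[of "max n1 n3" v n1] tz[of "max n1 n3" v n3] by simp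
    qed
    then have "Inv (Suc k) T'" unfolding Inv_def using T' by blast
    moreover have "Close k T T'"
      unfolding Close_def
    proof (intro allI impI)
      fix i assume i: "i < M"
      have "norm (T' i - T i) \<le> 2 * ((real M + 2) * e k)"
      proof (rule norm_le_of_form)
        show "selfadj (T' i - T i)" using T' Tsa i by (intro selfadj_simps) simp_all
        show "0 \<le> (real M + 2) * e k" using e[of k] by simp
        show "\<bar>inner ((T' i - T i) v) v\<bar> \<le> (real M + 2) * e k * (norm v)\<^sup>2" for v using TC i by blast
      qed
      then show "norm (T' i - T i) \<le> 2 * (real (M + 2) * e k)" by (simp add: add.commute)
    qed
    ultimately show ?thesis by blast
  qed
  have "\<exists>T. \<forall>k. Inv k (T k) \<and> Close k (T k) (T (Suc k))"
  proof (rule dependent_nat_choice)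
    show "\<exists>T. Inv 0 T" by (rule exI[of "Inv 0" R, OF start])
    show "\<exists>T'. Inv (Suc k) T' \<and> Close k T T'" if "Inv k T" for T k by (rule step[OF that])
  qed
  then obtain T where TT: "\<forall>k. Inv k (T k) \<and> Close k (T k) (T (Suc k))" by (rule exE)
  then have T: "Inv k (T k)" and TC: "Close k (T k) (T (Suc k))" for k by simp_all
  have "convergent (\<lambda>k. T k i)" if i: "i < M" for i
  proof -
    have "summable (\<lambda>k. T (Suc k) i - T k i)"
    proof (rule summable_comparison_test')
      show "summable (\<lambda>k. 2 * (real (M + 2) * e k))"
        unfolding e_def by (intro summable_mult summable_geometric) simp
      show "norm (T (Suc k) i - T k i) \<le> 2 * (real (M + 2) * e k)" for k
        using TC[of k] i unfolding Close_def by simp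
    qed
    then have "convergent (\<lambda>n. (\<Sum>k<n. T (Suc k) i - T k i) + T 0 i)"
      unfolding summable_iff_convergent by (intro convergent_add convergent_const)
    then show ?thesis by (simp add: sum_lessThan_telescope[of "\<lambda>k. T k i"])
  qed
  then have "\<forall>i. \<exists>h. i < M \<longrightarrow> (\<lambda>k. T k i) \<longlonglongrightarrow> h" unfolding convergent_def by blast
  from choice[OF this] obtain h where hh: "\<forall>i. i < M \<longrightarrow> (\<lambda>k. T k i) \<longlonglongrightarrow> h i" by (rule exE)
  then have h: "(\<lambda>k. T k i) \<longlonglongrightarrow> h i" if "i < M" for i using that by simp
  have hv: "(\<lambda>k. T k i v) \<longlonglongrightarrow> h i v" if "i < M" for i v
    by (rule blinfun.tendsto[OF h[OF that] tendsto_const])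
  have Tsa: "selfadj (T k i)" if "i < M" for k i using T[of k] that unfolding Inv_def by simp
  have "selfadj (h i)" if i: "i < M" for i
    unfolding selfadj_def bounded_ops_iff
  proof (intro conjI allI)
    show "h i (cscale c v) = cscale c (h i v)" for c v
    proof (rule LIMSEQ_unique[OF hv[OF i]])
      have "(\<lambda>k. cscale c (T k i v)) \<longlonglongrightarrow> cscale c (h i v)"
        by (rule bounded_linear.tendsto[OF bounded_linear_cscale hv[OF i]])
      then show "(\<lambda>k. T k i (cscale c v)) \<longlonglongrightarrow> cscale c (h i v)"
        using selfadj_bounded[OF Tsa[OF i]] by (simp add: bounded_ops_iff)
    qed
    show "inner (h i v) w = inner v (h i w)" for v w
    proof (rule LIMSEQ_unique)
      show "(\<lambda>k. inner (T k i v) w) \<longlonglongrightarrow> inner (h i v) w" by (intro tendsto_intros hv i)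
      show "(\<lambda>k. inner (T k i v) w) \<longlonglongrightarrow> inner v (h i w)"
        unfolding selfadj_inner[OF Tsa[OF i]] by (intro tendsto_intros hv i)
    qed
  qed
  moreover have "(\<Sum>i<M. h i v) = v" for v
  proof (rule LIMSEQ_unique)
    show "(\<lambda>k. \<Sum>i<M. T k i v) \<longlonglongrightarrow> (\<Sum>i<M. h i v)" by (intro tendsto_sum hv) simp
    show "(\<lambda>k. \<Sum>i<M. T k i v) \<longlonglongrightarrow> v" using T unfolding Inv_def by simp
  qed
  moreover have "0 \<le> inner (h i v) v" if i: "i < M" for i v
  proof (rule LIMSEQ_le)
    have "(\<lambda>k. - e k * (norm v)\<^sup>2) \<longlonglongrightarrow> - (e0 * 0) * (norm v)\<^sup>2"
      unfolding e_def by (intro tendsto_intros LIMSEQ_power_zero) simp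
    then show "(\<lambda>k. - e k * (norm v)\<^sup>2) \<longlonglongrightarrow> 0" by simp
    show "(\<lambda>k. inner (T k i v) v) \<longlonglongrightarrow> inner (h i v) v" by (intro tendsto_intros hv i)
    show "\<exists>N. \<forall>k\<ge>N. - e k * (norm v)\<^sup>2 \<le> inner (T k i v) v" using T i unfolding Inv_def by blast
  qed
  moreover have "\<exists>N. \<forall>v. trunc N v = 0 \<longrightarrow>
       \<bar>inner (blinfun_apply (h i) v) v - inner (blinfun_apply (R i) v) v\<bar> \<le> d * (norm v)\<^sup>2"
    if i: "i < M" and d: "0 < d" for i d
  proof -
    \<comment> \<open>Beyond the cut-off of round \<open>k\<close> the form of \<open>R i\<close> is
      that of \<open>T k i\<close>, so there the difference is controlled by the norm distance
      between \<open>T k i\<close> and the limit.\<close>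
    obtain k where k: "norm (T k i - h i) < d" using LIMSEQ_D[OF h[OF i] d] by blast
    obtain N where N: "\<forall>i<M. \<forall>v. trunc N v = 0 \<longrightarrow> inner (T k i v) v = inner (R i v) v"
      using T[of k] unfolding Inv_def by blast
    have "\<bar>inner (h i v) v - inner (R i v) v\<bar> \<le> d * (norm v)\<^sup>2" if v: "trunc N v = 0" for v
    proof -
      have "\<bar>inner (h i v) v - inner (R i v) v\<bar> = \<bar>inner ((T k i - h i) v) v\<bar>"
        using N i v by (simp add: blinfun.diff_left inner_diff_left abs_minus_commute)
      also have "\<dots> \<le> norm (T k i - h i) * norm v * norm v"
        by (rule order_trans[OF Cauchy_Schwarz_ineq2]) (intro mult_right_mono norm_blinfun norm_ge_zero)
      also have "\<dots> \<le> d * norm v * norm v" using k by (intro mult_right_mono) simp_all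
      finally show ?thesis by (simp add: power2_eq_square mult_ac)
    qed
    then show ?thesis by blast
  qed
  ultimately show ?thesis by (intro exI[of _ h] conjI) simp_all
qed

subsection \<open>Smith--Ward geometry\<close>

lemma affine_list_BH:
  "distinct ls \<Longrightarrow> blinfun_apply (affine_list BH c b x ls) v = c *\<^sub>R v + (\<Sum>l\<in>set ls. b l *\<^sub>R blinfun_apply (x l) v)"
  by (induction ls) (simp_all add: blinfun.add_left cscale_simps)

lemma affine_op_BH:
  "blinfun_apply (affine_op BH c b x) v = c *\<^sub>R v + (\<Sum>l\<in>UNIV. b l *\<^sub>R blinfun_apply (x l) v)"
  unfolding affine_op_def affine_list_BH[OF enum_list(2)] enum_list(1) ..

lemma selfadj_positive:
  assumes "selfadj T" "\<And>v. 0 \<le> inner (blinfun_apply T v) v"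
  shows "positive BH T"
  using assms by (simp add: positive_def selfadj_cip selfadj_bounded)

context simplex_coords
begin

lemma M_pos: "0 < M"
  using sum_\<alpha> by (cases M) auto

text \<open>The matrix expansion in \<open>nc_simplex_coordinates\<close>, read at a tuple of 1 by 1
  matrices.\<close>

lemma barycentric:
  assumes p: "p \<in> Delta"
  shows "vec_nth p l = (\<Sum>i<M. vec_nth (V i) l * (\<alpha> i + (\<Sum>k\<in>UNIV. \<beta> i k * vec_nth p k)))"
proof -
  define a where "a = point_tuple (complexify p)"
  have "a \<in> level nc_simplex 1" unfolding level_1_nc_simplex a_def using p by blast
  then have a: "a \<in> nc_simplex" "a \<in> tuples 1" by (auto simp: level_def)
  have ent: "a k $$ (0, 0) = of_real (vec_nth p k)" for k
    by (simp add: a_def point_tuple_def complexify_def)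
  have "complex_of_real (vec_nth p l)
      = (\<Sum>i<M. of_real (vec_nth (V i) l) * affine_form (\<alpha> i) (\<beta> i) a 0 0)"
    using nc_simplex_coordinates(3)[OF a, of 0 0 l] unfolding ent by (simp del: of_real_sum)
  also have "\<dots> = of_real (\<Sum>i<M. vec_nth (V i) l * (\<alpha> i + (\<Sum>k\<in>UNIV. \<beta> i k * vec_nth p k)))"
    by (simp add: affine_form_def ent)
  finally show ?thesis by (simp only: of_real_eq_iff)
qed

lemma coordinate_nonneg:
  assumes "p \<in> Delta" "i < M"
  shows "0 \<le> \<alpha> i + (\<Sum>k\<in>UNIV. \<beta> i k * vec_nth p k)"
  by (rule nonneg_on_Delta[OF _ assms(1)]) (use assms(2) dual in \<open>simp add: nonneg_on_def\<close>)

text \<open>An affine function of \<open>y\<close> is the sum of the \<open>h i\<close> weighted by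
  its values at the vertices, so positivity of the \<open>h i\<close> keeps the matrix range inside.
  Conversely \<open>ket j\<close> is a joint eigenvector at which \<open>y\<close> takes the value
  \<open>V j\<close>; combining these vector states along a rank-one representation reaches every
  tuple of the set.\<close>

lemma matrix_range_combination:
  assumes h: "\<And>i. i < M \<Longrightarrow> selfadj (h i)" "\<And>i v. i < M \<Longrightarrow> 0 \<le> inner (blinfun_apply (h i) v) v"
    and one: "\<And>v. (\<Sum>i<M. blinfun_apply (h i) v) = v"
    and ev: "\<And>i j. i < M \<Longrightarrow> j < M \<Longrightarrow> blinfun_apply (h i) (ket j) = (if i = j then ket j else 0)"
    and y: "\<And>l. y l = (\<Sum>i<M. vec_nth (V i) l *\<^sub>R h i)"
  shows "matrix_range BH y = nc_simplex"
proof (intro Set.equalityI subsetI)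
  have yv: "blinfun_apply (y l) v = (\<Sum>i<M. vec_nth (V i) l *\<^sub>R h i v)" for l v
    by (simp add: y blinfun.sum_left blinfun.scaleR_left)
  have "matrix_range BH y \<subseteq> nc_simplex"
  proof (rule matrix_range_subset_nc_simplex)
    fix c b assume cb: "nonneg_on c b"
    have eq: "affine_op BH c b y = (\<Sum>i<M. (c + (\<Sum>l\<in>UNIV. b l * vec_nth (V i) l)) *\<^sub>R h i)"
    proof (rule blinfun_eqI)
      fix v
      have "affine_op BH c b y v = c *\<^sub>R (\<Sum>i<M. h i v) + (\<Sum>l\<in>UNIV. \<Sum>i<M. (b l * vec_nth (V i) l) *\<^sub>R h i v)"
        unfolding affine_op_BH one yv by (simp add: scaleR_sum_right)
      also have "(\<Sum>l\<in>UNIV. \<Sum>i<M. (b l * vec_nth (V i) l) *\<^sub>R h i v)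
          = (\<Sum>i<M. \<Sum>l\<in>UNIV. (b l * vec_nth (V i) l) *\<^sub>R h i v)" by (rule sum.swap)
      finally show "affine_op BH c b y v = (\<Sum>i<M. (c + (\<Sum>l\<in>UNIV. b l * vec_nth (V i) l)) *\<^sub>R h i) v"
        by (simp add: blinfun.sum_left blinfun.add_left blinfun.scaleR_left scaleR_left_distrib scaleR_sum_right
            scaleR_sum_left sum.distrib)
    qed
    show "positive BH (affine_op BH c b y)"
    proof (rule selfadj_positive)
      show "selfadj (affine_op BH c b y)"
        unfolding eq by (intro selfadj_sum selfadj_simps h) simp
      show "0 \<le> inner (affine_op BH c b y v) v" for v
        unfolding eq using cb h(2)
        by (auto simp: blinfun.sum_left blinfun.scaleR_left inner_sum_left nonneg_on_def intro!: sum_nonneg)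
    qed
  qed
  then show "a \<in> nc_simplex" if "a \<in> matrix_range BH y" for a using that by blast
  fix a assume a: "a \<in> nc_simplex"
  then obtain n where n: "1 \<le> n" "a \<in> tuples n" unfolding nc_simplex_def by blast
  obtain N :: nat and \<kappa> w where \<kappa>: "\<And>j. j < N \<Longrightarrow> \<kappa> j < M"
    and w: "\<And>r s. r < n \<Longrightarrow> s < n \<Longrightarrow> (\<Sum>j<N. w j r * cnj (w j s)) = of_bool (r = s)"
    and al: "\<And>l r s. r < n \<Longrightarrow> s < n \<Longrightarrow>
       a l $$ (r, s) = (\<Sum>j<N. of_real (vec_nth (V (\<kappa> j)) l) * (w j r * cnj (w j s)))"
    by (rule nc_simplex_rank_one[OF a n(2)]) (rule that)
  define \<psi> where "\<psi> j T = cip (blinfun_apply T (ket (\<kappa> j))) (ket (\<kappa> j))" for j T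
  define \<phi> where "\<phi> T = Matrix.mat n n (\<lambda>(r, s). \<Sum>j<N. \<psi> j T * (w j r * cnj (w j s)))" for T
  have ket1: "cip (ket i) (ket i) = 1" for i
  proof -
    have "trunc (Suc i) (ket i) = ket i" by (rule ell2_eqI) simp
    then have "cip (ket i) (ket i) = cip (trunc (Suc i) (ket i)) (ket i)" by simp
    then show ?thesis unfolding cip_eq_sum_trunc by simp
  qed
  then have "complex_of_real ((norm (ket i))\<^sup>2) = of_real 1" for i unfolding cip_self by simp
  then have "(norm (ket i))\<^sup>2 = 1" for i unfolding of_real_eq_iff .
  then have kn: "norm (ket i) = 1" for i
    using power2_eq_imp_eq[of "norm (ket i)" 1] by simp
  have "ucp BH (cstar BH y) n \<phi>"
    unfolding \<phi>_def by (rule ucp_of_states[OF _ w]) (simp add: \<psi>_def vector_state_BH kn)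
  then have "(\<lambda>l. \<phi> (y l)) \<in> matrix_range BH y"
    unfolding matrix_range_def using n(1) by blast
  moreover have "\<phi> (y l) = a l" for l
  proof (rule eq_matI)
    have "\<psi> j (y l) = of_real (vec_nth (V (\<kappa> j)) l)" if "j < N" for j
    proof -
      have "y l (ket (\<kappa> j)) = (\<Sum>i<M. if i = \<kappa> j then vec_nth (V i) l *\<^sub>R ket (\<kappa> j) else 0)"
        unfolding yv by (rule sum.cong[OF refl]) (simp add: ev \<kappa>[OF that])
      also have "\<dots> = vec_nth (V (\<kappa> j)) l *\<^sub>R ket (\<kappa> j)" using \<kappa>[OF that] by simp
      finally show ?thesis by (simp add: \<psi>_def cip_simps ket1)
    qed
    moreover have "a l \<in> carrier_mat n n" using n(2) by (simp add: tuples_def)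
    ultimately show "dim_row (\<phi> (y l)) = dim_row (a l)" "dim_col (\<phi> (y l)) = dim_col (a l)"
      "\<And>r s. r < dim_row (a l) \<Longrightarrow> s < dim_col (a l) \<Longrightarrow> \<phi> (y l) $$ (r, s) = a l $$ (r, s)"
      by (auto simp: \<phi>_def al)
  qed
  ultimately show "a \<in> matrix_range BH y" by simp
qed

lemma smith_ward_nc_simplex: "smith_ward_geometry nc_simplex"
  unfolding smith_ward_geometry_def
proof (intro allI impI)
  fix x :: "'d \<Rightarrow> ell2 \<Rightarrow>\<^sub>L ell2"
  assume x': "(\<forall>l. x l \<in> bounded_ops) \<and> ess_matrix_range x = nc_simplex"
  then have x: "\<And>l. x l \<in> bounded_ops" and ess: "ess_matrix_range x = nc_simplex" by auto
  have "\<forall>l. \<exists>S. S \<in> bounded_ops \<and> (\<forall>v w. cip (x l v) w = cip v (blinfun_apply S w))"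
    using adjoint_exists[OF x] by blast
  from choice[OF this] obtain X where X: "\<forall>l. X l \<in> bounded_ops \<and> (\<forall>v w. cip (x l v) w = cip v (blinfun_apply (X l) w))"
    by (rule exE)
  have Xi: "inner (x l v) w = inner v (X l w)" for l v w unfolding Re_cip[symmetric] using X by simp
  have Xi': "inner (X l v) w = inner v (x l w)" for l v w using Xi[of l w v] by (simp add: inner_commute)
  \<comment> \<open>The \<open>x l\<close> need not be self-adjoint. Their essential numerical range
    is real, however, so their imaginary parts turn out compact and are absorbed by the perturbation
    \<open>k\<close>.\<close>
  define re where "re l = (1 / 2) *\<^sub>R (x l + X l)" for l
  have re: "selfadj (re l)" for l
    unfolding selfadj_def re_def using x X
    by (auto simp: blinfun.scaleR_left blinfun.add_left inner_add_left inner_add_right Xi Xi'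
        intro!: bounded_ops_closed)
  have re_form: "inner (re l v) v = Re (cip (x l v) v)" for l v
    using Xi'[of l v v] inner_commute[of v "x l v"]
    by (simp add: re_def blinfun.scaleR_left blinfun.add_left inner_add_left Re_cip)
  define R where "R i = \<alpha> i *\<^sub>R id_blinfun + (\<Sum>l\<in>UNIV. \<beta> i l *\<^sub>R re l)" for i
  have Rsa: "selfadj (R i)" for i unfolding R_def by (intro selfadj_simps selfadj_sum re)
  have Rv: "blinfun_apply (R i) v = \<alpha> i *\<^sub>R v + (\<Sum>l\<in>UNIV. \<beta> i l *\<^sub>R re l v)" for i v
    by (simp add: R_def blinfun.add_left blinfun.scaleR_left blinfun.sum_left)
  have Rone: "(\<Sum>i<M. R i v) = v" for v
  proof -
    have "(\<Sum>i<M. R i v) = (\<Sum>i<M. \<alpha> i) *\<^sub>R v + (\<Sum>l\<in>UNIV. (\<Sum>i<M. \<beta> i l) *\<^sub>R re l v)"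
      unfolding Rv sum.distrib scaleR_sum_left by (subst sum.swap) (rule refl)
    then show ?thesis by (simp add: sum_\<alpha> sum_\<beta>)
  qed
  have Rform: "inner (R i v) v = \<alpha> i * (norm v)\<^sup>2 + (\<Sum>l\<in>UNIV. \<beta> i l * Re (cip (x l v) v))" for i v
    unfolding Rv inner_add_left inner_sum_left inner_scaleR_left re_form by (simp add: power2_norm_eq_inner)
  \<comment> \<open>The Lipschitz constant for passing from an error in the values of
    \<open>x\<close> to an error in the coordinates \<open>R i\<close>, uniform in
    \<open>i\<close>.\<close>
  define B where "B = (\<Sum>i<M. \<Sum>l\<in>UNIV. \<bar>\<beta> i l\<bar>)"
  have B: "0 \<le> B" unfolding B_def by (intro sum_nonneg) simp
  have near: "\<exists>N. \<forall>v. norm v = 1 \<and> trunc N v = 0 \<longrightarrow> (\<exists>p\<in>Delta.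
      (\<forall>l. cmod (cip (x l v) v - of_real (vec_nth p l)) < d) \<and>
      (\<forall>i<M. \<bar>inner (R i v) v - (\<alpha> i + (\<Sum>k\<in>UNIV. \<beta> i k * vec_nth p k))\<bar> \<le> B * d))" if d: "0 < d" for d
  proof -
    obtain N where N: "\<forall>v. norm v = 1 \<and> trunc N v = 0 \<longrightarrow>
        (\<exists>p\<in>Delta. \<forall>l. cmod (cip (x l v) v - of_real (vec_nth p l)) < d)"
      using essential_numerical_range[of x, OF _ d] ess by blast
    show ?thesis
    proof (intro exI[of _ N] allI impI)
      fix v assume v: "norm v = 1 \<and> trunc N v = 0"
      then obtain p where p: "p \<in> Delta" "\<forall>l. cmod (cip (x l v) v - of_real (vec_nth p l)) < d"
        using N by blast
      have "\<bar>inner (R i v) v - (\<alpha> i + (\<Sum>k\<in>UNIV. \<beta> i k * vec_nth p k))\<bar> \<le> B * d" if i: "i < M" for i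
      proof -
        have "inner (R i v) v - (\<alpha> i + (\<Sum>k\<in>UNIV. \<beta> i k * vec_nth p k))
            = (\<Sum>k\<in>UNIV. \<beta> i k * Re (cip (x k v) v - of_real (vec_nth p k)))"
          unfolding Rform using v by (simp add: sum_subtractf right_diff_distrib)
        also have "\<bar>\<dots>\<bar> \<le> (\<Sum>k\<in>UNIV. \<bar>\<beta> i k\<bar> * d)"
        proof (rule order_trans[OF sum_abs], rule sum_mono)
          fix k
          have "\<bar>Re (cip (x k v) v - of_real (vec_nth p k))\<bar> \<le> d"
            using abs_Re_le_cmod[of "cip (x k v) v - of_real (vec_nth p k)"] p(2)[rule_format, of k] by linarith
          then show "\<bar>\<beta> i k * Re (cip (x k v) v - of_real (vec_nth p k))\<bar> \<le> \<bar>\<beta> i k\<bar> * d"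
            unfolding abs_mult by (rule mult_left_mono) simp
        qed
        also have "\<dots> = (\<Sum>k\<in>UNIV. \<bar>\<beta> i k\<bar>) * d" by (simp add: sum_distrib_right)
        also have "\<dots> \<le> B * d"
        proof (rule mult_right_mono)
          show "(\<Sum>k\<in>UNIV. \<bar>\<beta> i k\<bar>) \<le> B" unfolding B_def
            by (rule member_le_sum[of i "{..<M}" "\<lambda>i. \<Sum>k\<in>UNIV. \<bar>\<beta> i k\<bar>"]) (use i in \<open>auto intro: sum_nonneg\<close>)
        qed (use d in simp)
        finally show ?thesis .
      qed
      then show "\<exists>p\<in>Delta. (\<forall>l. cmod (cip (x l v) v - of_real (vec_nth p l)) < d) \<and>
          (\<forall>i<M. \<bar>inner (R i v) v - (\<alpha> i + (\<Sum>k\<in>UNIV. \<beta> i k * vec_nth p k))\<bar> \<le> B * d)"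
        using p by (intro bexI[of _ p] conjI) simp_all
    qed
  qed
  have unit: "\<exists>u. norm u = 1 \<and> trunc N u = 0 \<and> v = norm v *\<^sub>R u" if "v \<noteq> 0" "trunc N v = 0" for v N
    by (rule exI[of _ "(1 / norm v) *\<^sub>R v"]) (use that in \<open>simp add: trunc_simps\<close>)
  have far: "\<exists>N. \<forall>i<M. \<forall>v. trunc N v = 0 \<longrightarrow> - d * (norm v)\<^sup>2 \<le> inner (R i v) v" if d: "0 < d" for d
  proof -
    \<comment> \<open>The added 1 covers the case \<open>B = 0\<close>.\<close>
    have "0 < d / (B + 1)" using d B by simp
    from near[OF this] obtain N where N: "\<forall>v. norm v = 1 \<and> trunc N v = 0 \<longrightarrow> (\<exists>p\<in>Delta.
      (\<forall>l. cmod (cip (x l v) v - of_real (vec_nth p l)) < d / (B + 1)) \<and>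
      (\<forall>i<M. \<bar>inner (R i v) v - (\<alpha> i + (\<Sum>k\<in>UNIV. \<beta> i k * vec_nth p k))\<bar> \<le> B * (d / (B + 1))))"
      by (rule exE)
    have Bd: "B * (d / (B + 1)) \<le> d" using B d by (simp add: divide_le_eq algebra_simps)
    have "- d * (norm v)\<^sup>2 \<le> inner (R i v) v" if i: "i < M" and v: "trunc N v = 0" for i v
    proof (cases "v = 0")
      case False
      then obtain u where u: "norm u = 1" "trunc N u = 0" "v = norm v *\<^sub>R u" using unit v by blast
      then obtain p where p: "p \<in> Delta"
        "\<bar>inner (R i u) u - (\<alpha> i + (\<Sum>k\<in>UNIV. \<beta> i k * vec_nth p k))\<bar> \<le> B * (d / (B + 1))"
        using N i by blast
      then have "- d \<le> inner (R i u) u" using coordinate_nonneg[OF p(1) i] Bd by linarith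
      then have "(norm v)\<^sup>2 * (- d) \<le> (norm v)\<^sup>2 * inner (R i u) u" by (rule mult_left_mono) simp
      moreover have "inner (R i v) v = inner (R i (norm v *\<^sub>R u)) (norm v *\<^sub>R u)" using u(3) by simp
      ultimately show ?thesis by (simp add: blinfun.scaleR_right power2_eq_square mult_ac)
    qed simp
    then show ?thesis by blast
  qed
  obtain h where
    h: "\<forall>i<M. selfadj (h i)" "\<forall>v. (\<Sum>i<M. blinfun_apply (h i) v) = v"
      "\<forall>i<M. \<forall>v. 0 \<le> inner (blinfun_apply (h i) v) v"
    and hR: "\<forall>i<M. \<forall>d>0. \<exists>N. \<forall>v. trunc N v = 0 \<longrightarrow>
       \<bar>inner (blinfun_apply (h i) v) v - inner (blinfun_apply (R i) v) v\<bar> \<le> d * (norm v)\<^sup>2"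
    by (atomize_elim, rule positive_lift[OF M_pos Rsa Rone far])
  \<comment> \<open>The projection onto the single basis vector \<open>ket i\<close>; these
    telescope to \<open>trunc M\<close>.\<close>
  define E where "E i = trunc_op (Suc i) - trunc_op i" for i
  have Ev: "E i v = trunc (Suc i) v - trunc i v" for i v by (simp add: E_def blinfun.diff_left)
  \<comment> \<open>The first \<open>M\<close> coordinates are reserved for the vertices, one basis
    vector each. This is a finite-rank change of \<open>h i\<close>, invisible to the form beyond
    \<open>M\<close>, and it preserves positivity and the sum.\<close>
  define g where "g i = pinch M (E i) (h i)" for i
  have gsa: "selfadj (g i)" if "i < M" for i
    unfolding g_def E_def using h(1) that by (intro selfadj_pinch selfadj_simps) simp_all
  have gone: "(\<Sum>i<M. g i v) = v" for v
    unfolding g_def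
  proof (rule sum_pinch)
    fix v
    have "(\<Sum>i<M. E i (trunc M v)) = trunc M (trunc M v) - trunc 0 (trunc M v)"
      unfolding Ev by (rule sum_lessThan_telescope)
    also have "\<dots> = trunc M v" by (rule ell2_eqI) simp
    finally show "(\<Sum>i<M. E i (trunc M v)) = trunc M v" .
  qed (use h(2) in simp)
  have gpos: "0 \<le> inner (g i v) v" if i: "i < M" for i v
  proof -
    have "inner (E i u) u = (norm (E i u))\<^sup>2" for u
      by (simp add: Ev power2_norm_eq_inner inner_diff_left inner_diff_right inner_trunc trunc_trunc min_def)
    then show ?thesis unfolding g_def inner_pinch using h(3) i by simp
  qed
  have gket: "g i (ket j) = (if i = j then ket j else 0)" if "i < M" "j < M" for i j
  proof -
    have t: "trunc n (ket j) = (if j < n then ket j else 0)" for n by (rule ell2_eqI) auto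
    show ?thesis unfolding g_def pinch_apply Ev using that by (auto simp: t trunc_simps)
  qed
  define k where "k l = (\<Sum>i<M. vec_nth (V i) l *\<^sub>R g i) - x l" for l
  have kb: "k l \<in> bounded_ops" for l
    unfolding k_def by (intro bounded_ops_closed bounded_ops_sum x selfadj_bounded gsa) simp
  have "compact_op (k l)" for l
  proof (rule compact_opI[OF kb])
    fix d :: real assume d: "0 < d"
    define A where "A = (\<Sum>i<M. \<bar>vec_nth (V i) l\<bar>)"
    have A: "0 \<le> A" unfolding A_def by (intro sum_nonneg) simp
    \<comment> \<open>Replacing the coordinate of \<open>p\<close> by \<open>g i\<close> costs
      \<open>d'\<close> from the lifting and \<open>B * d'\<close> from \<open>R i\<close>; weighted
      by the vertices this is \<open>A * (1 + B) * d'\<close>, and comparing \<open>x l\<close> with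
      \<open>p\<close> adds \<open>d'\<close>. The denominator makes the total equal to
      \<open>d\<close>.\<close>
    define d' where "d' = d / (A + A * B + 1)"
    have AB: "0 < A + A * B + 1" using A B by (simp add: add_nonneg_pos)
    have d': "0 < d'" using d AB by (simp add: d'_def)
    obtain N1 where N1: "\<forall>v. norm v = 1 \<and> trunc N1 v = 0 \<longrightarrow> (\<exists>p\<in>Delta.
      (\<forall>l. cmod (cip (x l v) v - of_real (vec_nth p l)) < d') \<and>
      (\<forall>i<M. \<bar>inner (R i v) v - (\<alpha> i + (\<Sum>k\<in>UNIV. \<beta> i k * vec_nth p k))\<bar> \<le> B * d'))"
      using near[OF d'] by (rule exE)
    have "\<forall>i. \<exists>N. i < M \<longrightarrow> (\<forall>v. trunc N v = 0 \<longrightarrow> \<bar>inner (h i v) v - inner (R i v) v\<bar> \<le> d' * (norm v)\<^sup>2)"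
      using hR d' by blast
    from choice[OF this] obtain N2 where N2: "\<forall>i. i < M \<longrightarrow> (\<forall>v. trunc (N2 i) v = 0 \<longrightarrow>
        \<bar>inner (h i v) v - inner (R i v) v\<bar> \<le> d' * (norm v)\<^sup>2)" by (rule exE)
    define N where "N = M + N1 + (\<Sum>i<M. N2 i)"
    have tz: "trunc n v = 0" if "trunc N v = 0" "n \<le> N" for n v
    proof -
      have "trunc n v = trunc n (trunc N v)" using that(2) by (simp add: trunc_trunc min_absorb1)
      then show ?thesis by (simp add: that(1) trunc_simps)
    qed
    have small: "cmod (cip (k l u) u) \<le> d" if u: "norm u = 1" "trunc N u = 0" for u
    proof -
      obtain p where p: "p \<in> Delta" "cmod (cip (x l u) u - of_real (vec_nth p l)) < d'"
        "\<forall>i<M. \<bar>inner (R i u) u - (\<alpha> i + (\<Sum>k\<in>UNIV. \<beta> i k * vec_nth p k))\<bar> \<le> B * d'"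
        using N1 u(1) tz[OF u(2), of N1] by (auto simp: N_def)
      have gi: "\<bar>inner (g i u) u - (\<alpha> i + (\<Sum>k\<in>UNIV. \<beta> i k * vec_nth p k))\<bar> \<le> (1 + B) * d'" if i: "i < M" for i
      proof -
        have "trunc M u = 0" using tz[OF u(2), of M] by (simp add: N_def)
        then have "inner (g i u) u = inner (h i u) u" by (simp add: g_def inner_pinch)
        moreover have "N2 i \<le> (\<Sum>i<M. N2 i)" by (rule member_le_sum) (use i in auto)
        then have "trunc (N2 i) u = 0" using tz[OF u(2), of "N2 i"] by (simp add: N_def)
        then have "\<bar>inner (h i u) u - inner (R i u) u\<bar> \<le> d'"
          using N2[rule_format, OF i, of u] u(1) by simp
        ultimately show ?thesis using p(3)[rule_format, OF i] by (simp add: distrib_right)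
      qed
      have "cip (k l u) u = (\<Sum>i<M. of_real (vec_nth (V i) l * inner (g i u) u)) - cip (x l u) u"
        by (simp add: k_def blinfun.diff_left blinfun.sum_left blinfun.scaleR_left cip_simps cip_sum_left
            selfadj_cip[OF gsa])
      also have "\<dots> = of_real (\<Sum>i<M. vec_nth (V i) l * (inner (g i u) u
            - (\<alpha> i + (\<Sum>k\<in>UNIV. \<beta> i k * vec_nth p k)))) - (cip (x l u) u - of_real (vec_nth p l))"
        unfolding barycentric[OF p(1), of l] by (simp add: right_diff_distrib sum_subtractf)
      also have "cmod \<dots> \<le> (\<Sum>i<M. \<bar>vec_nth (V i) l\<bar> * ((1 + B) * d')) + d'"
      proof (rule order_trans[OF norm_triangle_ineq4 add_mono])
        show "cmod (of_real (\<Sum>i<M. vec_nth (V i) l * (inner (g i u) u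
            - (\<alpha> i + (\<Sum>k\<in>UNIV. \<beta> i k * vec_nth p k))))) \<le> (\<Sum>i<M. \<bar>vec_nth (V i) l\<bar> * ((1 + B) * d'))"
          unfolding norm_of_real
        proof (rule order_trans[OF sum_abs sum_mono])
          fix i assume "i \<in> {..<M}"
          then show "\<bar>vec_nth (V i) l * (inner (g i u) u - (\<alpha> i + (\<Sum>k\<in>UNIV. \<beta> i k * vec_nth p k)))\<bar>
              \<le> \<bar>vec_nth (V i) l\<bar> * ((1 + B) * d')"
            unfolding abs_mult using gi by (intro mult_left_mono) simp_all
        qed
      qed (use p(2) in simp)
      also have "\<dots> = A * ((1 + B) * d') + d'" by (simp only: A_def sum_distrib_right)
      also have "\<dots> = (A + A * B + 1) * d'" by (simp add: algebra_simps)
      also have "\<dots> = d" using AB by (simp add: d'_def)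
      finally show ?thesis .
    qed
    have "cmod (cip (k l v) v) \<le> d * (norm v)\<^sup>2" if v: "trunc N v = 0" for v
    proof (cases "v = 0")
      case False
      then obtain u where u: "norm u = 1" "trunc N u = 0" "v = norm v *\<^sub>R u" using unit v by blast
      have "cip (k l v) v = cip (k l (norm v *\<^sub>R u)) (norm v *\<^sub>R u)" using u(3) by simp
      then have "cmod (cip (k l v) v) = (norm v)\<^sup>2 * cmod (cip (k l u) u)"
        by (simp add: blinfun.scaleR_right cip_simps norm_mult power2_eq_square)
      also have "\<dots> \<le> (norm v)\<^sup>2 * d" by (rule mult_left_mono[OF small[OF u(1,2)]]) simp
      finally show ?thesis by (simp add: mult.commute)
    qed (simp add: cip_simps)
    then show "\<exists>N. \<forall>v. trunc N v = 0 \<longrightarrow> cmod (cip (k l v) v) \<le> d * (norm v)\<^sup>2" by blast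
  qed
  moreover have "matrix_range BH (\<lambda>l. x l + k l) = nc_simplex"
    by (rule matrix_range_combination[OF gsa gpos gone gket]) (simp_all add: k_def)
  ultimately show "smith_ward_property x"
    unfolding smith_ward_property_def using ess by (intro exI[of _ k]) simp
qed

end

theorem proposition3p1:
  fixes K :: "(real^'d) set" and m :: int
  assumes "m simplex K" and "0 \<le> m"
  shows "\<exists>Knc. compact_matrix_convex Knc \<and>
           level Knc 1 = point_tuple ` complexify ` K \<and>
           (\<forall>L. matrix_convex L \<and> level L 1 = point_tuple ` complexify ` K \<longrightarrow> L = Knc) \<and>
           Knc = K_min (complexify ` K) \<and>
           Knc = K_max (complexify ` K) \<and>
           smith_ward_geometry Knc"
proof -
  obtain V M \<alpha> \<beta> where sc: "simplex_coords V M \<alpha> \<beta>" and K: "K = simplex_coords.Delta V M"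
    using simplex_coords_exist[OF assms] by blast
  interpret simplex_coords V M \<alpha> \<beta> by (rule sc)
  show ?thesis
    unfolding K
  proof (intro exI[of _ nc_simplex] conjI allI impI)
    show "compact_matrix_convex nc_simplex"
      unfolding compact_matrix_convex_def using matrix_convex_nc_simplex compact_level_nc_simplex by simp
    show "level nc_simplex 1 = point_tuple ` complexify ` Delta" by (rule level_1_nc_simplex)
    show "L = nc_simplex" if "matrix_convex L \<and> level L 1 = point_tuple ` complexify ` Delta" for L
      using that matrix_convex_unique by simp
    show "nc_simplex = K_min (complexify ` Delta)" by (rule nc_simplex_eq_K_min)
    show "nc_simplex = K_max (complexify ` Delta)" by (rule nc_simplex_eq_K_max)
    show "smith_ward_geometry nc_simplex" by (rule smith_ward_nc_simplex)
  qed
qed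

end
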